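(* Let $Q$ be a positive-definite quadratic form over the integers of rank $n$ and determinant $3$. Then either $Q$ has a characteristic vector $x$ with $Q(x,x)\le n+2$, or it has a characteristic covector $y$ with $Q'(y,y)\le n-\frac{2}{3}$. Moreover, at least one of these inequalities is strict unless $Q$ is diagonal; that is, if $Q$ is not diagonal, then there is a characteristic vector $x$ with $Q(x,x)<n+2$ or a characteristic covector $y$ with $Q'(y,y)<n-\frac23$.
   Context: A quadratic form $Q$ of rank $n$ over the integers is a symmetric bilinear form $Q:\mathbb{Z}^n\times\mathbb{Z}^n\to\mathbb{Z}$, identified with the symmetric integer matrix with entries $Q(e_i,e_j)$; its determinant is the determinant of this matrix. Two matrices $Q_1,Q_2$ represent the same form iff $Q_1=P^TQ_2P$ for some $P\in GL(n,\mathbb{Z})$; $Q$ is diagonal if it is represented by a diagonal matrix. $Q'$ is the induced ($\mathbb{Q}$-valued) form on the dual $\mathbb{Z}^n$, given by the inverse matrix $Q^{-1}$. A vector $x\in\mathbb{Z}^n$ is a characteristic vector for $Q$ if $Q(x,\xi)\equiv Q(\xi,\xi)\pmod 2$ for all $\xi\in\mathbb{Z}^n$. An element $y$ of the dual $\mathbb{Z}^n$ is a characteristic covector for $Q$ if $(y,\xi)\equiv Q(\xi,\xi)\pmod 2$ for all $\xi\in\mathbb{Z}^n$, where $(\cdot,\cdot)$ is the evaluation pairing (the standard dot product in dual bases). *)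

theory Defs
  imports "HOL-Analysis.Analysis" "HOL-Number_Theory.Cong"
begin

text \<open>
  A form of rank \<open>n\<close> is given by its symmetric Gram matrix of type \<open>int^'n^'n\<close>, where
  \<open>n = CARD('n)\<close>. Elements of the dual lattice are coordinate vectors in the dual basis, so
  evaluation of a covector on a vector is \<open>scalar_product\<close>.
\<close>

definition symmetric_form :: "int^'n^'n \<Rightarrow> bool" where
  "symmetric_form Q \<longleftrightarrow> transpose Q = Q"

definition form :: "'a::semiring_1^'n^'n \<Rightarrow> 'a^'n \<Rightarrow> 'a^'n \<Rightarrow> 'a" where
  "form Q x y = scalar_product x (Q *v y)"

definition positive_definite :: "int^'n^'n \<Rightarrow> bool" where
  "positive_definite Q \<longleftrightarrow> (\<forall>x. x \<noteq> 0 \<longrightarrow> form Q x x > 0)"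

text \<open>Over \<open>int\<close>, \<open>invertible P\<close> asks for an integral inverse, that is, \<open>P \<in> GL(n, \<int>)\<close>.\<close>

definition same_form :: "int^'n^'n \<Rightarrow> int^'n^'n \<Rightarrow> bool" where
  "same_form Q1 Q2 \<longleftrightarrow> (\<exists>P. invertible P \<and> Q1 = transpose P ** Q2 ** P)"

definition diagonal_matrix :: "int^'n^'n \<Rightarrow> bool" where
  "diagonal_matrix D \<longleftrightarrow> (\<forall>i j. i \<noteq> j \<longrightarrow> D $ i $ j = 0)"

definition diagonal_form :: "int^'n^'n \<Rightarrow> bool" where
  "diagonal_form Q \<longleftrightarrow> (\<exists>D. diagonal_matrix D \<and> same_form D Q)"

text \<open>
  The inverse is taken over the rationals, as \<open>matrix_inv\<close> over \<open>int\<close> is unspecified unless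
  the determinant is \<open>\<plusminus>1\<close>. \<open>dual_form\<close> is meaningful for nonsingular \<open>Q\<close> only.
\<close>

definition dual_form :: "int^'n^'n \<Rightarrow> int^'n \<Rightarrow> int^'n \<Rightarrow> rat" where
  "dual_form Q y z =
     form (matrix_inv (map_matrix of_int Q)) (\<chi> i. of_int (y $ i)) (\<chi> i. of_int (z $ i))"

definition characteristic_vector :: "int^'n^'n \<Rightarrow> int^'n \<Rightarrow> bool" where
  "characteristic_vector Q x \<longleftrightarrow> (\<forall>\<xi>. [form Q x \<xi> = form Q \<xi> \<xi>] (mod 2))"

definition characteristic_covector :: "int^'n^'n \<Rightarrow> int^'n \<Rightarrow> bool" where
  "characteristic_covector Q y \<longleftrightarrow> (\<forall>\<xi>. [scalar_product y \<xi> = form Q \<xi> \<xi>] (mod 2))"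

end

theory Submission
  imports Defs "HOL-Probability.Probability" "HOL-Complex_Analysis.Complex_Analysis"
begin

no_notation fps_nth (infixl \<open>$\<close> 75)

text \<open>
  The discriminant group of \<open>Q\<close> is cyclic of order \<open>3\<close>, and its generator has norm \<open>2/3\<close> or \<open>1/3\<close>
  modulo \<open>1\<close>. Accordingly \<open>Q\<close> can be glued to \<open>\<langle>3\<rangle>\<close> or to the root lattice \<open>A\<^sub>2\<close>, which gives a
  unimodular form \<open>L\<close> of rank \<open>n + 1\<close> or \<open>n + 2\<close>. Characteristic vectors of \<open>L\<close> project to
  characteristic covectors of \<open>Q\<close>, and the norm lost in the projection is controlled by the parity
  of the other component. So everything follows from the theorem of Elkies: a unimodular form \<open>L\<close> of
  rank \<open>N\<close> has a characteristic vector of norm less than \<open>N\<close>, unless it is \<open>\<int>\<^sup>N\<close>.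

  For the latter, divide the theta series of \<open>L\<close>, and its translates under the modular group, by those of
  \<open>\<int>\<^sup>N\<close>. If no characteristic vector is shorter than \<open>N\<close>, then the three quotients are holomorphic at
  the cusp, and they are permuted by the modular group up to roots of unity. The maximum principle makes
  them constant; so \<open>L\<close> has \<open>2 N\<close> unit vectors.
\<close>

text \<open>Dividing by the theta series of the standard lattice cancels the automorphy factors,
  with their square roots in odd rank; the price is that Jacobi's theta functions must be shown to
  have no zeros. The length of characteristic vectors enters through one exponent: the quotient for
  the translate carries \<open>q\<close> to the power \<open>(m - N) / 4\<close>, with
  \<open>m\<close> the least characteristic norm, which is bounded at the cusp once
  \<open>N \<le> m\<close>. A consistency condition for the modular group makes \<open>m - N\<close>
  a multiple of 8, so that otherwise there is a gap of 8. The delicate case is a standard lattice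
  \<open>L\<close>, where no characteristic vector is shorter than the rank. For the glue partner of
  norm 3, parity of the component \<open>k\<close> alone would leave \<open>n + 1 - 1/3\<close>; a
  choice of signs in \<open>(\<plusminus>1, ..., \<plusminus>1)\<close> gives \<open>k = 3\<close>
  and \<open>n - 2\<close>. For \<open>A2\<close>, the components of \<open>(1, ..., 1)\<close> are
  even, so its projection either is a vector of \<open>Q\<close> or has lost at least
  \<open>8/3\<close>: this is the origin of the bounds \<open>n + 2\<close> and
  \<open>n - 2/3\<close>. Only here can strictness fail, and the complement of \<open>A2\<close> in
  the standard lattice is diagonal.\<close>

section \<open>Poisson summation for Gaussians\<close>

text \<open>\<open>D\<close> is tested against \<open>cos (pi x) ^ (2 n)\<close>, a trigonometric polynomial that concentrates at \<open>0\<close>.\<close>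

lemma fourier_coeffs_zero_imp_zero:
  fixes D :: "real \<Rightarrow> complex"
  assumes cont: "continuous_on {-1/2..1/2} D"
    and zero: "\<And>k::int. ((\<lambda>x. D x * cis (2 * pi * of_int k * x)) has_integral 0) {-1/2..1/2}"
  shows "D 0 = 0"
proof (rule ccontr)
  assume D0: "D 0 \<noteq> 0"
  \<comment> \<open>Since \<open>cos (pi x)^2\<close> is a combination of the frequencies 0, 1 and
    -1, the step for \<open>n\<close> needs the claim at \<open>k\<close>, \<open>k + 1\<close> and
    \<open>k - 1\<close>; hence \<open>k\<close> is arbitrary in the induction.\<close>
  have cosk: "((\<lambda>x. D x * cis (2 * pi * of_int k * x) * of_real (cos (pi * x) ^ (2 * n))) has_integral 0) {-1/2..1/2}"
    for n and k :: int
  proof (induction n arbitrary: k)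
    case 0
    then show ?case using zero[of k] by simp
  next
    case (Suc n)
    let ?f = "\<lambda>k x. D x * cis (2 * pi * of_int k * x) * of_real (cos (pi * x) ^ (2 * n))"
    have "((\<lambda>x. (1/4) * (2 * ?f k x + ?f (k+1) x + ?f (k-1) x)) has_integral (1/4) * (2 * 0 + 0 + 0)) {-1/2..1/2}"
      by (intro has_integral_mult_right has_integral_add Suc.IH)
    moreover have "(1/4) * (2 * ?f k x + ?f (k+1) x + ?f (k-1) x)
        = D x * cis (2 * pi * of_int k * x) * of_real (cos (pi * x) ^ (2 * Suc n))" for x
    proof -
      have a: "complex_of_real (cos (pi * x) ^ 2) = (2 + cis (2*pi*x) + cis (-(2*pi*x))) / 4"
        using cos_double_cos[of "pi * x"] by (simp add: complex_eq_iff mult.assoc)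
      have p: "cis (2 * pi * of_int (k+1) * x) = cis (2 * pi * of_int k * x) * cis (2*pi*x)"
        "cis (2 * pi * of_int (k-1) * x) = cis (2 * pi * of_int k * x) * cis (-(2*pi*x))"
        by (simp_all add: cis_mult algebra_simps)
      have "cos (pi * x) ^ (2 * Suc n) = cos (pi * x) ^ (2 * n) * cos (pi * x) ^ 2"
        by (simp add: power2_eq_square)
      then show ?thesis
        unfolding p by (simp only: of_real_mult a) (simp add: algebra_simps)
    qed
    ultimately show ?case by simp
  qed
  let ?c = "\<lambda>n x. cos (pi * x) ^ (2 * n)"
  have "isCont D 0"
    by (rule continuous_on_interior[OF cont]) auto
  then obtain \<delta>0 where \<delta>0: "\<delta>0 > 0" "\<And>x. dist x 0 < \<delta>0 \<Longrightarrow> dist (D x) (D 0) < norm (D 0) / 2"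
    unfolding continuous_at_eps_delta using D0
    by (metis (no_types, lifting) half_gt_zero zero_less_norm_iff)
  define \<delta> where "\<delta> = min (\<delta>0 / 2) (1/4)"
  have \<delta>: "\<delta> > 0" "\<delta> \<le> 1/4" "\<And>x. \<bar>x\<bar> \<le> \<delta> \<Longrightarrow> norm (D x - D 0) \<le> norm (D 0) / 2"
    using \<delta>0 unfolding \<delta>_def by (auto simp: dist_norm intro!: less_imp_le)
  have "bounded ((\<lambda>x. D x - D 0) ` {-1/2..1/2})"
    by (intro compact_imp_bounded compact_continuous_image continuous_intros cont) auto
  then obtain B where B: "\<And>x. x \<in> {-1/2..1/2} \<Longrightarrow> norm (D x - D 0) \<le> B"
    unfolding bounded_iff by blast
  have B0: "B \<ge> 0" using B[of 0] by (auto intro: order_trans[OF norm_ge_zero])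
  \<comment> \<open>The kernel is at most \<open>r ^ (2n)\<close> outside
    \<open>\<bar>x\<bar> \<le> \<delta>\<close> and at least \<open>s ^ (2n)\<close> inside
    \<open>\<bar>x\<bar> \<le> \<delta>/2\<close>; as \<open>r < s\<close>, the mass near 0
    dominates geometrically.\<close>
  define r s where "r = cos (pi * \<delta>)" and "s = cos (pi * \<delta> / 2)"
  have r: "r > 0" unfolding r_def using \<delta> by (intro cos_gt_zero) (auto simp: field_simps)
  have rs: "r < s" unfolding r_def s_def using \<delta> by (intro cos_monotone_0_pi) (auto simp: field_simps)
  \<comment> \<open>Against the kernel of mass \<open>J\<close>, the function
    \<open>D x - D 0\<close> integrates to \<open>- D 0 * J\<close>. Near 0 it contributes at most
    half of this modulus, which is absorbed; elsewhere at most \<open>B * r ^ (2n)\<close>.\<close>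
  have key: "norm (D 0) * \<delta> \<le> 2 * B * ((r/s)^2) ^ n" for n
  proof -
    define J where "J = integral {-1/2..1/2} (?c n)"
    have cint: "(?c n) integrable_on {a..b}" for a b :: real
      by (intro integrable_continuous_real continuous_intros)
    have J: "(?c n has_integral J) {-1/2..1/2}" unfolding J_def using cint by (simp add: has_integral_integral)
    have "((\<lambda>x. D x * cis (2 * pi * of_int 0 * x) * of_real (?c n x) - D 0 * of_real (?c n x)) has_integral 0 - D 0 * of_real J) {-1/2..1/2}"
      by (intro has_integral_diff cosk has_integral_mult_right has_integral_of_real J)
    then have h: "((\<lambda>x. (D x - D 0) * of_real (?c n x)) has_integral - D 0 * of_real J) {-1/2..1/2}"
      by (simp add: algebra_simps)
    have ptw: "norm ((D x - D 0) * of_real (?c n x)) \<le> norm (D 0) / 2 * ?c n x + B * r ^ (2*n)"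
      if x: "x \<in> {-1/2..1/2}" for x
    proof (cases "\<bar>x\<bar> \<le> \<delta>")
      case True
      have "norm (D x - D 0) * ?c n x \<le> norm (D 0) / 2 * ?c n x"
        by (intro mult_right_mono \<delta>(3) True) (auto simp: power_mult)
      moreover have "B * r ^ (2*n) \<ge> 0" using B0 by (auto simp: power_mult)
      ultimately show ?thesis by (simp add: norm_mult power_mult flip: of_real_power)
    next
      case False
      have "cos (pi * \<bar>x\<bar>) \<le> r" unfolding r_def using False x \<delta>
        by (intro cos_monotone_0_pi_le) (auto simp: field_simps)
      moreover have "cos (pi * \<bar>x\<bar>) \<ge> 0"
      proof (rule cos_ge_zero)
        show "pi * \<bar>x\<bar> \<le> pi / 2" using x by (auto simp: field_simps abs_if)
        have "0 \<le> pi * \<bar>x\<bar>" by simp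
        then show "- (pi / 2) \<le> pi * \<bar>x\<bar>" using pi_gt_zero by linarith
      qed
      ultimately have "cos (pi * \<bar>x\<bar>) ^ (2*n) \<le> r ^ (2*n)" by (intro power_mono)
      moreover have "cos (pi * \<bar>x\<bar>) = cos (pi * x)" by (cases "x \<ge> 0") auto
      ultimately have "?c n x \<le> r ^ (2*n)" by simp
      then have "norm (D x - D 0) * ?c n x \<le> B * r ^ (2*n)"
        by (intro mult_mono B x B0) (auto simp: power_mult)
      moreover have "norm (D 0) / 2 * ?c n x \<ge> 0" by (auto simp: power_mult)
      moreover have "norm ((D x - D 0) * of_real (?c n x)) = norm (D x - D 0) * ?c n x"
        by (simp add: norm_mult power_mult flip: of_real_power)
      ultimately show ?thesis by linarith
    qed
    have "norm (- D 0 * of_real J) \<le> norm (D 0) / 2 * J + B * r ^ (2*n)"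
    proof -
      have i2: "((\<lambda>x. norm (D 0) / 2 * ?c n x + B * r ^ (2*n)) has_integral norm (D 0) / 2 * J + B * r ^ (2*n)) {-1/2..1/2}"
        using has_integral_add[OF has_integral_mult_right[OF J, of "norm (D 0) / 2"] has_integral_const_real[of "B * r ^ (2*n)" "-1/2" "1/2"]]
        by simp
      have "norm (integral {-1/2..1/2} (\<lambda>x. (D x - D 0) * of_real (?c n x)))
          \<le> integral {-1/2..1/2} (\<lambda>x. norm (D 0) / 2 * ?c n x + B * r ^ (2*n))"
        by (rule integral_norm_bound_integral[OF has_integral_integrable[OF h] has_integral_integrable[OF i2] ptw])
      then show ?thesis unfolding integral_unique[OF h] integral_unique[OF i2] .
    qed
    moreover have "\<delta> * s ^ (2*n) \<le> J"
    proof -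
      have "((\<lambda>x. s ^ (2*n)) has_integral \<delta> * s^(2*n)) {-\<delta>/2..\<delta>/2}"
        using has_integral_const_real[of "s ^ (2*n)" "-\<delta>/2" "\<delta>/2"] \<delta> by simp
      moreover have "s ^ (2*n) \<le> ?c n x" if "x \<in> {-\<delta>/2..\<delta>/2}" for x
      proof -
        have "s \<le> cos (pi * \<bar>x\<bar>)" unfolding s_def using that \<delta>
          by (intro cos_monotone_0_pi_le) (auto simp: field_simps abs_if)
        moreover have "cos (pi * \<bar>x\<bar>) = cos (pi * x)" by (cases "x \<ge> 0") auto
        ultimately show ?thesis using r rs by (intro power_mono) auto
      qed
      ultimately have "\<delta> * s ^ (2*n) \<le> integral {-\<delta>/2..\<delta>/2} (?c n)"
        using integral_le[of "\<lambda>x. s ^ (2*n)" "{-\<delta>/2..\<delta>/2}" "?c n"] cint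
        by (metis (mono_tags, lifting) has_integral_integrable integral_unique)
      also have "\<dots> \<le> J" unfolding J_def
        by (intro integral_subset_le cint) (use \<delta> in \<open>auto simp: power_mult\<close>)
      finally show ?thesis .
    qed
    moreover have "J \<ge> 0" using J by (rule has_integral_nonneg) (auto simp: power_mult)
    ultimately have "norm (D 0) * J \<le> 2 * B * r ^ (2*n)" by (simp add: norm_mult)
    with \<open>\<delta> * s ^ (2*n) \<le> J\<close> have "norm (D 0) * (\<delta> * s ^ (2*n)) \<le> 2 * B * r ^ (2*n)"
      by (meson mult_left_mono norm_ge_zero order_trans)
    then have "norm (D 0) * \<delta> \<le> 2 * B * (r ^ (2*n) / s ^ (2*n))"
      using r rs by (simp add: field_simps)
    also have "r ^ (2*n) / s ^ (2*n) = ((r/s)^2) ^ n"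
      by (simp add: power_divide flip: power_mult)
    finally show ?thesis .
  qed
  have "(\<lambda>n. 2 * B * ((r/s)^2) ^ n) \<longlonglongrightarrow> 2 * B * 0"
    using r rs by (intro tendsto_intros LIMSEQ_realpow_zero) (auto simp: power_less_one_iff)
  then have "norm (D 0) * \<delta> \<le> 0"
    by (intro LIMSEQ_le_const[where X = "\<lambda>n. 2 * B * ((r/s)^2) ^ n"]) (use key in auto)
  with D0 \<delta>(1) show False by (simp add: mult_le_0_iff)
qed

text \<open>The substitution \<open>u = c x\<close> with \<open>c = sqrt (2 pi d)\<close> reduces
  this to the characteristic function of the standard normal distribution.\<close>

lemma gaussian_fourier_transform:
  fixes d \<xi> :: real
  assumes d: "d > 0"
  shows "integrable lborel (\<lambda>x. exp (- pi * d * x^2) * cis (2 * pi * \<xi> * x))"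
    and "(LBINT x. exp (- pi * d * x^2) * cis (2 * pi * \<xi> * x)) = exp (- pi * \<xi>^2 / d) / sqrt d"
proof -
  define c where "c = sqrt (2 * pi * d)"
  have c: "c > 0" "c^2 = 2 * pi * d" using d by (auto simp: c_def)
  define g where "g = (\<lambda>u. std_normal_density u *\<^sub>R cis ((2 * pi * \<xi> / c) * u))"
  have gc: "g (0 + c * x) = complex_of_real (1 / sqrt (2*pi)) * (exp (- pi * d * x^2) * cis (2 * pi * \<xi> * x))" for x
  proof -
    have "(c * x)^2 / 2 = pi * d * x^2" "2 * pi * \<xi> / c * (c * x) = 2 * pi * \<xi> * x"
      using c by (simp_all add: power_mult_distrib)
    then show ?thesis
      by (simp add: g_def std_normal_density_def scaleR_conv_of_real)
  qed
  have gi: "integrable lborel g"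
  proof (rule Bochner_Integration.integrable_bound[of _ std_normal_density])
    show "integrable lborel std_normal_density" by (rule integrable_normal_density) simp
    show "g \<in> borel_measurable lborel"
    proof -
      have [measurable]: "(\<lambda>u. cis ((2 * pi * \<xi> / c) * u)) \<in> borel_measurable borel"
        using c by (intro borel_measurable_continuous_onI continuous_intros) auto
      show ?thesis unfolding g_def by measurable
    qed
  qed (auto simp: g_def normal_density_nonneg)
  have "integrable lborel (\<lambda>x. g (0 + c * x))"
    using gi c by (subst lborel_integrable_real_affine_iff) auto
  then have *: "integrable lborel (\<lambda>x. complex_of_real (1 / sqrt (2*pi)) * (exp (- pi * d * x^2) * cis (2 * pi * \<xi> * x)))"
    unfolding gc .
  then show i: "integrable lborel (\<lambda>x. exp (- pi * d * x^2) * cis (2 * pi * \<xi> * x))"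
    using integrable_mult_right[of "complex_of_real (sqrt (2*pi))", OF *] by simp
  have "char std_normal_distribution (2 * pi * \<xi> / c) = integral\<^sup>L lborel g"
    unfolding char_def g_def
    by (subst integral_density) (auto simp: normal_density_nonneg cis_conv_exp mult_ac)
  also have "\<dots> = c *\<^sub>R (LBINT x. g (0 + c * x))"
    using c by (subst lborel_integral_real_affine[of c _ 0]) auto
  also have "\<dots> = c * complex_of_real (1 / sqrt (2*pi)) * (LBINT x. exp (- pi * d * x^2) * cis (2 * pi * \<xi> * x))"
    unfolding gc by (simp add: scaleR_conv_of_real)
  also have "c * complex_of_real (1 / sqrt (2*pi)) = complex_of_real (sqrt d)"
    using d by (simp add: c_def real_sqrt_mult)
  finally have "complex_of_real (sqrt d) * (LBINT x. exp (- pi * d * x^2) * cis (2 * pi * \<xi> * x))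
     = of_real (exp (- ((2 * pi * \<xi> / c)^2) / 2))"
    by (simp add: char_std_normal_distribution)
  also have "(2 * pi * \<xi> / c)^2 = 2 * (pi * \<xi>^2 / d)"
    using c(2) d by (simp add: power_divide power_mult_distrib power2_eq_square)
  finally show "(LBINT x. exp (- pi * d * x^2) * cis (2 * pi * \<xi> * x)) = exp (- pi * \<xi>^2 / d) / sqrt d"
    using d by (simp add: field_simps)
qed

lemma summable_on_gaussian_int:
  fixes c :: real
  assumes "c > 0"
  shows "(\<lambda>k::int. exp (- c * (of_int k)^2)) summable_on UNIV"
proof -
  define r where "r = exp (- c)"
  have r: "0 < r" "r < 1" using assms by (auto simp: r_def)
  have geo: "(\<lambda>n::nat. r ^ n) summable_on UNIV"
    using r by (intro summable_nonneg_imp_summable_on summable_geometric) auto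
  have "(\<lambda>k::int. r ^ nat \<bar>k\<bar>) summable_on range int"
    by (subst summable_on_reindex) (use geo in \<open>auto simp: o_def\<close>)
  moreover have "(\<lambda>k::int. r ^ nat \<bar>k\<bar>) summable_on range (\<lambda>n. - int n)"
    by (subst summable_on_reindex) (use geo in \<open>auto simp: o_def inj_on_def\<close>)
  ultimately have "(\<lambda>k::int. r ^ nat \<bar>k\<bar>) summable_on (range int \<union> range (\<lambda>n. - int n))"
    by (rule summable_on_union)
  also have "range int \<union> range (\<lambda>n. - int n) = UNIV"
    by (auto simp: image_iff) (metis int_cases2)
  finally have *: "(\<lambda>k::int. r ^ nat \<bar>k\<bar>) summable_on UNIV" .
  show ?thesis
  proof (rule summable_on_comparison_test[OF *])
    fix k :: int
    have "real (nat \<bar>k\<bar>) = \<bar>of_int k\<bar>" by simp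
    also have "\<bar>k\<bar> \<le> k^2" by (metis abs_ge_self abs_mult_self_eq abs_ge_zero int_one_le_iff_zero_less le_less mult_cancel_right1 mult_le_cancel_left1 power2_eq_square zero_le_mult_iff linorder_not_less order_refl mult_eq_0_iff)
    then have "\<bar>of_int k\<bar> \<le> (of_int k :: real)^2"
      by (metis of_int_abs of_int_le_iff of_int_power)
    finally have "real (nat \<bar>k\<bar>) * c \<le> c * (of_int k)^2" using assms by simp
    then show "exp (- c * (of_int k)^2) \<le> r ^ nat \<bar>k\<bar>"
      unfolding r_def by (simp flip: exp_of_nat_mult)
  qed auto
qed

text \<open>Unit intervals centred at the integers tile the line, so symmetric partial sums are
  integrals of \<open>F\<close> over growing intervals. Summability is assumed separately, because
  convergence of symmetric partial sums does not give an unordered sum.\<close>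

lemma has_sum_integral_translates:
  fixes F :: "real \<Rightarrow> complex"
  assumes cont: "continuous_on UNIV F" and int: "integrable lborel F"
    and summ: "(\<lambda>n::int. integral {-1/2..1/2} (\<lambda>x. F (x + of_int n))) summable_on UNIV"
  shows "((\<lambda>n::int. integral {-1/2..1/2} (\<lambda>x. F (x + of_int n))) has_sum (LBINT x. F x)) UNIV"
proof -
  let ?I = "\<lambda>n::int. integral {-1/2..1/2} (\<lambda>x. F (x + of_int n))"
  have ii: "F integrable_on {a..b}" for a b
    by (intro integrable_continuous_real continuous_on_subset[OF cont]) auto
  have sh: "?I n = integral {of_int n - 1/2..of_int n + 1/2} F" for n
    using integral_shift[of "-1/2" "of_int n" "1/2" F] continuous_on_subset[OF cont]
    by (simp add: o_def add.commute)
  have part: "(\<Sum>n\<in>{-int M..int M}. ?I n) = integral {-(real M + 1/2)..real M + 1/2} F" for M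
  proof (induction M)
    case 0
    then show ?case by (simp add: sh)
  next
    case (Suc M)
    have "{-int (Suc M)..int (Suc M)} = insert (- int (Suc M)) (insert (int (Suc M)) {-int M..int M})"
      by auto
    then have "(\<Sum>n\<in>{-int (Suc M)..int (Suc M)}. ?I n)
        = ?I (- int (Suc M)) + (?I (int (Suc M)) + integral {-(real M + 1/2)..real M + 1/2} F)"
      using Suc by simp
    also have "\<dots> = integral {-(real M + 3/2)..-(real M + 1/2)} F
        + (integral {real M + 1/2..real M + 3/2} F + integral {-(real M + 1/2)..real M + 1/2} F)"
    proof -
      have "of_int (- int (Suc M)) - 1/2 = -(real M + 3/2)" "of_int (- int (Suc M)) + 1/2 = -(real M + 1/2)"
        "of_int (int (Suc M)) - 1/2 = real M + 1/2" "of_int (int (Suc M)) + 1/2 = real M + 3/2"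
        by simp_all
      then show ?thesis unfolding sh by (simp only:)
    qed
    also have "\<dots> = integral {-(real M + 3/2)..-(real M + 1/2)} F + integral {-(real M + 1/2)..real M + 3/2} F"
      using Henstock_Kurzweil_Integration.integral_combine[of "-(real M + 1/2)" "real M + 1/2" "real M + 3/2" F] ii
      by (simp add: add.commute)
    also have "\<dots> = integral {-(real M + 3/2)..real M + 3/2} F"
      using ii by (intro Henstock_Kurzweil_Integration.integral_combine) auto
    finally show ?case by (simp add: algebra_simps)
  qed
  have "(\<lambda>M. LBINT x. indicator {-(real M + 1/2)..real M + 1/2} x *\<^sub>R F x) \<longlonglongrightarrow> (LBINT x. F x)"
  proof (rule integral_dominated_convergence[where w = "\<lambda>x. norm (F x)"])
    show "AE x in lborel. (\<lambda>M. indicator {-(real M + 1/2)..real M + 1/2} x *\<^sub>R F x) \<longlonglongrightarrow> F x"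
    proof (rule AE_I2)
      fix x :: real
      have "eventually (\<lambda>M. indicator {-(real M + 1/2)..real M + 1/2} x *\<^sub>R F x = F x) sequentially"
        using eventually_ge_at_top[of "nat \<lceil>\<bar>x\<bar>\<rceil>"]
      proof eventually_elim
        case (elim M)
        then have "\<bar>x\<bar> \<le> real M" by linarith
        then show ?case by (auto simp: indicator_def)
      qed
      then show "(\<lambda>M. indicator {-(real M + 1/2)..real M + 1/2} x *\<^sub>R F x) \<longlonglongrightarrow> F x"
        by (rule tendsto_eventually)
    qed
    show "integrable lborel (\<lambda>x. norm (F x))" using int by simp
    show "F \<in> borel_measurable lborel" using int by simp
    then show "(\<lambda>x. indicator {-(real M + 1/2)..real M + 1/2} x *\<^sub>R F x) \<in> borel_measurable lborel" for M
      by measurable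
  qed (auto simp: indicator_def)
  moreover have "(LBINT x. indicator {-(real M + 1/2)..real M + 1/2} x *\<^sub>R F x) = integral {-(real M + 1/2)..real M + 1/2} F" for M
    using set_borel_integral_eq_integral(2)[of "{-(real M + 1/2)..real M + 1/2}" F]
      integrable_mult_indicator[OF _ int] unfolding set_integrable_def set_lebesgue_integral_def by simp
  ultimately have l1: "(\<lambda>M. \<Sum>n\<in>{-int M..int M}. ?I n) \<longlonglongrightarrow> (LBINT x. F x)"
    unfolding part by simp
  have "filterlim (\<lambda>M. {-int M..int M}) (finite_subsets_at_top UNIV) sequentially"
    unfolding filterlim_finite_subsets_at_top
  proof safe
    fix X :: "int set" assume "finite X"
    then obtain B where B: "\<And>x. x \<in> X \<Longrightarrow> \<bar>x\<bar> \<le> B"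
      by (metis Max_ge finite_imageI imageI)
    show "\<forall>\<^sub>F M in sequentially. finite {-int M..int M} \<and> X \<subseteq> {-int M..int M} \<and> {-int M..int M} \<subseteq> UNIV"
      using eventually_ge_at_top[of "nat B"]
    proof eventually_elim
      case (elim M)
      then show ?case using B by fastforce
    qed
  qed
  from filterlim_compose[OF has_sum_infsum[OF summ, unfolded has_sum_def] this]
  have "(\<lambda>M. \<Sum>n\<in>{-int M..int M}. ?I n) \<longlonglongrightarrow> infsum ?I UNIV" .
  with l1 have "(LBINT x. F x) = infsum ?I UNIV" using LIMSEQ_unique by blast
  then show ?thesis using summ by simp
qed

lemma has_sum_integral_uniform:
  fixes f :: "int \<Rightarrow> real \<Rightarrow> complex"
  assumes cont: "\<And>n. continuous_on {a..b} (f n)"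
    and M: "M summable_on UNIV" "\<And>n x. x \<in> {a..b} \<Longrightarrow> norm (f n x) \<le> M n"
  shows "continuous_on {a..b} (\<lambda>x. \<Sum>\<^sub>\<infinity>n. f n x)"
    and "((\<lambda>n. integral {a..b} (f n)) has_sum integral {a..b} (\<lambda>x. \<Sum>\<^sub>\<infinity>n. f n x)) UNIV"
proof -
  have u: "uniform_limit {a..b} (\<lambda>X x. \<Sum>n\<in>X. f n x) (\<lambda>x. \<Sum>\<^sub>\<infinity>n. f n x) (finite_subsets_at_top UNIV)"
    using M by (intro Weierstrass_m_test_general) auto
  show c: "continuous_on {a..b} (\<lambda>x. \<Sum>\<^sub>\<infinity>n. f n x)"
    by (rule uniform_limit_theorem[OF _ u]) (auto intro!: always_eventually continuous_intros cont)
  obtain I J where IJ: "\<And>X. ((\<lambda>x. \<Sum>n\<in>X. f n x) has_integral I X) {a..b}"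
      "((\<lambda>x. \<Sum>\<^sub>\<infinity>n. f n x) has_integral J) {a..b}" "(I \<longlongrightarrow> J) (finite_subsets_at_top UNIV)"
    by (rule uniform_limit_integral[OF u]) (auto intro!: continuous_intros cont)
  have "\<forall>\<^sub>F X in finite_subsets_at_top UNIV. I X = (\<Sum>n\<in>X. integral {a..b} (f n))"
  proof (rule eventually_finite_subsets_at_top_weakI)
    fix X :: "int set" assume "finite X"
    have "((\<lambda>x. \<Sum>n\<in>X. f n x) has_integral (\<Sum>n\<in>X. integral {a..b} (f n))) {a..b}"
      by (intro has_integral_sum \<open>finite X\<close> integrable_integral integrable_continuous_real cont)
    with IJ(1) show "I X = (\<Sum>n\<in>X. integral {a..b} (f n))" using has_integral_unique by blast
  qed
  then show "((\<lambda>n. integral {a..b} (f n)) has_sum integral {a..b} (\<lambda>x. \<Sum>\<^sub>\<infinity>n. f n x)) UNIV"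
    unfolding has_sum_def using IJ(2,3) by (simp add: integral_unique tendsto_cong)
qed

text \<open>From \<open>2 (n/2 + y)^2 \<ge> 0\<close> follows
  \<open>(n + y)^2 \<ge> n^2/2 - y^2\<close>. The result is a summable majorant that is uniform for
  \<open>x\<close> in a bounded interval.\<close>

lemma shifted_gaussian_bound:
  fixes d a x :: real and n :: int
  assumes "d > 0" "\<bar>x\<bar> \<le> R"
  shows "exp (- pi * d * (x + of_int n + a)^2)
      \<le> exp (pi * d * (\<bar>a\<bar> + R)^2) * exp (- (pi * d / 2) * (of_int n)^2)"
proof -
  have "(x + a)^2 \<le> (\<bar>a\<bar> + R)^2" using assms by (intro abs_le_square_iff[THEN iffD1]) auto
  moreover have "0 \<le> (of_int n / 2 + (x + a))^2 * 2" by simp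
  ultimately have "(of_int n)^2 / 2 - (\<bar>a\<bar> + R)^2 \<le> (x + of_int n + a)^2"
    by (simp add: power2_eq_square algebra_simps)
  then have "pi * d * ((of_int n)^2 / 2 - (\<bar>a\<bar> + R)^2) \<le> pi * d * (x + of_int n + a)^2"
    using assms by (intro mult_left_mono) auto
  then show ?thesis by (simp add: algebra_simps flip: exp_add)
qed

lemma summable_on_shifted_gaussian:
  fixes d a :: real
  assumes "d > 0"
  shows "(\<lambda>n::int. exp (- pi * d * (of_int n + a)^2)) summable_on UNIV"
  using shifted_gaussian_bound[OF assms, of 0 0 _ a] assms
  by (intro summable_on_comparison_test[OF summable_on_cmult_right[OF summable_on_gaussian_int[of "pi * d / 2"]]])
     auto

text \<open>The periodisation \<open>\<Phi>\<close> of the Gaussian and the series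
  \<open>\<Psi>\<close> are both continuous with the same Fourier coefficients, so they agree at 0;
  no theorem on pointwise convergence of Fourier series enters. Both a shift \<open>a\<close> and a
  character \<open>b\<close> are carried along, because eliminating one of several variables changes
  both.\<close>

theorem poisson_gaussian:
  fixes d a b :: real
  assumes d: "d > 0"
  shows "(\<Sum>\<^sub>\<infinity>n::int. exp (- pi * d * (of_int n + a)^2) * cis (2 * pi * b * (of_int n + a)))
       = (\<Sum>\<^sub>\<infinity>m::int. exp (- pi * (of_int m - b)^2 / d) * cis (2 * pi * of_int m * a)) / sqrt d"
proof -
  define f where "f = (\<lambda>x::real. exp (- pi * d * (x + a)^2) * cis (2 * pi * b * (x + a)))"
  define h where "h = (\<lambda>m::int. exp (- pi * (of_int m - b)^2 / d) * cis (2 * pi * of_int m * a) / sqrt d)"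
  define \<Phi> where "\<Phi> = (\<lambda>x. \<Sum>\<^sub>\<infinity>n::int. f (x + of_int n))"
  define \<Psi> where "\<Psi> = (\<lambda>x. \<Sum>\<^sub>\<infinity>m::int. h m * cis (2 * pi * of_int m * x))"
  let ?I = "{-1/2..1/2::real}"
  have contf: "continuous_on A (\<lambda>x. f (x + c))" for A c
    unfolding f_def by (intro continuous_intros)
  define Mf where "Mf = (\<lambda>n::int. exp (pi * d * (\<bar>a\<bar> + 1/2)^2) * exp (- (pi * d / 2) * (of_int n)^2))"
  have Mf: "Mf summable_on UNIV"
    unfolding Mf_def using d by (intro summable_on_cmult_right summable_on_gaussian_int) auto
  have Mf': "norm (f (x + of_int n)) \<le> Mf n" if "x \<in> ?I" for n x
  proof -
    have "\<bar>x\<bar> \<le> 1/2" using that by auto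
    from shifted_gaussian_bound[OF d this, of n a] show ?thesis
      unfolding f_def Mf_def by (simp add: norm_mult)
  qed
  define Mh where "Mh = (\<lambda>m::int. exp (- pi * (1/d) * (of_int m + (-b))^2) / sqrt d)"
  have Mh: "Mh summable_on UNIV"
    unfolding Mh_def using summable_on_cmult_left[OF summable_on_shifted_gaussian[of "1/d" "-b"], of "inverse (sqrt d)"] d
    by (simp add: divide_inverse)
  have Mh': "norm (h m) \<le> Mh m" for m
    unfolding h_def Mh_def using d by (simp add: norm_mult norm_divide)
  have cont\<Phi>: "continuous_on ?I \<Phi>"
    unfolding \<Phi>_def by (rule has_sum_integral_uniform(1)[OF contf Mf Mf'])
  have cont\<Psi>: "continuous_on ?I \<Psi>"
    unfolding \<Psi>_def by (rule has_sum_integral_uniform(1)[OF _ Mh])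
      (auto intro!: continuous_intros simp: norm_mult Mh')
  \<comment> \<open>Unfolding: the character \<open>cis (2 pi k x)\<close> has period 1, so
    integrating the periodisation over one period is integrating \<open>F\<close> over the line, and
    this is a Gaussian transform at the frequency \<open>b + k\<close>.\<close>
  have int\<Phi>: "integral ?I (\<lambda>x. \<Phi> x * cis (2 * pi * of_int k * x)) = h (- k)" for k :: int
  proof -
    define F where "F = (\<lambda>x. f x * cis (2 * pi * of_int k * x))"
    have per: "F (x + of_int n) = f (x + of_int n) * cis (2 * pi * of_int k * x)" for x n
    proof -
      have "cis (2 * pi * of_int k * (x + of_int n)) = cis (2 * pi * of_int k * x) * cis (2 * pi * of_int (k * n))"
        by (simp add: cis_mult algebra_simps)
      also have "cis (2 * pi * of_int (k * n)) = 1"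
        by (rule cis_multiple_2pi) auto
      finally show ?thesis by (simp add: F_def)
    qed
    have Fshift: "F (-a + 1 * u) = cis (- 2 * pi * of_int k * a) * (exp (- pi * d * u^2) * cis (2 * pi * (b + of_int k) * u))" for u
      by (simp add: F_def f_def cis_mult algebra_simps)
    have "integrable lborel (\<lambda>u. F (-a + 1 * u))"
      unfolding Fshift by (intro integrable_mult_right gaussian_fourier_transform d)
    then have Fi: "integrable lborel F"
      by (subst (asm) lborel_integrable_real_affine_iff) auto
    have "(LBINT x. F x) = (LBINT u. F (-a + 1 * u))"
      by (subst lborel_integral_real_affine[of 1 _ "-a"]) auto
    also have "\<dots> = cis (- 2 * pi * of_int k * a) * (exp (- pi * (b + of_int k)^2 / d) / sqrt d)"
      unfolding Fshift using gaussian_fourier_transform(2)[OF d, of "b + of_int k"] by simp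
    also have "\<dots> = h (- k)"
      by (simp add: h_def power2_eq_square algebra_simps)
    finally have LF: "(LBINT x. F x) = h (- k)" .
    have contF: "continuous_on A (\<lambda>x. F (x + c))" for A c
      unfolding F_def by (intro continuous_intros contf)
    have hs: "((\<lambda>n::int. integral ?I (\<lambda>x. F (x + of_int n))) has_sum integral ?I (\<lambda>x. \<Sum>\<^sub>\<infinity>n. F (x + of_int n))) UNIV"
      by (rule has_sum_integral_uniform(2)[OF contF Mf]) (use Mf' in \<open>auto simp: per norm_mult\<close>)
    have "(\<Sum>\<^sub>\<infinity>n::int. F (x + of_int n)) = \<Phi> x * cis (2 * pi * of_int k * x)" for x
      unfolding per \<Phi>_def by (rule infsum_cmult_left')
    with hs have "((\<lambda>n::int. integral ?I (\<lambda>x. F (x + of_int n))) has_sum integral ?I (\<lambda>x. \<Phi> x * cis (2 * pi * of_int k * x))) UNIV"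
      by simp
    moreover have "((\<lambda>n::int. integral ?I (\<lambda>x. F (x + of_int n))) has_sum (LBINT x. F x)) UNIV"
      using has_sum_integral_translates[OF _ Fi has_sum_imp_summable[OF hs]] contF[of UNIV 0] by simp
    ultimately have "integral ?I (\<lambda>x. \<Phi> x * cis (2 * pi * of_int k * x)) = (LBINT x. F x)"
      by (rule has_sum_unique)
    then show ?thesis using LF by (rule trans)
  qed
  have int\<Psi>: "integral ?I (\<lambda>x. \<Psi> x * cis (2 * pi * of_int k * x)) = h (- k)" for k :: int
  proof -
    have orth: "integral ?I (\<lambda>x. cis (2 * pi * of_int j * x)) = (if j = 0 then 1 else 0)" for j :: int
    proof (cases "j = 0")
      case False
      have "((\<lambda>x. cis (2 * pi * of_int j * x)) has_integral
          (cis (2 * pi * of_int j * (1/2)) / (2 * pi * of_int j * \<i>) - cis (2 * pi * of_int j * (-1/2)) / (2 * pi * of_int j * \<i>))) ?I"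
      proof (rule fundamental_theorem_of_calculus)
        fix x :: real
        have "((\<lambda>z. exp (\<i> * (2 * pi * of_int j) * z) / (2 * pi * of_int j * \<i>)) has_field_derivative
            exp (\<i> * (2 * pi * of_int j) * of_real x)) (at (of_real x))"
          using False by (auto intro!: derivative_eq_intros simp: field_simps)
        then have "((\<lambda>x. exp (\<i> * (2 * pi * of_int j) * of_real x) / (2 * pi * of_int j * \<i>)) has_vector_derivative
            exp (\<i> * (2 * pi * of_int j) * of_real x)) (at x within ?I)"
          by (intro has_vector_derivative_real_field)
        then show "((\<lambda>x. cis (2 * pi * of_int j * x) / (2 * pi * of_int j * \<i>)) has_vector_derivative cis (2 * pi * of_int j * x)) (at x within ?I)"
          by (simp add: cis_conv_exp mult.assoc)
      qed auto
      moreover have "cis (2 * pi * of_int j * (1/2)) = cis (2 * pi * of_int j * (-1/2))"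
      proof -
        have "cis (2 * pi * of_int j * (1/2)) = cis (2 * pi * of_int j * (-1/2)) * cis (2 * pi * of_int j)"
          unfolding cis_mult by (simp add: algebra_simps)
        also have "cis (2 * pi * of_int j) = 1" by (rule cis_multiple_2pi) auto
        finally show ?thesis by (simp only: mult_1_right)
      qed
      ultimately show ?thesis using False by (simp add: integral_unique)
    qed simp
    have "((\<lambda>m::int. integral ?I (\<lambda>x. h m * cis (2 * pi * of_int (m + k) * x))) has_sum
        integral ?I (\<lambda>x. \<Sum>\<^sub>\<infinity>m. h m * cis (2 * pi * of_int (m + k) * x))) UNIV"
      by (rule has_sum_integral_uniform(2)[OF _ Mh]) (auto intro!: continuous_intros simp: norm_mult Mh')
    moreover have "(\<Sum>\<^sub>\<infinity>m::int. h m * cis (2 * pi * of_int (m + k) * x)) = \<Psi> x * cis (2 * pi * of_int k * x)" for x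
      unfolding \<Psi>_def by (subst infsum_cmult_left'[symmetric]) (simp add: cis_mult algebra_simps)
    moreover have "integral ?I (\<lambda>x. h m * cis (2 * pi * of_int (m + k) * x)) = (if m = - k then h (- k) else 0)" for m
      using orth[of "m + k"] by simp
    ultimately have "((\<lambda>m::int. if m = - k then h (- k) else 0) has_sum integral ?I (\<lambda>x. \<Psi> x * cis (2 * pi * of_int k * x))) UNIV"
      by simp
    moreover have "((\<lambda>m::int. if m = - k then h (- k) else 0) has_sum h (- k)) UNIV"
      using has_sum_finite_neutralI[of "{-k}" UNIV "\<lambda>m. if m = - k then h (- k) else 0"] by simp
    ultimately show ?thesis using has_sum_unique by blast
  qed
  have "\<Phi> 0 - \<Psi> 0 = 0"
  proof (rule fourier_coeffs_zero_imp_zero)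
    show "continuous_on ?I (\<lambda>x. \<Phi> x - \<Psi> x)" by (intro continuous_intros cont\<Phi> cont\<Psi>)
    fix k :: int
    have "((\<lambda>x. \<Phi> x * cis (2 * pi * of_int k * x)) has_integral h (- k)) ?I"
      unfolding int\<Phi>[symmetric]
      by (intro integrable_integral integrable_continuous_real continuous_intros cont\<Phi>)
    moreover have "((\<lambda>x. \<Psi> x * cis (2 * pi * of_int k * x)) has_integral h (- k)) ?I"
      unfolding int\<Psi>[symmetric]
      by (intro integrable_integral integrable_continuous_real continuous_intros cont\<Psi>)
    ultimately have "((\<lambda>x. \<Phi> x * cis (2 * pi * of_int k * x) - \<Psi> x * cis (2 * pi * of_int k * x)) has_integral h (- k) - h (- k)) ?I"
      by (rule has_integral_diff)
    then show "((\<lambda>x. (\<Phi> x - \<Psi> x) * cis (2 * pi * of_int k * x)) has_integral 0) ?I"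
      by (simp add: left_diff_distrib)
  qed
  then show ?thesis
    unfolding \<Phi>_def \<Psi>_def f_def h_def
    by (simp add: divide_inverse infsum_cmult_left' add.commute)
qed

section \<open>Poisson summation for positive quadratic forms in several variables\<close>

text \<open>Restricted to an index set \<open>S\<close>, so that an induction can eliminate one
  variable at a time without changing the type.\<close>

definition qf :: "'a set \<Rightarrow> ('a \<Rightarrow> 'a \<Rightarrow> real) \<Rightarrow> ('a \<Rightarrow> real) \<Rightarrow> real" where
  "qf S A u = (\<Sum>i\<in>S. \<Sum>j\<in>S. A i j * u i * u j)"

lemma qf_cong: "(\<And>i. i \<in> S \<Longrightarrow> u i = v i) \<Longrightarrow> qf S A u = qf S A v"
  unfolding qf_def by (intro sum.cong) auto

text \<open>The form left over on \<open>S\<close> is the Schur complement of the pivot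
  \<open>A s s\<close>.\<close>

lemma qf_complete_square:
  fixes A :: "'a \<Rightarrow> 'a \<Rightarrow> real"
  assumes "finite S" "s \<notin> S" and sym: "\<And>i. i \<in> S \<Longrightarrow> A i s = A s i" and d: "A s s > 0"
  shows "qf (insert s S) A u = A s s * (u s + (\<Sum>j\<in>S. A s j / A s s * u j))^2
    + qf S (\<lambda>i j. A i j - A i s * A s j / A s s) u"
proof -
  define m where "m = (\<Sum>j\<in>S. A s j * u j)"
  have "qf (insert s S) A u = A s s * u s * u s + (\<Sum>j\<in>S. A s j * u s * u j)
      + ((\<Sum>i\<in>S. A i s * u i * u s) + qf S A u)"
    using assms(1,2) by (simp add: qf_def sum.distrib)
  also have "(\<Sum>j\<in>S. A s j * u s * u j) = u s * m"
    unfolding m_def by (simp add: sum_distrib_left algebra_simps)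
  also have "(\<Sum>i\<in>S. A i s * u i * u s) = u s * m"
    unfolding m_def by (simp add: sum_distrib_left algebra_simps sym)
  finally have 1: "qf (insert s S) A u = A s s * u s * u s + u s * m + (u s * m + qf S A u)" .
  have "qf S (\<lambda>i j. A i j - A i s * A s j / A s s) u
      = qf S A u - (\<Sum>i\<in>S. \<Sum>j\<in>S. (A s i * u i) * (A s j * u j) / A s s)"
    unfolding qf_def sum_subtractf[symmetric] by (intro sum.cong refl) (auto simp: algebra_simps sym)
  also have "(\<Sum>i\<in>S. \<Sum>j\<in>S. (A s i * u i) * (A s j * u j) / A s s) = m * m / A s s"
    unfolding m_def sum_product by (simp add: sum_divide_distrib)
  finally have 2: "qf S (\<lambda>i j. A i j - A i s * A s j / A s s) u = qf S A u - m * m / A s s" .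
  have 3: "(\<Sum>j\<in>S. A s j / A s s * u j) = m / A s s"
    unfolding m_def by (simp add: sum_divide_distrib)
  show ?thesis
    unfolding 1 2 3 using d by (simp add: field_simps power2_eq_square)
qed

lemma infsum_complex_of_real:
  assumes "f summable_on A"
  shows "(\<Sum>\<^sub>\<infinity>x\<in>A. complex_of_real (f x)) = of_real (infsum f A)"
  using assms by (intro infsumI has_sum_of_real) simp

text \<open>Poisson summation turns the shift into phases, and bounding the phases by 1 removes it.
  Uniformity matters because, in a sum over several variables, the shift of one variable depends on
  the others.\<close>

lemma gaussian_sum_bounded:
  fixes d :: real
  assumes d: "d > 0"
  obtains C where "\<And>a. (\<Sum>\<^sub>\<infinity>n::int. exp (- pi * d * (of_int n + a)^2)) \<le> C"
proof
  fix a :: real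
  define S where "S = (\<Sum>\<^sub>\<infinity>n::int. exp (- pi * d * (of_int n + a)^2))"
  have "complex_of_real S = (\<Sum>\<^sub>\<infinity>n::int. of_real (exp (- pi * d * (of_int n + a)^2)))"
    unfolding S_def by (rule infsum_complex_of_real[symmetric]) (rule summable_on_shifted_gaussian[OF d])
  also have "\<dots> = (\<Sum>\<^sub>\<infinity>m::int. exp (- pi * (of_int m)^2 / d) * cis (2 * pi * of_int m * a)) / sqrt d"
    using poisson_gaussian[OF d, of a 0] by simp
  finally have e: "complex_of_real S = (\<Sum>\<^sub>\<infinity>m::int. exp (- pi * (of_int m)^2 / d) * cis (2 * pi * of_int m * a)) / sqrt d" .
  have "\<bar>S\<bar> = norm (complex_of_real S)" by (rule norm_of_real[symmetric])
  also have "\<dots> = norm (\<Sum>\<^sub>\<infinity>m::int. exp (- pi * (of_int m)^2 / d) * cis (2 * pi * of_int m * a)) / sqrt d"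
    unfolding e norm_divide using d by simp
  also have "\<dots> \<le> (\<Sum>\<^sub>\<infinity>m::int. norm (exp (- pi * (of_int m)^2 / d) * cis (2 * pi * of_int m * a))) / sqrt d"
    using summable_on_gaussian_int[of "pi / d"] d
    by (intro divide_right_mono norm_infsum_bound) (auto simp: norm_mult)
  also have "\<dots> = (\<Sum>\<^sub>\<infinity>m::int. exp (- pi * (of_int m)^2 / d)) / sqrt d"
    by (simp add: norm_mult)
  finally show "S \<le> (\<Sum>\<^sub>\<infinity>m::int. exp (- pi * (of_int m)^2 / d)) / sqrt d" by linarith
qed

lemma summable_on_Times_mult:
  fixes f :: "'a \<Rightarrow> real" and g :: "'b \<Rightarrow> real"
  assumes "f summable_on A" "g summable_on B" "\<And>x. x \<in> A \<Longrightarrow> f x \<ge> 0" "\<And>y. y \<in> B \<Longrightarrow> g y \<ge> 0"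
  shows "(\<lambda>(x, y). f x * g y) summable_on A \<times> B"
  by (rule summable_on_SigmaI[where g = "\<lambda>x. f x * infsum g B"])
     (use assms in \<open>auto intro!: has_sum_cmult_right summable_on_cmult_left\<close>)

lemma summable_on_SigmaI_bounded:
  fixes f :: "'a \<times> 'b \<Rightarrow> real"
  assumes f: "\<And>x. x \<in> A \<Longrightarrow> (\<lambda>y. f (x, y)) summable_on B" "\<And>x y. x \<in> A \<Longrightarrow> y \<in> B \<Longrightarrow> f (x, y) \<ge> 0"
    and g: "g summable_on A" "\<And>x. x \<in> A \<Longrightarrow> (\<Sum>\<^sub>\<infinity>y\<in>B. f (x, y)) \<le> g x"
  shows "f summable_on A \<times> B"
proof (rule summable_on_SigmaI[where g = "\<lambda>x. \<Sum>\<^sub>\<infinity>y\<in>B. f (x, y)"])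
  show "(\<lambda>x. \<Sum>\<^sub>\<infinity>y\<in>B. f (x, y)) summable_on A"
    by (rule summable_on_comparison_test[OF g(1) g(2)]) (auto intro!: infsum_nonneg f(2))
qed (use f in auto)

text \<open>Here \<open>Q'\<close> is the dual quadratic form of \<open>A\<close>. As the formula is stated for all scalings \<open>t\<close>, the value
  of \<open>c\<close>, which is \<open>det A\<close> to the power \<open>-1/2\<close>, is not needed: for unimodular \<open>A\<close> the case \<open>t = 1\<close>
  gives \<open>c = 1\<close>.\<close>

definition poisson_dual :: "'a set \<Rightarrow> ('a \<Rightarrow> 'a \<Rightarrow> real) \<Rightarrow> real \<Rightarrow> (('a \<Rightarrow> real) \<Rightarrow> real) \<Rightarrow> bool" where
  "poisson_dual S A c Q' \<longleftrightarrow> c > 0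
    \<and> (\<forall>v v'. (\<forall>i\<in>S. v i = v' i) \<longrightarrow> Q' v = Q' v')
    \<and> (\<forall>u v. (\<forall>i\<in>S. v i = (\<Sum>j\<in>S. A i j * u j)) \<longrightarrow> Q' v = qf S A u)
    \<and> (\<forall>t>0. \<forall>a. (\<lambda>x. exp (- pi * t * qf S A (\<lambda>i. of_int (x i) + a i))) summable_on (S \<rightarrow>\<^sub>E (UNIV :: int set)))
    \<and> (\<forall>t>0. \<forall>b. (\<lambda>y. exp (- pi * Q' (\<lambda>i. of_int (y i) - b i) / t)) summable_on (S \<rightarrow>\<^sub>E (UNIV :: int set)))
    \<and> (\<forall>t>0. \<forall>a b. (\<Sum>\<^sub>\<infinity>x\<in>S \<rightarrow>\<^sub>E (UNIV :: int set). exp (- pi * t * qf S A (\<lambda>i. of_int (x i) + a i))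
            * cis (2 * pi * (\<Sum>i\<in>S. b i * (of_int (x i) + a i))))
        = c * (1 / sqrt t) ^ card S * (\<Sum>\<^sub>\<infinity>y\<in>S \<rightarrow>\<^sub>E (UNIV :: int set). exp (- pi * Q' (\<lambda>i. of_int (y i) - b i) / t)
            * cis (2 * pi * (\<Sum>i\<in>S. of_int (y i) * a i))))"

text \<open>Complete the square in the variable \<open>s\<close>. Its sum is a one-dimensional
  Gaussian sum whose shift is linear in the other variables; Poisson summation turns that shift into
  a phase, that is, into a change of \<open>b\<close> for the form on \<open>S\<close>, where the
  induction hypothesis applies. Positivity on rational vectors is the notion that passes to the
  Schur complement, since the pivots are rational, and it follows from positivity on integer vectors
  by clearing denominators.\<close>

theorem poisson_quadratic_form:
  fixes A :: "'a \<Rightarrow> 'a \<Rightarrow> real"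
  assumes "finite S" "\<And>i j. i \<in> S \<Longrightarrow> j \<in> S \<Longrightarrow> A i j = A j i"
    and "\<And>i j. A i j \<in> \<rat>"
    and "\<And>u. (\<And>i. u i \<in> \<rat>) \<Longrightarrow> \<exists>i\<in>S. u i \<noteq> 0 \<Longrightarrow> qf S A u > 0"
  shows "\<exists>c Q'. poisson_dual S A c Q'"
  using assms
proof (induction S arbitrary: A rule: finite_induct)
  case empty
  show ?case
    by (rule exI[of _ 1], rule exI[of _ "\<lambda>_. 0"]) (simp add: qf_def poisson_dual_def)
next
  case (insert s S A)
  note sym = insert.prems(1) and rat = insert.prems(2) and pos = insert.prems(3)
  let ?X = "\<lambda>S. S \<rightarrow>\<^sub>E (UNIV :: int set)"
  define d where "d = A s s"
  have d: "d > 0"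
  proof -
    have "qf (insert s S) A (\<lambda>i. if i = s then 1 else 0) = d"
    proof -
      have z: "(if i = s then 1 else 0) = (0::real)" if "i \<in> S" for i
        using that insert.hyps by auto
      show ?thesis
        using insert.hyps unfolding qf_def d_def by (simp add: z cong: sum.cong_simp)
    qed
    then show ?thesis using pos[of "\<lambda>i. if i = s then 1 else 0"] by simp
  qed
  define l where "l = (\<lambda>j. A s j / d)"
  define A1 where "A1 = (\<lambda>i j. A i j - A i s * A s j / d)"
  have square: "qf (insert s S) A u = d * (u s + (\<Sum>j\<in>S. l j * u j))^2 + qf S A1 u" for u
    using qf_complete_square[of S s A u] insert.hyps sym d unfolding d_def l_def A1_def by auto
  have sym1: "A1 i j = A1 j i" if "i \<in> S" "j \<in> S" for i j
    using sym that by (simp add: A1_def)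
  have rat1: "A1 i j \<in> \<rat>" for i j
    unfolding A1_def d_def by (intro Rats_diff Rats_mult Rats_divide rat)
  \<comment> \<open>The coordinate given to \<open>s\<close> makes the completed square vanish, so
    that \<open>A\<close> takes on \<open>?u\<close> the value of the Schur complement on
    \<open>u\<close>.\<close>
  have pos1: "qf S A1 u > 0" if ur: "\<And>i. u i \<in> \<rat>" and u: "\<exists>i\<in>S. u i \<noteq> 0" for u
  proof -
    let ?u = "u(s := - (\<Sum>j\<in>S. l j * u j))"
    have rat_u: "?u i \<in> \<rat>" for i
      using ur by (auto simp: l_def d_def intro!: Rats_sum Rats_mult Rats_divide rat)
    have "(\<Sum>j\<in>S. l j * ?u j) = (\<Sum>j\<in>S. l j * u j)" "qf S A1 ?u = qf S A1 u"
      using insert.hyps by (auto intro!: sum.cong qf_cong)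
    then have eq: "qf (insert s S) A ?u = qf S A1 u" unfolding square by simp
    have "\<exists>i\<in>insert s S. ?u i \<noteq> 0" using u insert.hyps by auto
    from pos[OF rat_u this] show ?thesis unfolding eq .
  qed
  obtain c1 Q1 where dual1: "poisson_dual S A1 c1 Q1"
    using insert.IH[OF sym1 rat1 pos1] by blast
  have c1: "c1 > 0"
    using dual1 unfolding poisson_dual_def by (elim conjE)
  have Q1cong: "Q1 v = Q1 v'" if "\<forall>i\<in>S. v i = v' i" for v v'
    using dual1 that unfolding poisson_dual_def by (elim conjE) blast
  have Q1dual: "Q1 v = qf S A1 u" if "\<forall>i\<in>S. v i = (\<Sum>j\<in>S. A1 i j * u j)" for u v
    using dual1 that unfolding poisson_dual_def by (elim conjE) blast
  have sumA1: "(\<lambda>x. exp (- pi * t * qf S A1 (\<lambda>i. of_int (x i) + a i))) summable_on ?X S" if "t > 0" for t a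
    using dual1 that unfolding poisson_dual_def by (elim conjE) blast
  have sumQ1: "(\<lambda>y. exp (- pi * Q1 (\<lambda>i. of_int (y i) - b i) / t)) summable_on ?X S" if "t > 0" for t b
    using dual1 that unfolding poisson_dual_def by (elim conjE) blast
  have IH: "(\<Sum>\<^sub>\<infinity>x\<in>?X S. exp (- pi * t * qf S A1 (\<lambda>i. of_int (x i) + a i))
            * cis (2 * pi * (\<Sum>i\<in>S. b i * (of_int (x i) + a i))))
        = c1 * (1 / sqrt t) ^ card S * (\<Sum>\<^sub>\<infinity>y\<in>?X S. exp (- pi * Q1 (\<lambda>i. of_int (y i) - b i) / t)
            * cis (2 * pi * (\<Sum>i\<in>S. of_int (y i) * a i)))" if "t > 0" for t a b
    using dual1 that unfolding poisson_dual_def by (elim conjE) blast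
  \<comment> \<open>The inverse form: the substitution that splits \<open>A\<close> into
    \<open>d\<close> and \<open>A1\<close> acts on dual vectors by the inverse transpose, which
    subtracts \<open>v s * l j\<close>.\<close>
  define Q' where "Q' = (\<lambda>v. (v s)^2 / d + Q1 (\<lambda>j. v j - v s * l j))"
  have bij: "bij_betw (\<lambda>(k, x). x(s := k)) (UNIV \<times> ?X S) (?X (insert s S))"
    unfolding bij_betw_def
    using inj_combinator[OF \<open>s \<notin> S\<close>, of "\<lambda>_. UNIV :: int set"] PiE_insert_eq[of s S "\<lambda>_. UNIV :: int set"] by auto
  have bij': "bij_betw (\<lambda>(x, k). x(s := k)) (?X S \<times> UNIV) (?X (insert s S))"
  proof -
    have "bij_betw prod.swap (?X S \<times> (UNIV :: int set)) (UNIV \<times> ?X S)"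
      by (simp add: bij_betw_def product_swap)
    from bij_betw_trans[OF this bij] show ?thesis by (simp add: o_def case_prod_unfold)
  qed
  define \<alpha> where "\<alpha> = (\<lambda>a x. a s + (\<Sum>j\<in>S. l j * (of_int (x j) + a j)))"
  have qfx: "qf (insert s S) A (\<lambda>i. of_int ((x(s := k)) i) + a i)
      = d * (of_int k + \<alpha> a x)^2 + qf S A1 (\<lambda>i. of_int (x i) + a i)" for x k a
  proof -
    have "(\<Sum>j\<in>S. l j * (of_int ((x(s := k)) j) + a j)) = (\<Sum>j\<in>S. l j * (of_int (x j) + a j))"
      "qf S A1 (\<lambda>i. of_int ((x(s := k)) i) + a i) = qf S A1 (\<lambda>i. of_int (x i) + a i)"
      using insert.hyps by (auto intro!: sum.cong qf_cong)
    then show ?thesis unfolding square \<alpha>_def by (simp add: add.assoc)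
  qed
  have Q'y: "Q' (\<lambda>i. of_int ((y(s := m)) i) - b i)
      = (of_int m - b s)^2 / d + Q1 (\<lambda>i. of_int (y i) - (b i + (of_int m - b s) * l i))" for y m b
  proof -
    have "Q1 (\<lambda>j. of_int ((y(s := m)) j) - b j - (of_int m - b s) * l j)
      = Q1 (\<lambda>i. of_int (y i) - (b i + (of_int m - b s) * l i))"
      using insert.hyps by (intro Q1cong) auto
    then show ?thesis unfolding Q'_def by simp
  qed
  have exp_split: "exp (- pi * t * qf (insert s S) A (\<lambda>i. of_int ((x(s := k)) i) + a i))
      = exp (- pi * (t * d) * (of_int k + \<alpha> a x)^2) * exp (- pi * t * qf S A1 (\<lambda>i. of_int (x i) + a i))" for t x k a
    unfolding qfx by (simp add: algebra_simps flip: exp_add)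
  have exp_split': "exp (- pi * Q' (\<lambda>i. of_int ((y(s := m)) i) - b i) / t)
      = exp (- pi * (of_int m - b s)^2 / (t * d)) * exp (- pi * Q1 (\<lambda>i. of_int (y i) - (b i + (of_int m - b s) * l i)) / t)"
      if "t > 0" for t y m b
    unfolding Q'y using that d by (simp add: field_simps flip: exp_add)
  have summA: "(\<lambda>(x, k). exp (- pi * t * qf (insert s S) A (\<lambda>i. of_int ((x(s := k)) i) + a i))) summable_on ?X S \<times> UNIV"
    if t: "t > 0" for t a
  proof -
    have td: "t * d > 0" using t d by simp
    obtain C where C: "\<And>a. (\<Sum>\<^sub>\<infinity>n::int. exp (- pi * (t * d) * (of_int n + a)^2)) \<le> C"
      using gaussian_sum_bounded[OF td] by blast
    have "(\<lambda>z. case z of (x, k) \<Rightarrow> exp (- pi * t * qf (insert s S) A (\<lambda>i. of_int ((x(s := k)) i) + a i))) summable_on ?X S \<times> UNIV"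
    proof (rule summable_on_SigmaI_bounded[where g = "\<lambda>x. C * exp (- pi * t * qf S A1 (\<lambda>i. of_int (x i) + a i))"])
      show "(\<lambda>x. C * exp (- pi * t * qf S A1 (\<lambda>i. of_int (x i) + a i))) summable_on ?X S"
        by (intro summable_on_cmult_right sumA1 t)
    next
      fix x :: "'a \<Rightarrow> int"
      show "(\<lambda>y. case (x, y) of (x, k) \<Rightarrow> exp (- pi * t * qf (insert s S) A (\<lambda>i. of_int ((x(s := k)) i) + a i))) summable_on UNIV"
        unfolding prod.case exp_split by (intro summable_on_cmult_left summable_on_shifted_gaussian td)
      show "(\<Sum>\<^sub>\<infinity>y. case (x, y) of (x, k) \<Rightarrow> exp (- pi * t * qf (insert s S) A (\<lambda>i. of_int ((x(s := k)) i) + a i)))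
         \<le> C * exp (- pi * t * qf S A1 (\<lambda>i. of_int (x i) + a i))"
        unfolding prod.case exp_split infsum_cmult_left' by (intro mult_right_mono C) auto
    qed auto
    then show ?thesis .
  qed
  have summQ: "(\<lambda>(m, y). exp (- pi * Q' (\<lambda>i. of_int ((y(s := m)) i) - b i) / t)) summable_on UNIV \<times> ?X S"
    if t: "t > 0" for t b
  proof -
    \<comment> \<open>A bound independent of \<open>b\<close>: the induction hypothesis at
      \<open>a = 0\<close> is read backwards, its other side containing \<open>b\<close> only in
      phases.\<close>
    define C where "C = (\<Sum>\<^sub>\<infinity>x\<in>?X S. exp (- pi * t * qf S A1 (\<lambda>i. of_int (x i) + 0))) / (c1 * (1 / sqrt t) ^ card S)"
    have C: "(\<Sum>\<^sub>\<infinity>y\<in>?X S. exp (- pi * Q1 (\<lambda>i. of_int (y i) - b i) / t)) \<le> C" for b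
    proof -
      let ?R = "\<Sum>\<^sub>\<infinity>y\<in>?X S. exp (- pi * Q1 (\<lambda>i. of_int (y i) - b i) / t)"
      have k: "c1 * (1 / sqrt t) ^ card S > 0" using c1 t by simp
      have "complex_of_real (c1 * (1 / sqrt t) ^ card S * ?R)
         = c1 * (1 / sqrt t) ^ card S * (\<Sum>\<^sub>\<infinity>y\<in>?X S. complex_of_real (exp (- pi * Q1 (\<lambda>i. of_int (y i) - b i) / t)))"
        by (simp only: infsum_complex_of_real[OF sumQ1[OF t]] of_real_mult)
      also have "\<dots> = (\<Sum>\<^sub>\<infinity>x\<in>?X S. exp (- pi * t * qf S A1 (\<lambda>i. of_int (x i) + 0))
            * cis (2 * pi * (\<Sum>i\<in>S. b i * (of_int (x i) + 0))))"
        using IH[OF t, of "\<lambda>_. 0" b] by simp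
      finally have e: "complex_of_real (c1 * (1 / sqrt t) ^ card S * ?R) = (\<Sum>\<^sub>\<infinity>x\<in>?X S. exp (- pi * t * qf S A1 (\<lambda>i. of_int (x i) + 0))
            * cis (2 * pi * (\<Sum>i\<in>S. b i * (of_int (x i) + 0))))" .
      have "\<bar>c1 * (1 / sqrt t) ^ card S * ?R\<bar> = norm (\<Sum>\<^sub>\<infinity>x\<in>?X S. exp (- pi * t * qf S A1 (\<lambda>i. of_int (x i) + 0))
            * cis (2 * pi * (\<Sum>i\<in>S. b i * (of_int (x i) + 0))))"
        unfolding e[symmetric] by (rule norm_of_real[symmetric])
      also have "\<dots> \<le> (\<Sum>\<^sub>\<infinity>x\<in>?X S. norm (exp (- pi * t * qf S A1 (\<lambda>i. of_int (x i) + 0))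
            * cis (2 * pi * (\<Sum>i\<in>S. b i * (of_int (x i) + 0)))))"
        using sumA1[OF t, of "\<lambda>_. 0"] by (intro norm_infsum_bound) (simp add: norm_mult)
      also have "\<dots> = (\<Sum>\<^sub>\<infinity>x\<in>?X S. exp (- pi * t * qf S A1 (\<lambda>i. of_int (x i) + 0)))"
        by (simp add: norm_mult)
      finally have "c1 * (1 / sqrt t) ^ card S * ?R \<le> (\<Sum>\<^sub>\<infinity>x\<in>?X S. exp (- pi * t * qf S A1 (\<lambda>i. of_int (x i) + 0)))"
        by linarith
      then show ?thesis unfolding C_def pos_le_divide_eq[OF k] by (simp only: mult.commute)
    qed
    have "(\<lambda>z. case z of (m, y) \<Rightarrow> exp (- pi * Q' (\<lambda>i. of_int ((y(s := m)) i) - b i) / t)) summable_on UNIV \<times> ?X S"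
    proof (rule summable_on_SigmaI_bounded[where g = "\<lambda>m. exp (- pi * (of_int m - b s)^2 / (t * d)) * C"])
      show "(\<lambda>m::int. exp (- pi * (of_int m - b s)^2 / (t * d)) * C) summable_on UNIV"
        using summable_on_shifted_gaussian[of "1 / (t * d)" "- b s"] t d
        by (intro summable_on_cmult_left) simp
    next
      fix m :: int
      show "(\<lambda>y. case (m, y) of (m, y) \<Rightarrow> exp (- pi * Q' (\<lambda>i. of_int ((y(s := m)) i) - b i) / t)) summable_on ?X S"
        unfolding prod.case exp_split'[OF t] by (intro summable_on_cmult_right sumQ1 t)
      show "(\<Sum>\<^sub>\<infinity>y\<in>?X S. case (m, y) of (m, y) \<Rightarrow> exp (- pi * Q' (\<lambda>i. of_int ((y(s := m)) i) - b i) / t))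
         \<le> exp (- pi * (of_int m - b s)^2 / (t * d)) * C"
        unfolding prod.case exp_split'[OF t] infsum_cmult_right' by (intro mult_left_mono C) auto
    qed auto
    then show ?thesis .
  qed
  have main: "(\<Sum>\<^sub>\<infinity>x\<in>?X (insert s S). exp (- pi * t * qf (insert s S) A (\<lambda>i. of_int (x i) + a i))
            * cis (2 * pi * (\<Sum>i\<in>insert s S. b i * (of_int (x i) + a i))))
        = (c1 / sqrt d) * (1 / sqrt t) ^ card (insert s S) * (\<Sum>\<^sub>\<infinity>y\<in>?X (insert s S). exp (- pi * Q' (\<lambda>i. of_int (y i) - b i) / t)
            * cis (2 * pi * (\<Sum>i\<in>insert s S. of_int (y i) * a i)))" (is "?L = ?R")
    if t: "t > 0" for t a b
  proof -
    have td: "t * d > 0" using t d by simp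
    define E1 where "E1 = (\<lambda>x. exp (- pi * t * qf S A1 (\<lambda>i. of_int (x i) + a i)))"
    define B where "B = (\<lambda>b x. \<Sum>i\<in>S. b i * (of_int (x i) + a i))"
    define g where "g = (\<lambda>m::int. exp (- pi * (of_int m - b s)^2 / (t * d)))"
    \<comment> \<open>For a fixed dual index \<open>m\<close> of the variable \<open>s\<close>, all
      phases that involve the other variables combine into this character.\<close>
    define b' where "b' = (\<lambda>(m::int) i. b i + (of_int m - b s) * l i)"
    define G where "G = (\<lambda>x k. complex_of_real (exp (- pi * t * qf (insert s S) A (\<lambda>i. of_int ((x(s := k)) i) + a i)))
            * cis (2 * pi * (\<Sum>i\<in>insert s S. b i * (of_int ((x(s := k)) i) + a i))))"
    define H where "H = (\<lambda>x m. complex_of_real (E1 x * g m) * cis (2 * pi * (of_int m * a s + B (b' m) x)))"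
    define K where "K = (\<lambda>m y. complex_of_real (exp (- pi * Q' (\<lambda>i. of_int ((y(s := m)) i) - b i) / t))
            * cis (2 * pi * (\<Sum>i\<in>insert s S. of_int ((y(s := m)) i) * a i)))"
    have Gx: "(\<Sum>\<^sub>\<infinity>k. G x k) = (\<Sum>\<^sub>\<infinity>m. H x m) / sqrt (t * d)" for x
    proof -
      have Hxm: "(exp (- pi * (of_int m - b s)^2 / (t * d)) * cis (2 * pi * of_int m * \<alpha> a x))
          * (E1 x * cis (2 * pi * (B b x - b s * B l x))) = H x m" for m
      proof -
        have "\<alpha> a x = a s + B l x" unfolding \<alpha>_def B_def ..
        moreover have "B (b' m) x = B b x + (of_int m - b s) * B l x"
          unfolding B_def b'_def by (simp add: sum_distrib_left algebra_simps flip: sum.distrib)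
        ultimately have "2 * pi * of_int m * \<alpha> a x + 2 * pi * (B b x - b s * B l x) = 2 * pi * (of_int m * a s + B (b' m) x)"
          by (simp only: ring_distribs mult_ac)
        then have "cis (2 * pi * (of_int m * a s + B (b' m) x)) = cis (2 * pi * of_int m * \<alpha> a x) * cis (2 * pi * (B b x - b s * B l x))"
          by (simp only: cis_mult)
        then show ?thesis unfolding H_def g_def by (simp only: of_real_mult mult_ac)
      qed
      have "(\<Sum>i\<in>S. b i * (of_int ((x(s := k)) i) + a i)) = B b x" for k
        unfolding B_def using insert.hyps by (intro sum.cong) auto
      then have Bk: "(\<Sum>i\<in>insert s S. b i * (of_int ((x(s := k)) i) + a i))
          = b s * (of_int k + \<alpha> a x) + (B b x - b s * B l x)" for k
        using insert.hyps by (simp add: \<alpha>_def B_def algebra_simps)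
      have "G x k = (exp (- pi * (t * d) * (of_int k + \<alpha> a x)^2) * cis (2 * pi * b s * (of_int k + \<alpha> a x)))
          * (E1 x * cis (2 * pi * (B b x - b s * B l x)))" for k
      proof -
        have "cis (2 * pi * (b s * (of_int k + \<alpha> a x) + (B b x - b s * B l x)))
          = cis (2 * pi * b s * (of_int k + \<alpha> a x)) * cis (2 * pi * (B b x - b s * B l x))"
          unfolding cis_mult by (simp add: algebra_simps)
        then show ?thesis unfolding G_def Bk exp_split E1_def by simp
      qed
      then have "(\<Sum>\<^sub>\<infinity>k. G x k) = (\<Sum>\<^sub>\<infinity>m. exp (- pi * (of_int m - b s)^2 / (t * d)) * cis (2 * pi * of_int m * \<alpha> a x)) / sqrt (t * d)
          * (E1 x * cis (2 * pi * (B b x - b s * B l x)))"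
        using poisson_gaussian[OF td, of "\<alpha> a x" "b s"] by (simp add: infsum_cmult_left')
      also have "\<dots> = (\<Sum>\<^sub>\<infinity>m. (exp (- pi * (of_int m - b s)^2 / (t * d)) * cis (2 * pi * of_int m * \<alpha> a x))
          * (E1 x * cis (2 * pi * (B b x - b s * B l x)))) / sqrt (t * d)"
        by (subst infsum_cmult_left') simp
      also have "\<dots> = (\<Sum>\<^sub>\<infinity>m. H x m) / sqrt (t * d)"
        by (simp only: Hxm)
      finally show ?thesis .
    qed
    have Hm: "(\<Sum>\<^sub>\<infinity>x\<in>?X S. H x m) = c1 * (1 / sqrt t) ^ card S * (\<Sum>\<^sub>\<infinity>y\<in>?X S. K m y)" for m
    proof -
      have "H x m = (g m * cis (2 * pi * (of_int m * a s))) * (E1 x * cis (2 * pi * B (b' m) x))" for x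
      proof -
        have "cis (2 * pi * (of_int m * a s + B (b' m) x)) = cis (2 * pi * (of_int m * a s)) * cis (2 * pi * B (b' m) x)"
          unfolding cis_mult by (simp add: algebra_simps)
        then show ?thesis unfolding H_def by simp
      qed
      then have "(\<Sum>\<^sub>\<infinity>x\<in>?X S. H x m) = (g m * cis (2 * pi * (of_int m * a s)))
          * (c1 * (1 / sqrt t) ^ card S * (\<Sum>\<^sub>\<infinity>y\<in>?X S. exp (- pi * Q1 (\<lambda>i. of_int (y i) - b' m i) / t)
            * cis (2 * pi * (\<Sum>i\<in>S. of_int (y i) * a i))))"
        using IH[OF t, of a "b' m"] by (simp only: infsum_cmult_right' E1_def B_def)
      also have "\<dots> = c1 * (1 / sqrt t) ^ card S * ((g m * cis (2 * pi * (of_int m * a s))) *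
           (\<Sum>\<^sub>\<infinity>y\<in>?X S. exp (- pi * Q1 (\<lambda>i. of_int (y i) - b' m i) / t)
            * cis (2 * pi * (\<Sum>i\<in>S. of_int (y i) * a i))))"
        by (simp only: mult_ac)
      also have "(g m * cis (2 * pi * (of_int m * a s))) *
           (\<Sum>\<^sub>\<infinity>y\<in>?X S. exp (- pi * Q1 (\<lambda>i. of_int (y i) - b' m i) / t)
            * cis (2 * pi * (\<Sum>i\<in>S. of_int (y i) * a i))) = (\<Sum>\<^sub>\<infinity>y\<in>?X S. K m y)"
        unfolding infsum_cmult_right'[symmetric]
      proof (rule infsum_cong)
        fix y
        have "(\<Sum>i\<in>S. of_int ((y(s := m)) i) * a i) = (\<Sum>i\<in>S. of_int (y i) * a i)"
          using insert.hyps by (intro sum.cong) auto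
        then have "cis (2 * pi * (\<Sum>i\<in>insert s S. of_int ((y(s := m)) i) * a i))
            = cis (2 * pi * (of_int m * a s)) * cis (2 * pi * (\<Sum>i\<in>S. of_int (y i) * a i))"
          using insert.hyps unfolding cis_mult by (simp add: algebra_simps)
        then show "(g m * cis (2 * pi * (of_int m * a s))) * (exp (- pi * Q1 (\<lambda>i. of_int (y i) - b' m i) / t)
            * cis (2 * pi * (\<Sum>i\<in>S. of_int (y i) * a i))) = K m y"
          unfolding K_def exp_split'[OF t] g_def b'_def by simp
      qed
      finally show ?thesis .
    qed
    have "?L = (\<Sum>\<^sub>\<infinity>(x, k)\<in>?X S \<times> UNIV. G x k)"
      unfolding G_def by (subst infsum_reindex_bij_betw[OF bij', symmetric]) (simp add: case_prod_unfold)
    also have "\<dots> = (\<Sum>\<^sub>\<infinity>x\<in>?X S. \<Sum>\<^sub>\<infinity>k. G x k)"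
    proof (rule infsum_Sigma'_banach[symmetric], rule abs_summable_summable)
      show "(\<lambda>z. norm (case z of (x, k) \<Rightarrow> G x k)) summable_on ?X S \<times> UNIV"
        using summA[OF t, of a] by (simp add: G_def case_prod_unfold norm_mult)
    qed
    also have "\<dots> = (\<Sum>\<^sub>\<infinity>x\<in>?X S. (\<Sum>\<^sub>\<infinity>m. H x m) / sqrt (t * d))"
      by (simp only: Gx)
    also have "\<dots> = (\<Sum>\<^sub>\<infinity>x\<in>?X S. \<Sum>\<^sub>\<infinity>m. H x m) / sqrt (t * d)"
      by (simp only: divide_inverse infsum_cmult_left')
    finally have e1: "?L = (\<Sum>\<^sub>\<infinity>x\<in>?X S. \<Sum>\<^sub>\<infinity>m. H x m) / sqrt (t * d)" .
    have "(\<Sum>\<^sub>\<infinity>x\<in>?X S. \<Sum>\<^sub>\<infinity>m. H x m) = (\<Sum>\<^sub>\<infinity>m. \<Sum>\<^sub>\<infinity>x\<in>?X S. H x m)"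
    proof (rule infsum_swap_banach, rule abs_summable_summable)
      have "E1 summable_on ?X S" unfolding E1_def by (rule sumA1[OF t])
      moreover have "g summable_on UNIV"
        using summable_on_shifted_gaussian[of "1 / (t * d)" "- b s"] td by (simp add: g_def)
      ultimately have "(\<lambda>(x, m). E1 x * g m) summable_on ?X S \<times> UNIV"
        by (rule summable_on_Times_mult) (auto simp: E1_def g_def)
      then show "(\<lambda>z. norm (case z of (x, m) \<Rightarrow> H x m)) summable_on ?X S \<times> UNIV"
        by (simp add: H_def case_prod_unfold norm_mult E1_def g_def)
    qed
    also have "\<dots> = (\<Sum>\<^sub>\<infinity>m. c1 * (1 / sqrt t) ^ card S * (\<Sum>\<^sub>\<infinity>y\<in>?X S. K m y))"
      by (simp only: Hm)
    also have "\<dots> = c1 * (1 / sqrt t) ^ card S * (\<Sum>\<^sub>\<infinity>m. \<Sum>\<^sub>\<infinity>y\<in>?X S. K m y)"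
      by (rule infsum_cmult_right')
    finally have e2: "(\<Sum>\<^sub>\<infinity>x\<in>?X S. \<Sum>\<^sub>\<infinity>m. H x m) = c1 * (1 / sqrt t) ^ card S * (\<Sum>\<^sub>\<infinity>m. \<Sum>\<^sub>\<infinity>y\<in>?X S. K m y)" .
    have "(\<Sum>\<^sub>\<infinity>m. \<Sum>\<^sub>\<infinity>y\<in>?X S. K m y) = (\<Sum>\<^sub>\<infinity>(m, y)\<in>UNIV \<times> ?X S. K m y)"
    proof (rule infsum_Sigma'_banach, rule abs_summable_summable)
      show "(\<lambda>z. norm (case z of (m, y) \<Rightarrow> K m y)) summable_on UNIV \<times> ?X S"
        using summQ[OF t, of b] by (simp add: K_def case_prod_unfold norm_mult)
    qed
    also have "\<dots> = (\<Sum>\<^sub>\<infinity>y\<in>?X (insert s S). exp (- pi * Q' (\<lambda>i. of_int (y i) - b i) / t)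
            * cis (2 * pi * (\<Sum>i\<in>insert s S. of_int (y i) * a i)))" (is "_ = ?Y")
      unfolding K_def by (subst infsum_reindex_bij_betw[OF bij, symmetric]) (simp add: case_prod_unfold)
    finally have e3: "(\<Sum>\<^sub>\<infinity>m. \<Sum>\<^sub>\<infinity>y\<in>?X S. K m y) = ?Y" .
    have e4: "c1 * (1 / sqrt t) ^ card S * Y / sqrt (t * d) = (c1 / sqrt d) * (1 / sqrt t) ^ card (insert s S) * Y" for Y :: complex
      using insert.hyps by (simp add: real_sqrt_mult)
    show ?thesis unfolding e1 e2 e3 by (rule e4)
  qed
  have dual: "Q' v = qf (insert s S) A u" if v: "\<forall>i\<in>insert s S. v i = (\<Sum>j\<in>insert s S. A i j * u j)" for u v
  proof -
    define m where "m = (\<Sum>j\<in>S. A s j * u j)"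
    have vs: "v s = d * u s + m" using v insert.hyps by (simp add: d_def m_def)
    have lm: "(\<Sum>j\<in>S. l j * u j) = m / d" unfolding l_def m_def by (simp add: sum_divide_distrib)
    have "Q1 (\<lambda>j. v j - v s * l j) = qf S A1 u"
    proof (intro Q1dual ballI)
      fix i assume i: "i \<in> S"
      have "(\<Sum>j\<in>S. A1 i j * u j) = (\<Sum>j\<in>S. A i j * u j) - A i s / d * m"
        unfolding A1_def m_def by (simp add: sum_distrib_left sum_subtractf algebra_simps)
      moreover have "v i = A i s * u s + (\<Sum>j\<in>S. A i j * u j)" using v i insert.hyps by simp
      moreover have "A i s = A s i" using sym i by simp
      ultimately show "v i - v s * l i = (\<Sum>j\<in>S. A1 i j * u j)"
        unfolding vs l_def using d by (simp add: field_simps)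
    qed
    then show ?thesis unfolding square Q'_def vs lm using d by (simp add: field_simps power2_eq_square)
  qed
  show ?case
    unfolding poisson_dual_def
  proof (intro exI[of _ "c1 / sqrt d"] conjI exI[of _ Q'] allI impI)
    show "c1 / sqrt d > 0" using c1 d by simp
    show "Q' v = Q' v'" if "\<forall>i\<in>insert s S. v i = v' i" for v v'
      unfolding Q'_def using that Q1cong[of "\<lambda>j. v j - v s * l j" "\<lambda>j. v' j - v' s * l j"] by simp
    show "Q' v = qf (insert s S) A u" if "\<forall>i\<in>insert s S. v i = (\<Sum>j\<in>insert s S. A i j * u j)" for u v
      using dual[OF that] .
    show "(\<lambda>x. exp (- pi * t * qf (insert s S) A (\<lambda>i. of_int (x i) + a i))) summable_on ?X (insert s S)" if "t > 0" for t a
      using summA[OF that, of a] unfolding summable_on_reindex_bij_betw[OF bij', symmetric] by (simp add: case_prod_unfold)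
    show "(\<lambda>y. exp (- pi * Q' (\<lambda>i. of_int (y i) - b i) / t)) summable_on ?X (insert s S)" if "t > 0" for t b
      using summQ[OF that, of b] unfolding summable_on_reindex_bij_betw[OF bij, symmetric] by (simp add: case_prod_unfold)
  qed (rule main)
qed

section \<open>Theta series and the modular group\<close>

text \<open>Summability at one positive \<open>r\<close> makes the fibres of \<open>d\<close>
  finite, and grouping by degree turns the sum into a power series. The coefficient of degree 1 is
  recorded because it will count unit vectors.\<close>

lemma counting_power_series:
  fixes d :: "'a \<Rightarrow> nat" and X :: "'a set"
  assumes summ: "\<And>r::real. 0 < r \<Longrightarrow> r < 1 \<Longrightarrow> (\<lambda>x. r ^ d x) summable_on X"
  defines "F \<equiv> \<lambda>q::complex. \<Sum>\<^sub>\<infinity>x\<in>X. q ^ d x"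
  shows "finite {x\<in>X. d x = k}"
    and "F holomorphic_on ball 0 1"
    and "F 0 = of_nat (card {x\<in>X. d x = 0})"
    and "(F has_field_derivative of_nat (card {x\<in>X. d x = 1})) (at 0)"
proof -
  show fin: "finite {x\<in>X. d x = k}" for k
  proof -
    have "(\<lambda>x. (1/2::real) ^ d x) summable_on {x\<in>X. d x = k}"
      by (rule summable_on_subset_banach[OF summ]) auto
    then have "(\<lambda>x. (1/2::real) ^ k) summable_on {x\<in>X. d x = k}"
      by (rule summable_on_cong[THEN iffD1, rotated]) auto
    then show ?thesis using infsum_diverge_constant[of "{x\<in>X. d x = k}" "(1/2::real) ^ k"] by auto
  qed
  define N where "N = (\<lambda>k. card {x\<in>X. d x = k})"
  have series: "(\<lambda>k. of_nat (N k) * q ^ k) sums F q" if q: "norm q < 1" for q :: complex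
  proof -
    define r where "r = (norm q + 1) / 2"
    have r: "0 < r" "r < 1" "norm q \<le> r" using q by (auto simp: r_def intro: add_nonneg_pos)
    have "(\<lambda>x. norm (q ^ d x)) summable_on X"
      by (rule summable_on_comparison_test[OF summ[OF r(1,2)]]) (auto simp: norm_power intro: power_mono r)
    then have "(\<lambda>x. q ^ d x) summable_on X" by (rule abs_summable_summable)
    then have hs: "((\<lambda>x. q ^ d x) has_sum F q) X" unfolding F_def by simp
    have "bij_betw (\<lambda>x. (d x, x)) X (Sigma UNIV (\<lambda>k. {x\<in>X. d x = k}))"
      by (auto simp: bij_betw_def inj_on_def)
    from has_sum_reindex_bij_betw[OF this, of "\<lambda>(k, x). q ^ k" "F q"]
    have "((\<lambda>(k, x). q ^ k) has_sum F q) (Sigma UNIV (\<lambda>k. {x\<in>X. d x = k}))"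
      using hs by simp
    then have "((\<lambda>k. of_nat (N k) * q ^ k) has_sum F q) UNIV"
    proof (rule has_sum_Sigma')
      fix k
      have "((\<lambda>x. q ^ k) has_sum (\<Sum>x\<in>{x\<in>X. d x = k}. q ^ k)) {x\<in>X. d x = k}"
        by (rule has_sum_finite[OF fin])
      then show "((\<lambda>y. case (k, y) of (k, x) \<Rightarrow> q ^ k) has_sum of_nat (N k) * q ^ k) {x\<in>X. d x = k}"
        by (simp add: N_def)
    qed
    then show ?thesis by (rule has_sum_imp_sums)
  qed
  show "F holomorphic_on ball 0 1"
    by (rule power_series_holomorphic[where a = "\<lambda>k. of_nat (N k)"]) (use series in auto)
  show "F 0 = of_nat (card {x\<in>X. d x = 0})"
    using series[of 0] by (simp add: N_def)
  have "((\<lambda>q. \<Sum>k. of_nat (N k) * q ^ k) has_field_derivative (\<Sum>k. diffs (\<lambda>k. of_nat (N k)) k * 0 ^ k)) (at (0::complex))"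
    by (rule termdiffs_strong[where K = "1/2"]) (use series[of "1/2"] in \<open>auto simp: sums_iff\<close>)
  then have "((\<lambda>q. \<Sum>k. of_nat (N k) * q ^ k) has_field_derivative of_nat (N 1)) (at (0::complex))"
    by (simp only: powser_zero) (simp add: diffs_def)
  then have "(F has_field_derivative of_nat (N 1)) (at 0)"
    by (rule has_field_derivative_transform_within_open[where S = "ball 0 1"])
      (use series in \<open>auto simp: sums_iff\<close>)
  then show "(F has_field_derivative of_nat (card {x\<in>X. d x = 1})) (at 0)"
    unfolding N_def .
qed

lemma has_sum_geometric_int:
  fixes r :: real
  assumes "0 \<le> r" "r < 1"
  shows "((\<lambda>k::int. r ^ nat \<bar>k\<bar>) has_sum 2 * r / (1 - r)) (- {0})"
proof -
  have geo: "((\<lambda>n::nat. r ^ Suc n) has_sum r / (1 - r)) UNIV"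
    using assms has_sum_cmult_right[OF sums_nonneg_imp_has_sum[OF geometric_sums, of r], of r] by simp
  have "((\<lambda>k::int. r ^ nat \<bar>k\<bar>) has_sum r / (1 - r)) (range (\<lambda>n. int n + 1))"
    by (subst has_sum_reindex) (use geo in \<open>auto simp: o_def inj_on_def nat_add_distrib\<close>)
  moreover have "((\<lambda>k::int. r ^ nat \<bar>k\<bar>) has_sum r / (1 - r)) (range (\<lambda>n. - int n - 1))"
  proof (subst has_sum_reindex)
    have "nat \<bar>- int n - 1\<bar> = Suc n" for n by simp
    then show "((\<lambda>k. r ^ nat \<bar>k\<bar>) \<circ> (\<lambda>n. - int n - 1) has_sum r / (1 - r)) UNIV"
      using geo by (simp add: o_def)
  qed (auto simp: inj_on_def)
  ultimately have "((\<lambda>k::int. r ^ nat \<bar>k\<bar>) has_sum r / (1 - r) + r / (1 - r))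
      (range (\<lambda>n. int n + 1) \<union> range (\<lambda>n. - int n - 1))"
    by (rule has_sum_Un_disjoint) auto
  moreover have "range (\<lambda>n. int n + 1) \<union> range (\<lambda>n. - int n - 1) = - {0}"
  proof -
    have "k \<in> range (\<lambda>n. int n + 1) \<union> range (\<lambda>n. - int n - 1)" if "k \<noteq> 0" for k :: int
    proof (cases "k > 0")
      case True
      then have "k = int (nat (k - 1)) + 1" by simp
      then show ?thesis by blast
    next
      case False
      with that have "k = - int (nat (- k - 1)) - 1" by simp
      then show ?thesis by blast
    qed
    then show ?thesis by auto
  qed
  ultimately show ?thesis by simp
qed

lemma int_theta_summable:
  fixes e :: "int \<Rightarrow> nat" and r :: real
  assumes "finite Z" "\<And>k. k \<notin> Z \<Longrightarrow> nat \<bar>k\<bar> \<le> e k" "0 < r" "r < 1"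
  shows "(\<lambda>k. r ^ e k) summable_on UNIV"
proof -
  have "(\<lambda>k::int. r ^ nat \<bar>k\<bar>) summable_on (- {0} - Z)"
    using has_sum_geometric_int[of r] assms
    by (intro summable_on_subset_banach[OF has_sum_imp_summable]) auto
  then have "(\<lambda>k. r ^ e k) summable_on (- {0} - Z)"
    by (rule summable_on_comparison_test) (use assms in \<open>auto intro: power_decreasing\<close>)
  moreover have "(\<lambda>k. r ^ e k) summable_on insert 0 Z" using assms by (intro summable_on_finite) auto
  ultimately have "(\<lambda>k. r ^ e k) summable_on (- {0} - Z) \<union> insert 0 Z" by (rule summable_on_union)
  also have "(- {0} - Z) \<union> insert 0 Z = UNIV" by auto
  finally show ?thesis .
qed

text \<open>The terms over \<open>Z\<close> are all 1, while the others sum to at most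
  \<open>2 r / (1 - r)\<close> in modulus, which is below 1 for \<open>r < 1/3\<close>. The set
  \<open>Z\<close> is \<open>{0}\<close> for \<open>theta3\<close> and \<open>{0, -1}\<close> for
  \<open>theta2\<close>.\<close>

lemma int_theta_nonzero:
  fixes e :: "int \<Rightarrow> nat" and q :: complex
  assumes Z: "finite Z" "0 \<in> Z" "\<And>k. k \<in> Z \<Longrightarrow> e k = 0" "\<And>k. k \<notin> Z \<Longrightarrow> nat \<bar>k\<bar> \<le> e k"
    and q: "norm q < 1 / 3"
  shows "(\<Sum>\<^sub>\<infinity>k. q ^ e k) \<noteq> 0"
proof
  assume zero: "(\<Sum>\<^sub>\<infinity>k. q ^ e k) = 0"
  define r where "r = norm q"
  have r: "0 \<le> r" "r < 1 / 3" using q by (auto simp: r_def)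
  have g: "((\<lambda>k::int. r ^ nat \<bar>k\<bar>) has_sum 2 * r / (1 - r)) (- {0})"
    using r by (intro has_sum_geometric_int) auto
  have s1: "(\<lambda>k::int. r ^ nat \<bar>k\<bar>) summable_on - Z"
    by (rule summable_on_subset_banach[OF has_sum_imp_summable[OF g]]) (use Z in auto)
  have s2: "(\<lambda>k. norm (q ^ e k)) summable_on - Z"
    by (rule summable_on_comparison_test[OF s1])
      (use Z r in \<open>auto simp: norm_power r_def[symmetric] intro: power_decreasing\<close>)
  have s3: "((\<lambda>k. q ^ e k) has_sum infsum (\<lambda>k. q ^ e k) (- Z)) (- Z)"
    using abs_summable_summable[OF s2] by simp
  have "((\<lambda>k. q ^ e k) has_sum of_nat (card Z)) Z"
    using has_sum_finite[OF Z(1), of "\<lambda>k. q ^ e k"] Z by simp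
  from has_sum_Un_disjoint[OF s3 this] have "((\<lambda>k. q ^ e k) has_sum infsum (\<lambda>k. q ^ e k) (- Z) + of_nat (card Z)) UNIV"
    by (simp add: Compl_partition2)
  with zero have "infsum (\<lambda>k. q ^ e k) (- Z) = - of_nat (card Z)"
    by (metis infsumI eq_neg_iff_add_eq_0)
  then have "real (card Z) = norm (infsum (\<lambda>k. q ^ e k) (- Z))" by simp
  also have "\<dots> \<le> infsum (\<lambda>k. norm (q ^ e k)) (- Z)" by (rule norm_infsum_bound[OF s2])
  also have "\<dots> \<le> infsum (\<lambda>k. r ^ nat \<bar>k\<bar>) (- Z)"
    by (rule infsum_mono[OF s2 s1])
      (use Z r in \<open>auto simp: norm_power r_def[symmetric] intro: power_decreasing\<close>)
  also have "\<dots> \<le> infsum (\<lambda>k. r ^ nat \<bar>k\<bar>) (- {0})"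
    by (rule infsum_mono_neutral[OF s1 has_sum_imp_summable[OF g]]) (use Z r in auto)
  also have "\<dots> = 2 * r / (1 - r)" by (rule infsumI[OF g])
  also have "\<dots> < 1" using r by (simp add: field_simps)
  finally have "card Z = 0" by simp
  then show False using Z by auto
qed

text \<open>Carries the identities that real Poisson summation gives for \<open>z = \<i> t\<close>
  to the whole half plane.\<close>

lemma holomorphic_eq_on_imaginary_axis:
  assumes "f holomorphic_on {z. Im z > 0}" "g holomorphic_on {z. Im z > 0}"
    and eq: "\<And>t. 0 < (t::real) \<Longrightarrow> f (\<i> * of_real t) = g (\<i> * of_real t)" and z: "Im z > 0"
  shows "f z = g z"
proof -
  have "(\<lambda>z. f z - g z) z = 0"
  proof (rule analytic_continuation[where f = "\<lambda>z. f z - g z" and w = z and S = "{z. Im z > 0}" and U = "(\<lambda>t. \<i> * complex_of_real t) ` {0<..}" and \<xi> = \<i>])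
    show "connected {z. Im z > 0}" by (intro convex_connected convex_halfspace_Im_gt)
    show "open {z. Im z > 0}" by (rule open_halfspace_Im_gt)
    show "\<i> islimpt (\<lambda>t. \<i> * complex_of_real t) ` {0<..}"
      unfolding islimpt_approachable
    proof (intro allI impI)
      fix \<epsilon> :: real assume e: "\<epsilon> > 0"
      have "\<i> * complex_of_real (1 + \<epsilon>/2) - \<i> = \<i> * complex_of_real (\<epsilon>/2)" by (simp add: algebra_simps)
      then have "dist (\<i> * complex_of_real (1 + \<epsilon>/2)) \<i> = \<epsilon>/2"
        using e unfolding dist_norm by (simp only: norm_mult norm_of_real) simp
      moreover have "\<i> * complex_of_real (1 + \<epsilon>/2) \<noteq> \<i>" using e by (auto simp: complex_eq_iff)
      ultimately show "\<exists>x'\<in>(\<lambda>t. \<i> * complex_of_real t) ` {0<..}. x' \<noteq> \<i> \<and> dist x' \<i> < \<epsilon>"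
        using e by (intro bexI[of _ "\<i> * complex_of_real (1 + \<epsilon>/2)"] imageI) auto
    qed
  qed (use assms in \<open>auto intro!: holomorphic_intros\<close>)
  then show ?thesis by simp
qed

text \<open>The translations \<open>z \<mapsto> z \<plusminus> 1\<close> bring \<open>z\<close> into the strip \<open>\<bar>Re z\<bar> \<le> 1/2\<close>; if then \<open>Im z < 1/2\<close>,
  the inversion \<open>z \<mapsto> -1/z\<close> at least doubles the imaginary part.\<close>

lemma modular_induct:
  fixes P :: "complex \<Rightarrow> bool"
  assumes T: "\<And>z. Im z > 0 \<Longrightarrow> P (z + 1) \<longleftrightarrow> P z"
    and S: "\<And>z. Im z > 0 \<Longrightarrow> P (- 1 / z) \<Longrightarrow> P z"
    and base: "\<And>z. Im z \<ge> 1 / 2 \<Longrightarrow> P z"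
    and z: "Im z > 0"
  shows "P z"
proof -
  have T': "P (z + of_int k) \<longleftrightarrow> P z" if "Im z > 0" for z and k :: int
  proof (induction k rule: int_induct[where k = 0])
    case (step1 i)
    then show ?case using T[of "z + of_int i"] that by (simp add: add.assoc)
  next
    case (step2 i)
    then show ?case using T[of "z + of_int (i - 1)"] that by (simp add: add.assoc)
  qed simp
  have main: "P z" if "Im z \<ge> 1 / 2 ^ Suc n" for z n
    using that
  proof (induction n arbitrary: z)
    case 0
    then show ?case using base by simp
  next
    case (Suc n)
    show ?case
    proof (cases "Im z \<ge> 1 / 2")
      case False
      have pos: "Im z > 0" by (rule less_le_trans[OF _ Suc.prems]) simp
      define w where "w = z + of_int (- round (Re z))"
      have "\<bar>Re w\<bar> \<le> 1 / 2" using of_int_round_abs_le[of "Re z"] by (simp add: w_def abs_minus_commute)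
      then have "(Re w)^2 \<le> (1/2)^2" by (metis abs_le_square_iff abs_of_nonneg zero_le_divide_1_iff zero_le_numeral)
      moreover have Imw: "Im w = Im z" by (simp add: w_def)
      moreover have "(Im w)^2 \<le> (1/2)^2" using False pos Imw by (intro power_mono) auto
      ultimately have nw: "(Re w)^2 + (Im w)^2 \<le> 1/2" by (simp add: power2_eq_square)
      have nw0: "(Re w)^2 + (Im w)^2 > 0" using pos Imw by (simp add: add_nonneg_pos)
      have "Im (- 1 / w) = Im w / ((Re w)^2 + (Im w)^2)" by (simp add: Im_divide)
      also have "\<dots> \<ge> 2 * Im w" using nw nw0 pos Imw
        by (simp add: pos_le_divide_eq)
      finally have "2 * Im w \<le> Im (- 1 / w)" .
      moreover have "1 / 2 ^ Suc n \<le> 2 * Im w" using Suc.prems Imw by (simp add: field_simps)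
      ultimately have "Im (- 1 / w) \<ge> 1 / 2 ^ Suc n" by linarith
      then have "P (- 1 / w)" by (rule Suc.IH)
      then have "P w" using S[of w] pos Imw by simp
      then show ?thesis using T'[OF pos, of "- round (Re z)"] unfolding w_def by simp
    qed (rule base)
  qed
  obtain n where "1 / Im z < 2 ^ n" using real_arch_pow[of 2 "1 / Im z"] by auto
  then have "1 / 2 ^ n < Im z" using z by (simp add: field_simps)
  moreover have "1 / 2 ^ Suc n \<le> (1 / 2 ^ n :: real)" by (simp add: field_simps)
  ultimately show ?thesis by (intro main[of n]) linarith
qed

section \<open>The nome and Jacobi's theta functions\<close>

text \<open>The convention with \<open>\<i> pi z\<close> suits lattices with vectors of odd norm:
  the exponent of \<open>q\<close> is the norm itself, and \<open>z + 1\<close> changes the sign of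
  \<open>q\<close>.\<close>

definition nome :: "complex \<Rightarrow> complex" where
  "nome z = exp (\<i> * pi * z)"

lemma nome_holomorphic [holomorphic_intros]:
  "f holomorphic_on A \<Longrightarrow> (\<lambda>z. nome (f z)) holomorphic_on A"
  unfolding nome_def by (intro holomorphic_intros)

lemma norm_nome: "norm (nome z) = exp (- pi * Im z)"
  by (simp add: nome_def)

lemma norm_nome_less_1 [simp]: "Im z > 0 \<Longrightarrow> norm (nome z) < 1"
  by (simp add: norm_nome)

lemma nome_plus_1: "nome (z + 1) = - nome z"
  by (simp add: nome_def ring_distribs exp_add)

lemma nome_imaginary: "nome (\<i> * of_real t) = of_real (exp (- pi * t))"
proof -
  have "\<i> * pi * (\<i> * of_real t) = of_real (- pi * t)" by (simp add: algebra_simps)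
  then show ?thesis unfolding nome_def by (simp only: exp_of_real)
qed

lemma nome_surj:
  assumes "norm u < 1" "u \<noteq> 0"
  obtains z where "Im z > 0" "nome z = u"
proof
  define z where "z = Ln u / (\<i> * pi)"
  have "\<i> * pi * z = Ln u" by (simp add: z_def)
  then show "nome z = u" using assms by (simp add: nome_def)
  then have "exp (- pi * Im z) < 1" using assms norm_nome[of z] by simp
  then show "Im z > 0" by (simp add: zero_less_mult_iff)
qed

text \<open>Links two thresholds: \<open>modular_induct\<close> needs a base for
  \<open>Im z \<ge> 1/2\<close>, where the nome has at most this modulus, and
  \<open>int_theta_nonzero\<close> works below \<open>1/3\<close>.\<close>

lemma exp_pi_half_bound: "exp (- pi / 2) < 1 / 3"
proof -
  have "exp (- pi / 2) < exp (- (3/2))" using pi_gt3 by simp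
  moreover have "exp (3/2 :: real) \<ge> 1 + 3/2 + (3/2)^2 / 2"
    using exp_lower_Taylor_quadratic[of "3/2"] by simp
  then have "exp (3/2 :: real) > 3" by (simp add: power2_eq_square)
  then have "exp (- (3/2) :: real) < 1 / 3" by (simp add: exp_minus field_simps)
  ultimately show ?thesis by (rule less_trans)
qed

lemma Im_neg_inverse_pos: "Im z > 0 \<Longrightarrow> Im (- 1 / z) > 0"
  by (auto simp: Im_divide add_nonneg_pos)

text \<open>\<open>F\<close> and \<open>F2\<close> are the theta series, in the nome, of a unimodular lattice of rank \<open>N\<close> and of its
  translate by half a characteristic vector of minimal norm \<open>m\<close>, the latter divided by \<open>q\<^sup>m\<^sup>/\<^sup>4\<close>.\<close>

definition theta_pair :: "nat \<Rightarrow> nat \<Rightarrow> (complex \<Rightarrow> complex) \<Rightarrow> (complex \<Rightarrow> complex) \<Rightarrow> bool" where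
  "theta_pair N m F F2 \<longleftrightarrow> F holomorphic_on ball 0 1 \<and> F2 holomorphic_on ball 0 1 \<and> F 0 = 1
    \<and> (\<forall>q. F2 (- q) = F2 q)
    \<and> (\<forall>t. 0 < (t::real) \<longrightarrow> F (of_real (exp (- pi / t))) = of_real (sqrt t) ^ N * F (of_real (exp (- pi * t))))
    \<and> (\<forall>t. 0 < (t::real) \<longrightarrow> F (- of_real (exp (- pi / t)))
        = of_real (sqrt t) ^ N * of_real (exp (- pi * m * t / 4)) * F2 (of_real (exp (- pi * t))))"

lemma theta_pair_holomorphic:
  assumes "theta_pair N m F F2"
  shows "F holomorphic_on ball 0 1" "F2 holomorphic_on ball 0 1" "F 0 = 1" "F2 (- q) = F2 q"
  using assms by (auto simp: theta_pair_def)

lemma theta_pair_inversion: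
  assumes "theta_pair N m F F2" "0 < (t::real)"
  shows "F (of_real (exp (- pi / t))) = of_real (sqrt t) ^ N * F (of_real (exp (- pi * t)))"
    and "F (- of_real (exp (- pi / t)))
        = of_real (sqrt t) ^ N * of_real (exp (- pi * m * t / 4)) * F2 (of_real (exp (- pi * t)))"
  using assms by (auto simp: theta_pair_def)

definition theta3 :: "complex \<Rightarrow> complex" where
  "theta3 q = (\<Sum>\<^sub>\<infinity>k::int. q ^ nat (k^2))"

text \<open>Jacobi's \<open>\<theta>\<^sub>2\<close> without its factor \<open>q\<^sup>1\<^sup>/\<^sup>4\<close>\<close>

definition theta2 :: "complex \<Rightarrow> complex" where
  "theta2 q = (\<Sum>\<^sub>\<infinity>k::int. q ^ nat (k^2 + k))"

lemma cis_pi_times_int: "cis (pi * of_int k) = (if even k then 1 else - 1)"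
proof -
  have "cis (2 * pi * of_int b) = 1" for b :: int by (rule cis_multiple_2pi) auto
  then show ?thesis by (auto elim!: evenE oddE simp: cis_mult[symmetric] ring_distribs mult_ac)
qed

lemma abs_le_square_int: "nat \<bar>k\<bar> \<le> nat (k^2)" for k :: int
proof (rule nat_mono)
  have "\<bar>k\<bar> * 1 \<le> \<bar>k\<bar> * \<bar>k\<bar>" by (cases "k = 0") (simp, rule mult_left_mono, auto)
  then show "\<bar>k\<bar> \<le> k^2" by (simp add: power2_eq_square)
qed

lemma pronic_nonneg: "k^2 + k \<ge> 0" for k :: int
proof -
  have "0 \<le> k * (k + 1)" by (cases "k \<ge> 0") (auto intro: mult_nonpos_nonpos)
  then show ?thesis by (simp add: power2_eq_square algebra_simps)
qed

lemma abs_le_pronic_int: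
  fixes k :: int
  assumes "k \<notin> {0, -1}"
  shows "nat \<bar>k\<bar> \<le> nat (k^2 + k)"
proof (rule nat_mono)
  have "\<bar>k\<bar> * 1 \<le> \<bar>k\<bar> * \<bar>k + 1\<bar>" using assms by (intro mult_left_mono) auto
  also have "\<dots> = \<bar>k * (k + 1)\<bar>" by (simp add: abs_mult)
  also have "k * (k + 1) = k^2 + k" by (simp add: power2_eq_square algebra_simps)
  finally show "\<bar>k\<bar> \<le> k^2 + k" using pronic_nonneg[of k] by simp
qed

lemma theta3_summable: "0 < r \<Longrightarrow> r < 1 \<Longrightarrow> (\<lambda>k::int. r ^ nat (k^2)) summable_on UNIV" for r :: real
  by (rule int_theta_summable[of "{}"]) (auto intro: abs_le_square_int)

lemma theta2_summable: "0 < r \<Longrightarrow> r < 1 \<Longrightarrow> (\<lambda>k::int. r ^ nat (k^2 + k)) summable_on UNIV" for r :: real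
  by (rule int_theta_summable[of "{0, -1}"]) (auto intro: abs_le_pronic_int[simplified])

text \<open>The lattice of integers has the shortest characteristic vector 1, of norm 1, and
  \<open>(k + 1/2)^2 = k^2 + k + 1/4\<close> explains the exponents of \<open>theta2\<close>. Its
  \<open>N\<close>-th powers are the denominators of the quotients.\<close>

lemma theta_pair_integers: "theta_pair 1 1 theta3 theta2"
  unfolding theta_pair_def
proof (intro conjI allI impI)
  show "theta3 holomorphic_on ball 0 1" "theta2 holomorphic_on ball 0 1"
    unfolding theta3_def[abs_def] theta2_def[abs_def]
    by (intro counting_power_series(2) theta3_summable theta2_summable; assumption)+
  have "theta3 0 = of_nat (card {k::int \<in> UNIV. nat (k^2) = 0})"
    unfolding theta3_def by (intro counting_power_series(3) theta3_summable)
  also have "{k::int \<in> UNIV. nat (k^2) = 0} = {0}" by auto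
  finally show "theta3 0 = 1" by simp
  show "theta2 (- q) = theta2 q" for q
  proof -
    have "even (nat (k^2 + k))" for k :: int using pronic_nonneg[of k] by (simp add: even_nat_iff)
    then show ?thesis unfolding theta2_def by (simp add: power_minus_even)
  qed
  fix t :: real assume t: "0 < t"
  have e: "complex_of_real (exp (- pi / t)) ^ nat (k^2) = of_real (exp (- pi * (1 / t) * (of_int k)^2))" for k :: int
    by (simp add: mult.commute flip: exp_of_nat_mult of_real_power)
  have e': "complex_of_real (exp (- pi * t)) ^ nat (k^2) = of_real (exp (- pi * t * (of_int k)^2))" for k :: int
    by (simp add: mult.commute flip: exp_of_nat_mult of_real_power)
  have "theta3 (of_real (exp (- pi / t))) = (\<Sum>\<^sub>\<infinity>n::int. of_real (exp (- pi * (1 / t) * (of_int n + 0)^2)) * cis (2 * pi * 0 * (of_int n + 0)))"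
    unfolding theta3_def e by simp
  also have "\<dots> = (\<Sum>\<^sub>\<infinity>m::int. exp (- pi * (of_int m - 0)^2 / (1 / t)) * cis (2 * pi * of_int m * 0)) / sqrt (1 / t)"
    using t by (intro poisson_gaussian) auto
  also have "\<dots> = sqrt t * theta3 (of_real (exp (- pi * t)))"
    unfolding theta3_def e' using t by (simp add: real_sqrt_divide mult_ac)
  finally show "theta3 (of_real (exp (- pi / t))) = of_real (sqrt t) ^ 1 * theta3 (of_real (exp (- pi * t)))" by simp
  \<comment> \<open>As \<open>k^2\<close> and \<open>k\<close> have the same parity, changing the
    sign of \<open>q\<close> inserts the character with \<open>b = 1/2\<close>.\<close>
  have sgn: "(- 1) ^ nat (k^2) = cis (2 * pi * (1/2) * (of_int k + 0))" for k :: int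
  proof -
    have "even (nat (k^2)) \<longleftrightarrow> even k" by (simp add: even_nat_iff)
    then show ?thesis by (auto simp: minus_one_power_iff cis_pi_times_int)
  qed
  have "theta3 (- of_real (exp (- pi / t))) = (\<Sum>\<^sub>\<infinity>n::int. of_real (exp (- pi * (1 / t) * (of_int n + 0)^2)) * cis (2 * pi * (1/2) * (of_int n + 0)))"
    unfolding theta3_def power_minus[of "complex_of_real (exp (- pi / t))"] e sgn by (simp add: mult.commute)
  also have "\<dots> = (\<Sum>\<^sub>\<infinity>m::int. exp (- pi * (of_int m - 1/2)^2 / (1 / t)) * cis (2 * pi * of_int m * 0)) / sqrt (1 / t)"
    using t by (intro poisson_gaussian) auto
  also have "\<dots> = sqrt t * (\<Sum>\<^sub>\<infinity>m::int. complex_of_real (exp (- pi * (of_int m - 1/2)^2 * t)))"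
    using t by (simp add: real_sqrt_divide mult_ac)
  \<comment> \<open>The reflection turns \<open>(m - 1/2)^2\<close> into
    \<open>k^2 + k + 1/4\<close>; the constant is the factor split off from
    \<open>theta2\<close>.\<close>
  also have "(\<Sum>\<^sub>\<infinity>m::int. complex_of_real (exp (- pi * (of_int m - 1/2)^2 * t)))
      = (\<Sum>\<^sub>\<infinity>k::int. complex_of_real (exp (- pi * (of_int (- k) - 1/2)^2 * t)))"
    by (rule infsum_reindex_bij_witness[of _ uminus uminus]) auto
  also have "\<dots> = (\<Sum>\<^sub>\<infinity>k::int. of_real (exp (- pi * t / 4)) * complex_of_real (exp (- pi * t)) ^ nat (k^2 + k))"
  proof (rule infsum_cong)
    fix k :: int
    have r: "real (nat (k^2 + k)) = (of_int k)^2 + of_int k"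
      using pronic_nonneg[of k] by (simp add: of_nat_nat)
    have "exp (- pi * (of_int (- k) - 1/2)^2 * t) = exp (- pi * t / 4 + real (nat (k^2 + k)) * (- pi * t))"
      unfolding r by (simp add: power2_eq_square algebra_simps)
    also have "\<dots> = exp (- pi * t / 4) * exp (- pi * t) ^ nat (k^2 + k)"
      by (simp only: exp_add exp_of_nat_mult)
    finally show "complex_of_real (exp (- pi * (of_int (- k) - 1/2)^2 * t)) = of_real (exp (- pi * t / 4)) * complex_of_real (exp (- pi * t)) ^ nat (k^2 + k)"
      by (simp only: of_real_mult of_real_power)
  qed
  also have "\<dots> = of_real (exp (- pi * t / 4)) * theta2 (of_real (exp (- pi * t)))"
    unfolding theta2_def by (rule infsum_cmult_right')
  finally show "theta3 (- of_real (exp (- pi / t))) = of_real (sqrt t) ^ 1 * of_real (exp (- pi * real 1 * t / 4)) * theta2 (of_real (exp (- pi * t)))"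
    by (simp add: mult.assoc)
qed

lemma neg_inverse_imaginary: "t \<noteq> 0 \<Longrightarrow> - 1 / (\<i> * of_real t) = \<i> * of_real (1 / t)" for t :: real
  by (simp add: field_simps)

text \<open>Squaring replaces the factor \<open>sqrt (z / \<i>)\<close> by \<open>z / \<i>\<close>
  and so avoids a branch of the square root; zeros are not affected.\<close>

lemma jacobi_theta_inversion:
  assumes z: "Im z > 0"
  shows "(theta3 (nome (- 1 / z)))^2 = z / \<i> * (theta3 (nome z))^2"
    and "(theta3 (- nome (- 1 / z)))^2 = z / \<i> * exp (\<i> * pi * z / 2) * (theta2 (nome z))^2"
proof -
  note hol = theta_pair_holomorphic[OF theta_pair_integers]
  let ?H = "{z. Im z > 0}"
  have [holomorphic_intros]: "(\<lambda>z. theta3 (f z)) holomorphic_on ?H" "(\<lambda>z. theta2 (f z)) holomorphic_on ?H"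
    if "f holomorphic_on ?H" "\<And>z. Im z > 0 \<Longrightarrow> norm (f z) < 1" for f
  proof -
    have "f ` ?H \<subseteq> ball 0 1" using that(2) by auto
    then show "(\<lambda>z. theta3 (f z)) holomorphic_on ?H" "(\<lambda>z. theta2 (f z)) holomorphic_on ?H"
      using holomorphic_on_compose_gen[OF that(1) hol(1)] holomorphic_on_compose_gen[OF that(1) hol(2)]
      by (auto simp: o_def)
  qed
  have nz: "z \<noteq> 0" if "Im z > 0" for z using that by auto
  show "(theta3 (nome (- 1 / z)))^2 = z / \<i> * (theta3 (nome z))^2"
  proof (rule holomorphic_eq_on_imaginary_axis[OF _ _ _ z])
    fix t :: real assume t: "0 < t"
    have "theta3 (nome (- 1 / (\<i> * of_real t))) = of_real (sqrt t) ^ 1 * theta3 (nome (\<i> * of_real t))"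
      using theta_pair_inversion(1)[OF theta_pair_integers t] t
      by (subst neg_inverse_imaginary) (auto simp only: nome_imaginary, simp)
    then show "(theta3 (nome (- 1 / (\<i> * of_real t))))^2 = \<i> * of_real t / \<i> * (theta3 (nome (\<i> * of_real t)))^2"
      using t by (simp add: power_mult_distrib flip: of_real_power)
  qed (auto intro!: holomorphic_intros simp: nz Im_neg_inverse_pos[simplified])
  show "(theta3 (- nome (- 1 / z)))^2 = z / \<i> * exp (\<i> * pi * z / 2) * (theta2 (nome z))^2"
  proof (rule holomorphic_eq_on_imaginary_axis[OF _ _ _ z])
    fix t :: real assume t: "0 < t"
    have "theta3 (- nome (- 1 / (\<i> * of_real t))) = of_real (sqrt t) * of_real (exp (- pi * t / 4)) * theta2 (nome (\<i> * of_real t))"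
      using theta_pair_inversion(2)[OF theta_pair_integers t] t
      by (subst neg_inverse_imaginary) (auto simp only: nome_imaginary, simp)
    moreover have "complex_of_real (exp (- pi * t / 4)) ^ 2 = exp (\<i> * pi * (\<i> * of_real t) / 2)"
    proof -
      have "\<i> * pi * (\<i> * of_real t) / 2 = of_real (- pi * t / 2)" by (simp add: algebra_simps)
      moreover have "exp (- pi * t / 4) ^ 2 = exp (- pi * t / 2)" by (simp flip: exp_double)
      ultimately show ?thesis by (simp only: exp_of_real flip: of_real_power)
    qed
    ultimately show "(theta3 (- nome (- 1 / (\<i> * of_real t))))^2
        = \<i> * of_real t / \<i> * exp (\<i> * pi * (\<i> * of_real t) / 2) * (theta2 (nome (\<i> * of_real t)))^2"
      using t by (simp only: power_mult_distrib) (simp flip: of_real_power)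
  qed (auto intro!: holomorphic_intros simp: nz Im_neg_inverse_pos[simplified])
qed

lemma jacobi_theta_nonzero_small:
  assumes "norm q < 1 / 3"
  shows "theta3 q \<noteq> 0" "theta2 q \<noteq> 0"
proof -
  show "theta3 q \<noteq> 0" unfolding theta3_def
    by (rule int_theta_nonzero[of "{0}"]) (use assms in \<open>auto intro: abs_le_square_int\<close>)
  show "theta2 q \<noteq> 0" unfolding theta2_def
    by (rule int_theta_nonzero[of "{0, -1}"]) (use assms in \<open>auto intro: abs_le_pronic_int[simplified]\<close>)
qed

text \<open>Takes the place of the product formula. Translation and inversion permute
  \<open>theta3 q\<close>, \<open>theta3 (- q)\<close> and \<open>theta2 q\<close> up to factors
  without zeros, and for small \<open>q\<close> the leading terms dominate; so
  \<open>modular_induct\<close> spreads the absence of zeros over the half plane.\<close>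

lemma jacobi_theta_nonzero:
  assumes "norm q < 1"
  shows "theta3 q \<noteq> 0" "theta2 q \<noteq> 0"
proof -
  have main: "theta3 (nome z) \<noteq> 0 \<and> theta3 (- nome z) \<noteq> 0 \<and> theta2 (nome z) \<noteq> 0" if z: "Im z > 0" for z
  proof (rule modular_induct[OF _ _ _ z, of "\<lambda>z. theta3 (nome z) \<noteq> 0 \<and> theta3 (- nome z) \<noteq> 0 \<and> theta2 (nome z) \<noteq> 0"])
    fix z assume z: "Im z > 0"
    show "(theta3 (nome (z + 1)) \<noteq> 0 \<and> theta3 (- nome (z + 1)) \<noteq> 0 \<and> theta2 (nome (z + 1)) \<noteq> 0)
        = (theta3 (nome z) \<noteq> 0 \<and> theta3 (- nome z) \<noteq> 0 \<and> theta2 (nome z) \<noteq> 0)"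
      unfolding nome_plus_1 theta_pair_holomorphic(4)[OF theta_pair_integers] by auto
    assume P: "theta3 (nome (- 1 / z)) \<noteq> 0 \<and> theta3 (- nome (- 1 / z)) \<noteq> 0 \<and> theta2 (nome (- 1 / z)) \<noteq> 0"
    have nz: "z \<noteq> 0" using z by auto
    have w: "- 1 / (- 1 / z) = z" using nz by simp
    have "theta3 (nome z) \<noteq> 0" using P jacobi_theta_inversion(1)[OF z] by auto
    moreover have "theta2 (nome z) \<noteq> 0" using P jacobi_theta_inversion(2)[OF z] by auto
    moreover have "(theta3 (- nome z))^2 \<noteq> 0"
      using P jacobi_theta_inversion(2)[OF Im_neg_inverse_pos[OF z], unfolded w] nz by simp
    ultimately show "theta3 (nome z) \<noteq> 0 \<and> theta3 (- nome z) \<noteq> 0 \<and> theta2 (nome z) \<noteq> 0" by simp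
  next
    fix z assume "Im z \<ge> 1 / 2"
    then have "- pi * Im z \<le> - pi / 2" by (simp add: field_simps)
    then have "norm (nome z) \<le> exp (- pi / 2)" unfolding norm_nome by simp
    then have "norm (nome z) < 1 / 3" using exp_pi_half_bound by simp
    then show "theta3 (nome z) \<noteq> 0 \<and> theta3 (- nome z) \<noteq> 0 \<and> theta2 (nome z) \<noteq> 0"
      using jacobi_theta_nonzero_small[of "nome z"] jacobi_theta_nonzero_small[of "- nome z"] by simp
  qed
  have "theta3 q \<noteq> 0 \<and> theta2 q \<noteq> 0"
  proof (cases "q = 0")
    case True
    then show ?thesis using jacobi_theta_nonzero_small[of 0] by simp
  next
    case False
    with assms obtain z where "Im z > 0" "nome z = q" by (rule nome_surj)
    then show ?thesis using main[of z] by simp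
  qed
  then show "theta3 q \<noteq> 0" "theta2 q \<noteq> 0" by auto
qed

text \<open>The nome omits the value 0, so whatever comes from the half plane is known only off 0
  and must be extended by continuity.\<close>

lemma holomorphic_constant_off_0:
  assumes "f holomorphic_on ball (0::complex) 1" "\<And>u. norm u < 1 \<Longrightarrow> u \<noteq> 0 \<Longrightarrow> f u = c"
  shows "f 0 = c"
proof -
  have "isCont f 0"
    using holomorphic_on_imp_continuous_on[OF assms(1)] by (simp add: continuous_on_eq_continuous_at)
  then have "(f \<longlongrightarrow> f 0) (at 0)" by (simp add: isCont_def)
  moreover have "(f \<longlongrightarrow> c) (at 0)"
    by (rule tendsto_eventually) (use assms(2) in \<open>auto simp: eventually_at intro!: exI[of _ 1]\<close>)
  ultimately show ?thesis by (metis tendsto_unique trivial_limit_at)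
qed

section \<open>Quotients of theta series\<close>

context
  fixes N m :: nat and F F2 :: "complex \<Rightarrow> complex"
  assumes pair: "theta_pair N m F F2"
begin

definition ratio3 :: "complex \<Rightarrow> complex" where "ratio3 q = F q / theta3 q ^ N"
definition ratio2 :: "complex \<Rightarrow> complex" where "ratio2 q = F2 q / theta2 q ^ N"
text \<open>This is \<open>q\<close> to the power \<open>(m - N) / 4\<close>, the quotient of the
  powers of \<open>q\<close> left out of \<open>F2\<close> and of \<open>theta2 ^ N\<close>. As a
  possibly fractional power it depends on \<open>z\<close> and not only on the nome.\<close>

definition twist :: "complex \<Rightarrow> complex" where "twist z = exp (\<i> * pi * (of_nat m - of_nat N) / 4 * z)"

lemma ratio_holomorphic: "ratio3 holomorphic_on ball 0 1" "ratio2 holomorphic_on ball 0 1"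
  unfolding ratio3_def[abs_def] ratio2_def[abs_def]
  using theta_pair_holomorphic[OF pair] theta_pair_holomorphic[OF theta_pair_integers] jacobi_theta_nonzero
  by (auto intro!: holomorphic_intros)

lemma ratio3_0: "ratio3 0 = 1"
  using theta_pair_holomorphic(3)[OF pair] theta_pair_holomorphic(3)[OF theta_pair_integers] by (simp add: ratio3_def)

lemma ratio2_even: "ratio2 (- q) = ratio2 q"
  by (simp add: ratio2_def theta_pair_holomorphic(4)[OF pair] theta_pair_holomorphic(4)[OF theta_pair_integers])

lemma ratio_inversion:
  assumes z: "Im z > 0"
  shows "ratio3 (nome (- 1 / z)) = ratio3 (nome z)"
    and "ratio3 (- nome (- 1 / z)) = twist z * ratio2 (nome z)"
proof -
  let ?H = "{z. Im z > 0}"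
  have comp: "(\<lambda>z. ratio3 (f z)) holomorphic_on ?H" "(\<lambda>z. ratio2 (f z)) holomorphic_on ?H"
    if "f holomorphic_on ?H" "\<And>z. Im z > 0 \<Longrightarrow> norm (f z) < 1" for f
  proof -
    have "f ` ?H \<subseteq> ball 0 1" using that(2) by auto
    then show "(\<lambda>z. ratio3 (f z)) holomorphic_on ?H" "(\<lambda>z. ratio2 (f z)) holomorphic_on ?H"
      using holomorphic_on_compose_gen[OF that(1) ratio_holomorphic(1)] holomorphic_on_compose_gen[OF that(1) ratio_holomorphic(2)]
      by (auto simp: o_def)
  qed
  have nz: "z \<noteq> 0" if "Im z > 0" for z using that by auto
  have nomes: "nome holomorphic_on ?H" "(\<lambda>z. nome (- 1 / z)) holomorphic_on ?H" "(\<lambda>z. - nome (- 1 / z)) holomorphic_on ?H"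
    unfolding nome_def[abs_def] by (auto intro!: holomorphic_intros simp: nz)
  note inv = theta_pair_inversion[OF pair] theta_pair_inversion[OF theta_pair_integers]
  have ax: "nome (- 1 / (\<i> * of_real t)) = of_real (exp (- pi / t))" if "0 < t" for t :: real
    using that by (subst neg_inverse_imaginary) (auto simp only: nome_imaginary, simp)
  show "ratio3 (nome (- 1 / z)) = ratio3 (nome z)"
  proof (rule holomorphic_eq_on_imaginary_axis[OF _ _ _ z])
    fix t :: real assume t: "0 < t"
    show "ratio3 (nome (- 1 / (\<i> * of_real t))) = ratio3 (nome (\<i> * of_real t))"
      unfolding ax[OF t] nome_imaginary ratio3_def inv(1,3)[OF t] using t by (simp add: power_mult_distrib)
  next
    show "(\<lambda>z. ratio3 (nome (- 1 / z))) holomorphic_on ?H"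
      by (rule comp(1)[OF nomes(2)]) (rule norm_nome_less_1, rule Im_neg_inverse_pos)
    show "(\<lambda>z. ratio3 (nome z)) holomorphic_on ?H"
      by (rule comp(1)[OF nomes(1)]) (rule norm_nome_less_1)
  qed
  show "ratio3 (- nome (- 1 / z)) = twist z * ratio2 (nome z)"
  proof (rule holomorphic_eq_on_imaginary_axis[OF _ _ _ z])
    show "(\<lambda>z. twist z * ratio2 (nome z)) holomorphic_on ?H"
      unfolding twist_def by (intro holomorphic_intros comp nomes) auto
    fix t :: real assume t: "0 < t"
    have "twist (\<i> * of_real t) = of_real (exp (- pi * m * t / 4) / exp (- pi * 1 * t / 4) ^ N)"
    proof -
      have "\<i> * pi * (of_nat m - of_nat N) / 4 * (\<i> * of_real t) = complex_of_real (- pi * m * t / 4 - real N * (- pi * 1 * t / 4))"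
        by (simp add: algebra_simps) (simp add: field_simps)
      then show ?thesis unfolding twist_def by (simp only: exp_of_real exp_diff exp_of_nat_mult)
    qed
    then show "ratio3 (- nome (- 1 / (\<i> * of_real t))) = twist (\<i> * of_real t) * ratio2 (nome (\<i> * of_real t))"
      unfolding ax[OF t] nome_imaginary ratio3_def ratio2_def inv(2,4)[OF t] using t
      by (simp add: power_mult_distrib)
  next
    show "(\<lambda>z. ratio3 (- nome (- 1 / z))) holomorphic_on ?H"
      by (rule comp(1)[OF nomes(3)]) (simp only: norm_minus_cancel norm_nome_less_1 Im_neg_inverse_pos)
  qed
qed

lemma ratio3_minus_nome_nonzero: obtains z where "Im z > 0" "ratio3 (- nome z) \<noteq> 0"
proof -
  have "\<not> (\<forall>u. norm u < 1 \<longrightarrow> u \<noteq> 0 \<longrightarrow> ratio3 u = 0)"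
    using holomorphic_constant_off_0[OF ratio_holomorphic(1), of 0] ratio3_0 by auto
  then obtain u where u: "norm u < 1" "u \<noteq> 0" "ratio3 u \<noteq> 0" by blast
  then obtain z where "Im z > 0" "nome z = - u" using nome_surj[of "- u"] by auto
  then show ?thesis using that[of z] u by simp
qed

text \<open>The relation \<open>(ST)\<^sup>3 = -1\<close> in the modular group forces the multiplier of the translation
  \<open>z \<mapsto> z + 1\<close> on \<open>twist z * ratio2 (nome z)\<close> to be trivial.\<close>

lemma rank_cong_norm_mod_8: "8 dvd (int m - int N)"
proof -
  obtain z where z: "Im z > 0" "ratio3 (- nome z) \<noteq> 0" by (rule ratio3_minus_nome_nonzero)
  have nz: "z \<noteq> 0" "z + 1 \<noteq> 0" using z by (auto simp: complex_eq_iff)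
  \<comment> \<open>The value \<open>ratio3 (- nome z)\<close> is transported in two ways to
    \<open>twist * ratio2\<close>: through \<open>z + 1\<close> it is found at \<open>w\<close>,
    directly at \<open>- 1 / z = w + 1\<close>. The two results differ by \<open>twist 1\<close>, an
    eighth root of unity.\<close>
  define w where "w = - 1 / z - 1"
  have w: "Im w > 0" using Im_neg_inverse_pos[OF z(1)] by (simp add: w_def)
  have "ratio3 (- nome z) = ratio3 (nome (z + 1))" by (simp add: nome_plus_1)
  also have "\<dots> = ratio3 (nome (- 1 / (z + 1)))" using ratio_inversion(1)[of "z + 1"] z by simp
  also have "\<dots> = ratio3 (- nome (- 1 / (z + 1) + 1))" by (simp only: nome_plus_1) simp
  also have "- 1 / (z + 1) + 1 = - 1 / w"
  proof -
    have "- 1 * (z + 1) = z * w" using nz by (simp add: w_def field_simps)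
    moreover have "w \<noteq> 0" using w by auto
    ultimately have "- 1 / w = z / (z + 1)" using nz by (subst frac_eq_eq) simp_all
    moreover have "- 1 / (z + 1) + 1 = z / (z + 1)" using nz by (simp add: field_simps)
    ultimately show ?thesis by simp
  qed
  also have "ratio3 (- nome (- 1 / w)) = twist w * ratio2 (nome w)" by (rule ratio_inversion(2)[OF w])
  finally have 1: "ratio3 (- nome z) = twist w * ratio2 (nome w)" .
  have "- 1 / (- 1 / z) = z" using nz by simp
  then have "ratio3 (- nome z) = twist (- 1 / z) * ratio2 (nome (- 1 / z))"
    using ratio_inversion(2)[OF Im_neg_inverse_pos[OF z(1)]] by simp
  also have "- 1 / z = w + 1" by (simp add: w_def)
  also have "twist (w + 1) * ratio2 (nome (w + 1)) = twist 1 * (twist w * ratio2 (nome w))"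
    by (simp add: nome_plus_1 ratio2_even twist_def ring_distribs exp_add)
  finally have "ratio3 (- nome z) = twist 1 * ratio3 (- nome z)" unfolding 1 .
  with z have "twist 1 = 1" by simp
  then obtain n :: int where "Im (\<i> * pi * (of_nat m - of_nat N) / 4 * 1) = of_int (2 * n) * pi"
    unfolding twist_def exp_eq_1 by blast
  then have "pi * (real m - real N) = pi * of_int (8 * n)" by (simp add: field_simps)
  then have "real m - real N = of_int (8 * n)" by (subst (asm) mult_cancel_left) simp
  then have "int m - int N = 8 * n" by linarith
  then show ?thesis by simp
qed

lemma theta_eq_power_theta3:
  assumes mN: "N \<le> m" and q: "norm q < 1"
  shows "F q = theta3 q ^ N"
proof -
  obtain j where j: "m - N = 8 * j"
    using rank_cong_norm_mod_8 mN by (metis dvd_def of_nat_diff int_dvd_int_iff of_nat_numeral)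
  have twist: "twist z = nome z ^ (2 * j)" for z
  proof -
    have "complex_of_nat m - of_nat N = of_nat (8 * j)" using j mN by (metis of_nat_diff)
    then have "\<i> * pi * (of_nat m - of_nat N) / 4 * z = of_nat (2 * j) * (\<i> * pi * z)" by simp
    then show ?thesis unfolding twist_def nome_def by (simp only: exp_of_nat_mult)
  qed
  \<comment> \<open>The function \<open>twist * ratio2\<close> in terms of the nome. Here
    \<open>N \<le> m\<close> enters: the exponent is not negative, so \<open>s2\<close> is
    holomorphic at the cusp; being even, it is fixed by \<open>z \<mapsto> z + 1\<close>.\<close>
  define s2 where "s2 = (\<lambda>u. u ^ (2 * j) * ratio2 u)"
  have s2: "s2 holomorphic_on ball 0 1" unfolding s2_def by (intro holomorphic_intros ratio_holomorphic)
  have s2_even: "s2 (- u) = s2 u" for u by (simp add: s2_def ratio2_even)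
  have inv2: "ratio3 (- nome (- 1 / z)) = s2 (nome z)" if "Im z > 0" for z
    using ratio_inversion(2)[OF that] by (simp add: s2_def twist)
  \<comment> \<open>Points with \<open>Im z \<ge> 1/2\<close> have nomes in this compact disc. The
    maximum \<open>M\<close> over it bounds the permuted functions on the whole half plane, yet it
    is attained at \<open>u0\<close>, in the interior of the unit disc.\<close>
  define \<rho> where "\<rho> = exp (- pi / 2)"
  have \<rho>: "0 < \<rho>" "\<rho> < 1" using exp_pi_half_bound by (auto simp: \<rho>_def)
  have sub: "cball 0 \<rho> \<subseteq> ball (0::complex) 1" using \<rho> by auto
  have "continuous_on (cball 0 \<rho>) (\<lambda>u. max (norm (ratio3 u)) (norm (s2 u)))"
    by (intro continuous_intros holomorphic_on_imp_continuous_on holomorphic_on_subset[OF _ sub] ratio_holomorphic s2)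
  then obtain u0 where u0: "u0 \<in> cball 0 \<rho>"
      "\<And>u. u \<in> cball 0 \<rho> \<Longrightarrow> max (norm (ratio3 u)) (norm (s2 u)) \<le> max (norm (ratio3 u0)) (norm (s2 u0))"
    using continuous_attains_sup[of "cball (0::complex) \<rho>"] \<rho> by fastforce
  define M where "M = max (norm (ratio3 u0)) (norm (s2 u0))"
  have bound: "norm (ratio3 (nome z)) \<le> M \<and> norm (ratio3 (- nome z)) \<le> M \<and> norm (s2 (nome z)) \<le> M" if z: "Im z > 0" for z
  proof (rule modular_induct[OF _ _ _ z, of "\<lambda>z. norm (ratio3 (nome z)) \<le> M \<and> norm (ratio3 (- nome z)) \<le> M \<and> norm (s2 (nome z)) \<le> M"])
    fix z assume z: "Im z > 0"
    show "(norm (ratio3 (nome (z + 1))) \<le> M \<and> norm (ratio3 (- nome (z + 1))) \<le> M \<and> norm (s2 (nome (z + 1))) \<le> M)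
        = (norm (ratio3 (nome z)) \<le> M \<and> norm (ratio3 (- nome z)) \<le> M \<and> norm (s2 (nome z)) \<le> M)"
      unfolding nome_plus_1 s2_even by auto
    assume P: "norm (ratio3 (nome (- 1 / z))) \<le> M \<and> norm (ratio3 (- nome (- 1 / z))) \<le> M \<and> norm (s2 (nome (- 1 / z))) \<le> M"
    have nz: "z \<noteq> 0" using z by auto
    have w: "- 1 / (- 1 / z) = z" using nz by simp
    show "norm (ratio3 (nome z)) \<le> M \<and> norm (ratio3 (- nome z)) \<le> M \<and> norm (s2 (nome z)) \<le> M"
      using P ratio_inversion(1)[OF z] inv2[OF z] inv2[OF Im_neg_inverse_pos[OF z], unfolded w] by simp
  next
    fix z assume "Im z \<ge> 1 / 2"
    then have "- pi * Im z \<le> - pi / 2" by (simp add: field_simps)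
    then have "norm (nome z) \<le> \<rho>" unfolding norm_nome \<rho>_def by simp
    then show "norm (ratio3 (nome z)) \<le> M \<and> norm (ratio3 (- nome z)) \<le> M \<and> norm (s2 (nome z)) \<le> M"
      using u0(2)[of "nome z"] u0(2)[of "- nome z"] unfolding M_def by auto
  qed
  have bound': "norm (ratio3 u) \<le> M \<and> norm (s2 u) \<le> M" if "norm u < 1" for u
  proof (cases "u = 0")
    case True
    then show ?thesis using u0(2)[of 0] \<rho> unfolding M_def by auto
  next
    case False
    with that obtain z where "Im z > 0" "nome z = u" by (rule nome_surj)
    then show ?thesis using bound[of z] by simp
  qed
  have u0': "u0 \<in> ball 0 1" using u0 sub by blast
  have "ratio3 q = 1"
  proof (cases "M = norm (ratio3 u0)")
    case True
    have "ratio3 constant_on ball 0 1"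
      by (rule maximum_modulus_principle[OF ratio_holomorphic(1) _ _ _ _ u0'])
        (use bound' True in auto)
    then show ?thesis using ratio3_0 q unfolding constant_on_def by auto
  next
    case False
    then have "M = norm (s2 u0)" by (auto simp: M_def max_def split: if_splits)
    have "s2 constant_on ball 0 1"
      by (rule maximum_modulus_principle[OF s2 _ _ _ _ u0'])
        (use bound' \<open>M = norm (s2 u0)\<close> in auto)
    then obtain c where c: "\<And>u. norm u < 1 \<Longrightarrow> s2 u = c" unfolding constant_on_def by auto
    \<comment> \<open>Inversion carries the constant value of \<open>s2\<close> back to
      \<open>ratio3\<close> off 0, and \<open>ratio3 0 = 1\<close> then determines it.\<close>
    have r3c: "ratio3 u = c" if u: "norm u < 1" "u \<noteq> 0" for u
    proof -
      obtain z where z: "Im z > 0" "nome z = - u" using nome_surj[of "- u"] u by auto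
      have "- 1 / (- 1 / z) = z" using z by auto
      then show ?thesis
        using inv2[OF Im_neg_inverse_pos[OF z(1)]] z c[of "nome (- 1 / z)"] Im_neg_inverse_pos[OF z(1)] by simp
    qed
    have "ratio3 0 = c" by (rule holomorphic_constant_off_0[OF ratio_holomorphic(1) r3c])
    then show ?thesis using r3c[of q] ratio3_0 q by (cases "q = 0") auto
  qed
  then show ?thesis using jacobi_theta_nonzero[OF q] by (simp add: ratio3_def)
qed

end

lemma theta3_deriv_0: "(theta3 has_field_derivative 2) (at 0)"
proof -
  have "(theta3 has_field_derivative of_nat (card {k::int \<in> UNIV. nat (k^2) = 1})) (at 0)"
    unfolding theta3_def[abs_def] by (intro counting_power_series(4) theta3_summable)
  also have "{k::int \<in> UNIV. nat (k^2) = 1} = {1, -1}"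
  proof -
    have "nat (k^2) = 1 \<longleftrightarrow> k^2 = 1" for k :: int by linarith
    then show ?thesis by (auto simp: power2_eq_1_iff)
  qed
  finally show ?thesis by simp
qed

lemma theta_pair_count_unit_vectors:
  assumes "theta_pair N m F F2" "N \<le> m" "(F has_field_derivative of_nat k) (at 0)"
  shows "k = 2 * N"
proof -
  have "((\<lambda>q. theta3 q ^ N) has_field_derivative of_nat N * (2 * theta3 0 ^ (N - 1))) (at 0)"
    using theta3_deriv_0 by (auto intro!: derivative_eq_intros)
  then have "((\<lambda>q. theta3 q ^ N) has_field_derivative of_nat (2 * N)) (at 0)"
    using theta_pair_holomorphic(3)[OF theta_pair_integers] by (simp add: mult.commute)
  then have "(F has_field_derivative of_nat (2 * N)) (at 0)"
    by (rule has_field_derivative_transform_within_open[where S = "ball 0 1"])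
      (use theta_eq_power_theta3[OF assms(1,2)] in auto)
  from DERIV_unique[OF this assms(3)] show ?thesis by (simp only: of_nat_eq_iff)
qed

section \<open>The theorem of Elkies\<close>

lemma form_eq_sum: "form Q x y = (\<Sum>i\<in>UNIV. \<Sum>j\<in>UNIV. x $ i * Q $ i $ j * y $ j)"
  by (simp add: form_def scalar_product_def matrix_vector_mult_def sum_distrib_left mult.assoc)

lemma form_add_left: "form Q (x + y) z = form Q x z + form Q y z" for Q :: "'a::comm_ring_1^'n^'n"
  by (simp add: form_eq_sum ring_distribs sum.distrib)

lemma form_add_right: "form Q x (y + z) = form Q x y + form Q x z" for Q :: "'a::comm_ring_1^'n^'n"
  by (simp add: form_eq_sum ring_distribs sum.distrib)

lemma form_smult_left: "form Q (c *s x) z = c * form Q x z" for Q :: "'a::comm_ring_1^'n^'n"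
  by (simp add: form_eq_sum sum_distrib_left mult_ac)

lemma form_smult_right: "form Q x (c *s z) = c * form Q x z" for Q :: "'a::comm_ring_1^'n^'n"
  by (simp add: form_eq_sum sum_distrib_left mult_ac)

lemma form_minus_left: "form Q (- x) z = - form Q x z" for Q :: "'a::comm_ring_1^'n^'n"
  by (simp add: form_eq_sum sum_negf)

lemma form_minus_right: "form Q x (- z) = - form Q x z" for Q :: "'a::comm_ring_1^'n^'n"
  by (simp add: form_eq_sum sum_negf)

lemma form_diff_left: "form Q (x - y) z = form Q x z - form Q y z" for Q :: "'a::comm_ring_1^'n^'n"
  using form_add_left[of Q x "- y" z] by (simp add: form_minus_left)

lemma form_diff_right: "form Q x (y - z) = form Q x y - form Q x z" for Q :: "'a::comm_ring_1^'n^'n"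
  using form_add_right[of Q x y "- z"] by (simp add: form_minus_right)

lemma form_zero [simp]: "form Q 0 z = 0" "form Q x 0 = 0"
  by (simp_all add: form_eq_sum)

lemma form_sum_left: "form Q (\<Sum>i\<in>A. f i) z = (\<Sum>i\<in>A. form Q (f i) z)" for Q :: "'a::comm_ring_1^'n^'n"
  by (induction A rule: infinite_finite_induct) (auto simp: form_add_left)

lemma form_sum_right: "form Q x (\<Sum>i\<in>A. f i) = (\<Sum>i\<in>A. form Q x (f i))" for Q :: "'a::comm_ring_1^'n^'n"
  by (induction A rule: infinite_finite_induct) (auto simp: form_add_right)

lemmas form_simps = form_add_left form_add_right form_diff_left form_diff_right form_minus_left form_minus_right
  form_smult_left form_smult_right

lemma symmetric_formD: "symmetric_form Q \<Longrightarrow> Q $ i $ j = Q $ j $ i"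
proof -
  assume "symmetric_form Q"
  moreover have "transpose Q $ i $ j = Q $ j $ i" by (simp add: transpose_def)
  ultimately show ?thesis by (simp add: symmetric_form_def)
qed

lemma form_commute:
  fixes Q :: "int^'n^'n"
  assumes "symmetric_form Q"
  shows "form Q x y = form Q y x"
proof -
  have "form Q x y = (\<Sum>j\<in>UNIV. \<Sum>i\<in>UNIV. x $ i * Q $ i $ j * y $ j)"
    unfolding form_eq_sum by (rule sum.swap)
  also have "\<dots> = form Q y x"
    unfolding form_eq_sum
    by (intro sum.cong refl) (simp only: symmetric_formD[OF assms, of _ "_ :: 'n"] mult_ac)
  finally show ?thesis .
qed

lemma positive_definite_nonneg: "positive_definite Q \<Longrightarrow> form Q x x \<ge> 0"
  by (cases "x = 0") (auto simp: positive_definite_def less_imp_le)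

lemma positive_definite_eq_0: "positive_definite Q \<Longrightarrow> form Q x x = 0 \<longleftrightarrow> x = 0"
  unfolding positive_definite_def by (metis form_zero(1) less_irrefl)

lemma even_offdiagonal_sum:
  fixes g :: "'a \<Rightarrow> 'a \<Rightarrow> int"
  assumes "finite S" "\<And>i j. g i j = g j i"
  shows "even ((\<Sum>i\<in>S. \<Sum>j\<in>S. g i j) - (\<Sum>i\<in>S. g i i))"
  using assms(1)
proof (induction S rule: finite_induct)
  case (insert s S)
  have "(\<Sum>i\<in>insert s S. \<Sum>j\<in>insert s S. g i j) - (\<Sum>i\<in>insert s S. g i i)
     = 2 * (\<Sum>i\<in>S. g i s) + ((\<Sum>i\<in>S. \<Sum>j\<in>S. g i j) - (\<Sum>i\<in>S. g i i))"
  proof -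
    have "(\<Sum>j\<in>S. g s j) = (\<Sum>i\<in>S. g i s)" by (rule sum.cong[OF refl assms(2)])
    then show ?thesis using insert.hyps by (simp add: sum.distrib)
  qed
  then show ?case using insert.IH by simp
qed simp

text \<open>Modulo 2 the map \<open>\<xi> \<mapsto> form Q \<xi> \<xi>\<close> is linear, with the
  diagonal of \<open>Q\<close> as its coefficients, because off-diagonal terms occur twice.
  Surjectivity of \<open>Q\<close> represents this covector by a vector.\<close>

lemma exists_characteristic_vector:
  fixes Q :: "int^'n^'n"
  assumes "symmetric_form Q" "surj ((*v) Q)"
  obtains w where "characteristic_vector Q w"
proof -
  obtain w where w: "Q *v w = (\<chi> i. Q $ i $ i)" using assms(2) by (metis surj_def)
  have "[form Q w \<xi> = form Q \<xi> \<xi>] (mod 2)" for \<xi>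
  proof -
    have "form Q w \<xi> = form Q \<xi> w" by (rule form_commute[OF assms(1)])
    also have "\<dots> = (\<Sum>i\<in>UNIV. \<xi> $ i * Q $ i $ i)" by (simp add: form_def w scalar_product_def)
    finally have 1: "form Q w \<xi> = (\<Sum>i\<in>UNIV. \<xi> $ i * Q $ i $ i)" .
    have "even (form Q \<xi> \<xi> - (\<Sum>i\<in>UNIV. \<xi> $ i * Q $ i $ i * \<xi> $ i))"
      unfolding form_eq_sum
      by (rule even_offdiagonal_sum) (use assms(1) in \<open>auto simp: symmetric_formD mult_ac\<close>)
    moreover have "even ((\<Sum>i\<in>UNIV. \<xi> $ i * Q $ i $ i * \<xi> $ i) - (\<Sum>i\<in>UNIV. \<xi> $ i * Q $ i $ i))"
      unfolding sum_subtractf[symmetric] by (rule dvd_sum) auto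
    ultimately have "even (form Q \<xi> \<xi> - form Q w \<xi>)"
      unfolding 1 using dvd_add by fastforce
    then show ?thesis by (simp add: cong_iff_dvd_diff dvd_diff_commute)
  qed
  then show ?thesis using that by (auto simp: characteristic_vector_def)
qed

lemma characteristic_vectorD: "characteristic_vector Q w \<Longrightarrow> even (form Q w x) \<longleftrightarrow> even (form Q x x)"
  unfolding characteristic_vector_def by (metis cong_def even_iff_mod_2_eq_zero)

lemma characteristic_vector_translate:
  assumes "characteristic_vector Q w"
  shows "characteristic_vector Q (2 *s x + w)"
  unfolding characteristic_vector_def
proof
  fix \<xi>
  have "[2 * form Q x \<xi> + form Q w \<xi> = form Q \<xi> \<xi>] (mod 2)"
    using assms by (simp add: characteristic_vector_def cong_def mod_add_left_eq)
  then show "[form Q (2 *s x + w) \<xi> = form Q \<xi> \<xi>] (mod 2)" by (simp add: form_simps)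
qed

section \<open>The theta series of a unimodular lattice\<close>

definition real_matrix :: "int^'n^'n \<Rightarrow> 'n \<Rightarrow> 'n \<Rightarrow> real" where
  "real_matrix Q i j = of_int (Q $ i $ j)"

lemma qf_real_matrix: "qf UNIV (real_matrix Q) (\<lambda>i. of_int (x $ i)) = of_int (form Q x x)"
  by (simp add: qf_def real_matrix_def form_eq_sum mult_ac)

lemma common_denominator:
  fixes u :: "'a::finite \<Rightarrow> real"
  assumes "\<And>i. u i \<in> \<rat>"
  obtains D :: int and x :: "'a \<Rightarrow> int" where "D > 0" "\<And>i. of_int D * u i = of_int (x i)"
proof -
  have "\<exists>D>0. \<forall>i\<in>S. \<exists>k::int. of_int D * u i = of_int k" if "finite S" for S :: "'a set"
    using that
  proof (induction S rule: finite_induct)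
    case empty
    show ?case by (auto intro: exI[of _ 1])
  next
    case (insert s S)
    then obtain D where D: "(D::int) > 0" "\<forall>i\<in>S. \<exists>k::int. of_int D * u i = of_int k" by blast
    obtain a b :: int where ab: "b > 0" "u s = of_int a / of_int b"
      using assms[of s] by (auto elim!: Rats_cases')
    have "\<exists>k::int. of_int (b * D) * u i = of_int k" if i: "i \<in> insert s S" for i
    proof (cases "i = s")
      case True
      then have "of_int (b * D) * u i = of_int (D * a)" using ab by simp
      then show ?thesis by blast
    next
      case False
      with i D obtain k :: int where "of_int D * u i = of_int k" by blast
      then have "of_int (b * D) * u i = of_int (b * k)" by (simp add: mult.assoc)
      then show ?thesis by blast
    qed
    then show ?case using D ab by (intro exI[of _ "b * D"]) auto
  qed
  from this[of UNIV] obtain D where D: "(D::int) > 0" "\<forall>i. \<exists>k::int. of_int D * u i = of_int k" by auto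
  then obtain x where "\<And>i. of_int D * u i = of_int (x i)" by metis
  with D show ?thesis using that by blast
qed

lemma qf_rational_positive:
  assumes "positive_definite Q" "\<And>i. u i \<in> \<rat>" "\<exists>i\<in>UNIV. u i \<noteq> 0"
  shows "qf UNIV (real_matrix Q) u > 0"
proof -
  obtain D :: int and x where D: "D > 0" "\<And>i. of_int D * u i = of_int (x i)"
    by (rule common_denominator[of u, OF assms(2)]) blast
  define y where "y = (\<chi> i. x i)"
  have "(of_int D)^2 * qf UNIV (real_matrix Q) u = qf UNIV (real_matrix Q) (\<lambda>i. of_int D * u i)"
    by (simp add: qf_def sum_distrib_left power2_eq_square mult_ac)
  also have "\<dots> = of_int (form Q y y)"
    using qf_real_matrix[of Q y] by (simp add: D(2) y_def)
  finally have e: "(of_int D)^2 * qf UNIV (real_matrix Q) u = of_int (form Q y y)" .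
  obtain i where "u i \<noteq> 0" using assms(3) by auto
  then have "y $ i \<noteq> 0" using D by (metis of_int_0 mult_eq_0_iff of_int_eq_0_iff less_irrefl vec_lambda_beta y_def)
  then have "y \<noteq> 0" by auto
  then have "form Q y y > 0" using assms(1) by (auto simp: positive_definite_def)
  then have "(of_int D)^2 * qf UNIV (real_matrix Q) u > 0" unfolding e by simp
  then show ?thesis using D(1) by (simp add: zero_less_mult_iff)
qed

text \<open>Surjectivity expresses unimodularity: \<open>x \<mapsto> Q *v x\<close> identifies the
  lattice with its dual, so the dual side of Poisson summation is again a sum over the lattice.
  Changing the sign of \<open>q\<close> inserts the character of parity of the norm, which pairing
  with \<open>w\<close> represents; this shifts the dual sum by \<open>w / 2\<close>.\<close>

lemma unimodular_theta_pair:
  fixes Q :: "int^'m^'m"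
  assumes sym: "symmetric_form Q" and pd: "positive_definite Q" and surj: "surj ((*v) Q)"
    and w: "characteristic_vector Q w" "form Q w w = int m"
    and min: "\<And>v. characteristic_vector Q v \<Longrightarrow> int m \<le> form Q v v"
  obtains F F2 where "theta_pair CARD('m) m F F2"
    "(F has_field_derivative of_nat (card {x. form Q x x = 1})) (at 0)"
proof -
  define A where "A = real_matrix Q"
  have "\<exists>c Q'. poisson_dual UNIV A c Q'"
  proof (rule poisson_quadratic_form)
    show "A i j \<in> \<rat>" for i j
      unfolding A_def real_matrix_def by (rule Rats_of_int)
    show "A i j = A j i" for i j
      unfolding A_def real_matrix_def by (simp only: symmetric_formD[OF sym, of i j])
    show "qf UNIV A u > 0" if "\<And>i. u i \<in> \<rat>" "\<exists>i\<in>UNIV. u i \<noteq> 0" for u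
      unfolding A_def by (rule qf_rational_positive[OF pd that])
  qed simp
  then obtain c Q' where dual: "poisson_dual UNIV A c Q'" by blast
  have Q'dual: "Q' v = qf UNIV A u" if "\<forall>i\<in>UNIV. v i = (\<Sum>j\<in>UNIV. A i j * u j)" for u v
    using dual that unfolding poisson_dual_def by (elim conjE) blast
  have sumA: "(\<lambda>x. exp (- pi * t * qf UNIV A (\<lambda>i. of_int (x i) + a i))) summable_on UNIV" if "t > 0" for t a
    using dual that unfolding poisson_dual_def PiE_UNIV_domain by (elim conjE) (auto simp: PiE_def)
  have sumQ: "(\<lambda>y. exp (- pi * Q' (\<lambda>i. of_int (y i) - b i) / t)) summable_on UNIV" if "t > 0" for t b
    using dual that unfolding poisson_dual_def by (elim conjE) (auto simp: PiE_def)
  have poisson: "(\<Sum>\<^sub>\<infinity>x. exp (- pi * t * qf UNIV A (\<lambda>i. of_int (x i) + a i))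
            * cis (2 * pi * (\<Sum>i\<in>UNIV. b i * (of_int (x i) + a i))))
        = c * (1 / sqrt t) ^ CARD('m) * (\<Sum>\<^sub>\<infinity>y. exp (- pi * Q' (\<lambda>i. of_int (y i) - b i) / t)
            * cis (2 * pi * (\<Sum>i\<in>UNIV. of_int (y i) * a i)))" if "t > 0" for t a b
    using dual that unfolding poisson_dual_def by (elim conjE) (auto simp: PiE_def)
  have bij_vec: "bij_betw (vec_nth :: int^'m \<Rightarrow> _) UNIV UNIV"
    by (rule bij_betw_byWitness[where f' = vec_lambda]) auto
  have "inj ((*v) Q)"
  proof (rule injI)
    fix x y assume "Q *v x = Q *v y"
    then have "Q *v (x - y) = 0" by (simp add: matrix_vector_mult_diff_distrib)
    then have "form Q (x - y) (x - y) = 0" by (simp add: form_def scalar_product_def)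
    then show "x = y" using positive_definite_eq_0[OF pd] by simp
  qed
  then have bij_Q: "bij_betw (\<lambda>x. vec_nth (Q *v x)) UNIV UNIV"
    using bij_betw_trans[OF bij_betw_imageI[OF _ surj] bij_vec] by (simp add: o_def)
  have Q'Q: "Q' (\<lambda>i. of_int ((Q *v x) $ i) - of_int ((Q *v v) $ i) / 2) = of_int (form Q (2 *s x - v) (2 *s x - v)) / 4" for x v
  proof -
    have "Q' (\<lambda>i. of_int ((Q *v x) $ i) - of_int ((Q *v v) $ i) / 2) = qf UNIV A (\<lambda>i. of_int ((2 *s x - v) $ i) / 2)"
      by (rule Q'dual) (simp add: A_def real_matrix_def matrix_vector_mult_def sum_subtractf[symmetric] sum_divide_distrib
          diff_divide_distrib right_diff_distrib)
    also have "\<dots> = qf UNIV A (\<lambda>i. of_int ((2 *s x - v) $ i)) / 4"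
      by (simp add: qf_def sum_divide_distrib)
    finally show ?thesis unfolding A_def qf_real_matrix .
  qed
  define d where "d = (\<lambda>x. nat (form Q x x))"
  \<comment> \<open>By \<open>form2\<close> this is \<open>(form Q v v - m) / 4\<close> for
    \<open>v = 2 *s x + w\<close>. Minimality of \<open>m\<close> makes it nonnegative, so
    \<open>nat\<close> loses nothing, and \<open>w\<close> being characteristic makes it
    even.\<close>
  define e where "e = (\<lambda>x. nat (form Q x x + form Q x w))"
  have d: "real (d x) = of_int (form Q x x)" for x
    using positive_definite_nonneg[OF pd] by (simp add: d_def)
  have form2: "form Q (2 *s x + w) (2 *s x + w) = int m + 4 * (form Q x x + form Q x w)" for x
    by (simp add: form_simps w(2) form_commute[OF sym, of w x])
  have e: "int (e x) = form Q x x + form Q x w" for x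
    using min[OF characteristic_vector_translate[OF w(1), of x]] by (simp add: e_def form2)
  have e': "real (e x) = of_int (form Q x x + form Q x w)" for x
    by (metis e of_int_of_nat_eq)
  have even_e: "even (e x)" for x
  proof -
    have "even (int (e x))" unfolding e using characteristic_vectorD[OF w(1), of x] by (simp add: form_commute[OF sym, of x w])
    then show ?thesis by simp
  qed
  have exp_d: "exp (- pi * t * of_int (form Q x x)) = exp (- pi * t) ^ d x" for t x
    by (simp add: d[symmetric] exp_of_nat_mult[symmetric] mult_ac)
  have qfx: "qf UNIV A (\<lambda>i. of_int (x $ i) + 0) = of_int (form Q x x)" for x
    unfolding A_def using qf_real_matrix[of Q x] by simp
  have summ_d: "(\<lambda>x. r ^ d x) summable_on UNIV" if r: "0 < r" "r < 1" for r :: real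
  proof -
    define t where "t = - ln r / pi"
    have t: "t > 0" "exp (- pi * t) = r" using r by (auto simp: t_def divide_neg_pos)
    show ?thesis
      using sumA[OF t(1), of "\<lambda>_. 0"] unfolding summable_on_reindex_bij_betw[OF bij_vec, symmetric] qfx exp_d t(2) .
  qed
  have exp_e: "exp (- pi * (of_int (form Q (2 *s x + w) (2 *s x + w)) / 4) / t) = exp (- pi * m * (1 / t) / 4) * exp (- pi * (1 / t)) ^ e x" for x t
  proof -
    have split: "- p * ((M + 4 * E) / 4) * T = - p * M * T / 4 + E * (- p * T)" for p M E T :: real
      by (simp add: field_simps)
    have "- pi * (of_int (form Q (2 *s x + w) (2 *s x + w)) / 4) / t = - pi * ((real m + 4 * real (e x)) / 4) * (1 / t)"
      unfolding e' form2 by simp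
    also have "\<dots> = - pi * m * (1 / t) / 4 + real (e x) * (- pi * (1 / t))"
      by (rule split)
    finally show ?thesis by (simp only: exp_add exp_of_nat_mult)
  qed
  \<comment> \<open>Half of \<open>- w\<close> in dual coordinates: as a character it gives the sign
    by the parity of the norm, and as a shift it turns \<open>x\<close> into
    \<open>(2 *s x + w) / 2\<close>.\<close>
  define b where "b = (\<lambda>i. of_int ((Q *v (- w)) $ i) / 2 :: real)"
  have Q'b: "Q' (\<lambda>i. of_int ((Q *v x) $ i) - b i) = of_int (form Q (2 *s x + w) (2 *s x + w)) / 4" for x
    using Q'Q[of x "- w"] by (simp add: b_def)
  have summ_e: "(\<lambda>x. r ^ e x) summable_on UNIV" if r: "0 < r" "r < 1" for r :: real
  proof -
    define t where "t = pi / - ln r"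
    have t: "t > 0" "exp (- pi * (1 / t)) = r" using r by (auto simp: t_def divide_pos_neg)
    have "(\<lambda>x. exp (- pi * m * (1 / t) / 4) * r ^ e x) summable_on UNIV"
      using sumQ[OF t(1), of b] unfolding summable_on_reindex_bij_betw[OF bij_Q, symmetric] Q'b exp_e t(2) .
    then show ?thesis by (subst (asm) summable_on_cmult_right') auto
  qed
  define F where "F = (\<lambda>q::complex. \<Sum>\<^sub>\<infinity>x. q ^ d x)"
  define F2 where "F2 = (\<lambda>q::complex. \<Sum>\<^sub>\<infinity>x. q ^ e x)"
  have inv1: "F (of_real (exp (- pi / t))) = c * sqrt t ^ CARD('m) * F (of_real (exp (- pi * t)))" if t: "0 < t" for t
  proof -
    have "F (of_real (exp (- pi / t))) = (\<Sum>\<^sub>\<infinity>x. of_real (exp (- pi * (1 / t) * qf UNIV A (\<lambda>i. of_int (x $ i) + 0)))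
        * cis (2 * pi * (\<Sum>i\<in>UNIV. 0 * (of_int (x $ i) + 0))))"
      unfolding F_def qfx exp_d by simp
    also have "\<dots> = (\<Sum>\<^sub>\<infinity>x. of_real (exp (- pi * (1 / t) * qf UNIV A (\<lambda>i. of_int (x i) + 0)))
        * cis (2 * pi * (\<Sum>i\<in>UNIV. 0 * (of_int (x i) + 0))))"
      by (rule infsum_reindex_bij_betw[OF bij_vec])
    also have "\<dots> = c * (1 / sqrt (1 / t)) ^ CARD('m) * (\<Sum>\<^sub>\<infinity>y. exp (- pi * Q' (\<lambda>i. of_int (y i) - 0) / (1 / t))
            * cis (2 * pi * (\<Sum>i\<in>UNIV. of_int (y i) * 0)))"
      using t by (intro poisson) simp
    also have "(\<Sum>\<^sub>\<infinity>y. exp (- pi * Q' (\<lambda>i. of_int (y i) - 0) / (1 / t)) * cis (2 * pi * (\<Sum>i\<in>UNIV. of_int (y i) * 0)))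
        = (\<Sum>\<^sub>\<infinity>x. exp (- pi * Q' (\<lambda>i. of_int ((Q *v x) $ i) - 0) / (1 / t)) * cis (2 * pi * (\<Sum>i\<in>UNIV. of_int ((Q *v x) $ i) * 0)))"
      by (rule infsum_reindex_bij_betw[OF bij_Q, symmetric])
    also have "\<dots> = F (of_real (exp (- pi * t)))"
    proof -
      have "Q' (\<lambda>i. of_int ((Q *v x) $ i) - 0) = of_int (form Q x x)" for x
        using Q'Q[of x 0] by (simp add: form_simps)
      then have "exp (- pi * Q' (\<lambda>i. of_int ((Q *v x) $ i) - 0) / (1 / t)) = exp (- pi * t) ^ d x" for x
        using exp_d[of t x] by (simp add: mult_ac)
      then show ?thesis unfolding F_def by simp
    qed
    finally show ?thesis using t by (simp add: real_sqrt_divide)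
  qed
  have F0: "F 0 = 1"
  proof -
    have "F 0 = of_nat (card {x \<in> UNIV. d x = 0})"
      unfolding F_def by (rule counting_power_series(3)[OF summ_d])
    also have "{x \<in> UNIV. d x = 0} = {0}"
      using positive_definite_nonneg[OF pd] positive_definite_eq_0[OF pd] by (auto simp: d_def intro: antisym)
    finally show ?thesis by simp
  qed
  have c: "c = 1"
  proof -
    have r: "0 < exp (- pi)" "exp (- pi) < (1::real)" by auto
    have "F (of_real (exp (- pi))) = of_real (\<Sum>\<^sub>\<infinity>x. exp (- pi) ^ d x)"
      unfolding F_def using infsum_complex_of_real[OF summ_d[OF r]] by simp
    moreover have "(\<Sum>\<^sub>\<infinity>x. exp (- pi) ^ d x) \<ge> (\<Sum>x\<in>{0}. exp (- pi) ^ d x)"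
      by (rule finite_sum_le_infsum[OF summ_d[OF r]]) auto
    ultimately have "F (of_real (exp (- pi))) \<noteq> 0" by (auto simp: d_def)
    then show ?thesis using inv1[of 1] by simp
  qed
  have inv2: "F (- of_real (exp (- pi / t))) = of_real (sqrt t) ^ CARD('m) * of_real (exp (- pi * m * t / 4)) * F2 (of_real (exp (- pi * t)))"
    if t: "0 < t" for t
  proof -
    have sgn: "(- 1) ^ d x = cis (2 * pi * (\<Sum>i\<in>UNIV. b i * (of_int (x $ i) + 0)))" for x
    proof -
      have "(\<Sum>i\<in>UNIV. b i * (of_int (x $ i) + 0)) = of_int (form Q x (- w)) / 2"
        by (simp add: b_def form_def scalar_product_def sum_divide_distrib mult_ac)
      then have arg: "2 * pi * (\<Sum>i\<in>UNIV. b i * (of_int (x $ i) + 0)) = pi * of_int (form Q x (- w))" by simp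
      have "even (form Q x (- w)) \<longleftrightarrow> even (d x)"
        using characteristic_vectorD[OF w(1), of x] positive_definite_nonneg[OF pd, of x]
        by (simp add: form_simps form_commute[OF sym, of x w] d_def even_nat_iff)
      then show ?thesis unfolding arg cis_pi_times_int by (simp add: minus_one_power_iff)
    qed
    have tt: "- pi * (1 / t) = - pi / t" "1 / (1 / t) = t" by simp_all
    have "F (- of_real (exp (- pi / t))) = (\<Sum>\<^sub>\<infinity>x. of_real (exp (- pi * (1 / t) * qf UNIV A (\<lambda>i. of_int (x $ i) + 0)))
        * cis (2 * pi * (\<Sum>i\<in>UNIV. b i * (of_int (x $ i) + 0))))"
      unfolding F_def qfx exp_d power_minus[of "complex_of_real (exp (- pi / t))"] sgn[symmetric] by (simp only: tt(1) of_real_power mult.commute)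
    also have "\<dots> = (\<Sum>\<^sub>\<infinity>x. of_real (exp (- pi * (1 / t) * qf UNIV A (\<lambda>i. of_int (x i) + 0)))
        * cis (2 * pi * (\<Sum>i\<in>UNIV. b i * (of_int (x i) + 0))))"
      by (rule infsum_reindex_bij_betw[OF bij_vec])
    also have "\<dots> = c * (1 / sqrt (1 / t)) ^ CARD('m) * (\<Sum>\<^sub>\<infinity>y. exp (- pi * Q' (\<lambda>i. of_int (y i) - b i) / (1 / t))
            * cis (2 * pi * (\<Sum>i\<in>UNIV. of_int (y i) * 0)))"
      using t by (intro poisson) simp
    also have "(\<Sum>\<^sub>\<infinity>y. exp (- pi * Q' (\<lambda>i. of_int (y i) - b i) / (1 / t)) * cis (2 * pi * (\<Sum>i\<in>UNIV. of_int (y i) * 0)))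
        = (\<Sum>\<^sub>\<infinity>x. exp (- pi * Q' (\<lambda>i. of_int ((Q *v x) $ i) - b i) / (1 / t)) * cis (2 * pi * (\<Sum>i\<in>UNIV. of_int ((Q *v x) $ i) * 0)))"
      by (rule infsum_reindex_bij_betw[OF bij_Q, symmetric])
    also have "\<dots> = (\<Sum>\<^sub>\<infinity>x. of_real (exp (- pi * m * t / 4)) * complex_of_real (exp (- pi * t)) ^ e x)"
      unfolding Q'b exp_e tt(2)
      by (simp only: of_real_mult of_real_power mult_zero_right sum.neutral_const cis_zero mult_1_right)
    also have "\<dots> = of_real (exp (- pi * m * t / 4)) * F2 (of_real (exp (- pi * t)))"
      unfolding F2_def by (rule infsum_cmult_right')
    finally show ?thesis using t c by (simp add: real_sqrt_divide mult_ac)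
  qed
  show ?thesis
  proof (rule that)
    show "theta_pair CARD('m) m F F2"
      unfolding theta_pair_def
    proof (intro conjI allI impI)
      show "F holomorphic_on ball 0 1" unfolding F_def by (rule counting_power_series(2)[OF summ_d])
      show "F2 holomorphic_on ball 0 1" unfolding F2_def by (rule counting_power_series(2)[OF summ_e])
      show "F2 (- q) = F2 q" for q unfolding F2_def using even_e by (simp add: power_minus_even)
      show "F (of_real (exp (- pi / t))) = of_real (sqrt t) ^ CARD('m) * F (of_real (exp (- pi * t)))" if "0 < t" for t
        using inv1[OF that] c by simp
    qed (use F0 inv2 in auto)
    have "(F has_field_derivative of_nat (card {x \<in> UNIV. d x = 1})) (at 0)"
      unfolding F_def by (rule counting_power_series(4)[OF summ_d])
    also have "{x \<in> UNIV. d x = 1} = {x. form Q x x = 1}"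
      using positive_definite_nonneg[OF pd] by (auto simp: d_def)
    finally show "(F has_field_derivative of_nat (card {x. form Q x x = 1})) (at 0)" .
  qed
qed

text \<open>The norms \<open>2 - 2 Q(u, v)\<close> and \<open>2 + 2 Q(u, v)\<close> of
  \<open>u - v\<close> and \<open>u + v\<close> are positive, which leaves 0 as the only integer
  value of \<open>Q(u, v)\<close>.\<close>

lemma unit_vectors_orthogonal:
  assumes "symmetric_form Q" "positive_definite Q" "form Q u u = 1" "form Q v v = 1" "u \<noteq> v" "u \<noteq> - v"
  shows "form Q u v = 0"
proof -
  have "form Q (u - v) (u - v) > 0" "form Q (u + v) (u + v) > 0"
    using assms by (auto simp: positive_definite_def eq_neg_iff_add_eq_0)
  then show ?thesis using assms(3,4) form_commute[OF assms(1), of v u] by (simp add: form_simps)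
qed

text \<open>Let \<open>m\<close> be the least norm of a characteristic vector. If it is at least the
  rank, the unit vectors fall into as many antipodal pairs as the rank, and one vector from each
  pair gives the orthonormal family. Otherwise the congruence modulo 8 sharpens \<open>m < N\<close>
  to \<open>m + 8 \<le> N\<close>.\<close>

theorem elkies:
  fixes Q :: "int^'m^'m"
  assumes sym: "symmetric_form Q" and pd: "positive_definite Q" and surj: "surj ((*v) Q)"
  shows "(\<exists>w. characteristic_vector Q w \<and> form Q w w + 8 \<le> int CARD('m))
    \<or> (\<exists>f :: 'm \<Rightarrow> int^'m. \<forall>i j. form Q (f i) (f j) = (if i = j then 1 else 0))"
proof (rule disjCI)
  assume nof: "\<nexists>f :: 'm \<Rightarrow> int^'m. \<forall>i j. form Q (f i) (f j) = (if i = j then 1 else 0)"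
  define m where "m = (LEAST k. \<exists>w. characteristic_vector Q w \<and> form Q w w = int k)"
  obtain w0 where "characteristic_vector Q w0" by (rule exists_characteristic_vector[OF sym surj])
  then have "characteristic_vector Q w0 \<and> form Q w0 w0 = int (nat (form Q w0 w0))"
    using positive_definite_nonneg[OF pd, of w0] by simp
  then have "\<exists>k w. characteristic_vector Q w \<and> form Q w w = int k" by blast
  then have "\<exists>w. characteristic_vector Q w \<and> form Q w w = int m"
    unfolding m_def by (rule LeastI_ex)
  then obtain w where w: "characteristic_vector Q w" "form Q w w = int m" by blast
  have min: "int m \<le> form Q v v" if v: "characteristic_vector Q v" for v
  proof -
    obtain k where k: "form Q v v = int k" using positive_definite_nonneg[OF pd, of v] by (rule nonneg_int_cases)
    then have "m \<le> k" unfolding m_def using v by (intro Least_le) auto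
    then show ?thesis using k by simp
  qed
  obtain F F2 where F: "theta_pair CARD('m) m F F2"
    "(F has_field_derivative of_nat (card {x. form Q x x = 1})) (at 0)"
    by (rule unimodular_theta_pair[OF sym pd surj w min])
  let ?U = "{x. form Q x x = 1}"
  have "\<not> CARD('m) \<le> m"
  proof
    assume "CARD('m) \<le> m"
    from theta_pair_count_unit_vectors[OF F(1) this F(2)] have cU: "card ?U = 2 * CARD('m)" .
    then have finU: "finite ?U" by (metis card.infinite mult_eq_0_iff zero_neq_numeral zero_less_card_finite less_irrefl)
    define C where "C = (\<lambda>u. {u, - u}) ` ?U"
    have UC: "\<Union> C = ?U" by (auto simp: C_def form_simps)
    have "2 * card C = card (\<Union> C)"
    proof (rule card_partition)
      show "finite C" unfolding C_def using finU by simp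
      show "finite (\<Union> C)" unfolding UC by (rule finU)
      show "card c = 2" if c: "c \<in> C" for c
      proof -
        obtain u where u: "form Q u u = 1" "c = {u, - u}" using c unfolding C_def by blast
        have "u \<noteq> - u"
        proof
          assume "u = - u"
          then have "form Q u u = form Q (- u) u" by (rule arg_cong[where f = "\<lambda>v. form Q v u"])
          then show False using u by (simp add: form_simps)
        qed
        then show ?thesis using u by simp
      qed
      show "c1 \<inter> c2 = {}" if "c1 \<in> C" "c2 \<in> C" "c1 \<noteq> c2" for c1 c2
        using that by (auto simp: C_def)
    qed
    then have "card C = CARD('m)" unfolding UC cU by simp
    moreover have "finite C" unfolding C_def using finU by simp
    ultimately obtain h where h: "bij_betw h (UNIV :: 'm set) C"
      using finite_same_card_bij[of "UNIV :: 'm set" C] by auto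
    define f where "f = (\<lambda>i. SOME u. u \<in> h i)"
    have hC: "h i \<in> C" for i using h by (auto simp: bij_betw_def)
    have fh: "f i \<in> h i" for i
    proof -
      have "h i \<noteq> {}" using hC[of i] by (auto simp: C_def)
      then show ?thesis unfolding f_def by (simp add: some_in_eq)
    qed
    have hf: "h i = {f i, - f i} \<and> form Q (f i) (f i) = 1" for i
    proof -
      obtain u where u: "form Q u u = 1" "h i = {u, - u}" using hC[of i] unfolding C_def by blast
      then consider "f i = u" | "f i = - u" using fh[of i] by blast
      then show ?thesis
      proof cases
        case 1
        then show ?thesis using u by simp
      next
        case 2
        then have "- f i = u" by simp
        with 2 u show ?thesis by (simp add: form_simps insert_commute)
      qed
    qed
    have h_eq: "h i = {f i, - f i}" for i by (rule conjunct1[OF hf])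
    have f1: "form Q (f i) (f i) = 1" for i by (rule conjunct2[OF hf])
    have "form Q (f i) (f j) = (if i = j then 1 else 0)" for i j
    proof (cases "i = j")
      case False
      then have "h i \<noteq> h j" using h by (auto simp: bij_betw_def inj_on_def)
      then have sets: "{f i, - f i} \<noteq> {f j, - f j}" by (simp only: h_eq[symmetric] not_False_eq_True)
      then have "f i \<noteq> f j" by (rule contrapos_nn) simp
      moreover from sets have "f i \<noteq> - f j" by (rule contrapos_nn) (simp add: insert_commute)
      ultimately show ?thesis using unit_vectors_orthogonal[OF sym pd f1 f1] False by simp
    qed (simp add: f1)
    then have "\<exists>f :: 'm \<Rightarrow> int^'m. \<forall>i j. form Q (f i) (f j) = (if i = j then 1 else 0)"
      by (intro exI[of _ f] allI)
    with nof show False by (rule notE)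
  qed
  moreover have "8 dvd (int m - int CARD('m))" by (rule rank_cong_norm_mod_8[OF F(1)])
  ultimately have "int m + 8 \<le> int CARD('m)" by presburger
  then show "\<exists>w. characteristic_vector Q w \<and> form Q w w + 8 \<le> int CARD('m)" using w by auto
qed

section \<open>Forms of determinant three\<close>

lemma scalar_product_simps:
  fixes x y z :: "'a::comm_ring_1^'n"
  shows "scalar_product (x + y) z = scalar_product x z + scalar_product y z"
    "scalar_product x (y + z) = scalar_product x y + scalar_product x z"
    "scalar_product (c *s x) z = c * scalar_product x z"
    "scalar_product x (c *s z) = c * scalar_product x z"
  by (simp_all add: scalar_product_def sum.distrib ring_distribs sum_distrib_left mult_ac)

lemma scalar_product_zero [simp]: "scalar_product 0 x = 0"
  by (simp add: scalar_product_def)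

lemma scalar_product_commute: "scalar_product x y = scalar_product y x" for x :: "'a::comm_ring_1^'n"
  by (simp add: scalar_product_def mult.commute)

lemma scalar_product_axis: "scalar_product (axis i 1) x = x $ i" for x :: "'a::comm_ring_1^'n"
  by (simp add: scalar_product_def axis_def if_distrib[of "\<lambda>a. a * _"] cong: if_cong)

lemma mult_axis: "(A *v axis i 1) $ j = A $ j $ i" for A :: "'a::comm_ring_1^'n^'m"
  by (simp add: matrix_vector_mult_def axis_def if_distrib cong: if_cong)

lemma transpose_mult_nth: "(transpose A *v u) $ i = (\<Sum>j\<in>UNIV. A $ j $ i * u $ j)"
  by (simp only: matrix_vector_mult_def transpose_def vec_lambda_beta)

lemma mult_smult: "A *v (c *s x) = c *s (A *v x)" for A :: "'a::comm_ring_1^'n^'m"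
  by (simp add: vec_eq_iff matrix_vector_mult_def sum_distrib_left mult_ac)

lemma mat_mult_vec: "mat c *v x = c *s x" for x :: "'a::comm_ring_1^'n"
  by (simp add: vec_eq_iff matrix_vector_mult_def mat_def if_distrib[of "\<lambda>a. a * _"] cong: if_cong)

section \<open>Integer matrices, the adjugate and the discriminant group\<close>

abbreviation rat_matrix :: "int^'n^'m \<Rightarrow> rat^'n^'m" where
  "rat_matrix \<equiv> map_matrix of_int"

lemma of_int_det: "of_int (det A) = det (rat_matrix A)"
  by (simp add: det_def)

lemma rat_matrix_mult: "rat_matrix (A ** B) = rat_matrix A ** rat_matrix B"
  by (simp add: vec_eq_iff matrix_matrix_mult_def)

lemma rat_matrix_mat: "rat_matrix (mat c) = mat (of_int c)"
  by (simp add: vec_eq_iff mat_def)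

lemma rat_matrix_eq_iff: "rat_matrix A = rat_matrix B \<longleftrightarrow> A = B"
  by (simp add: vec_eq_iff)

lemma int_matrix_left_right_inverse:
  fixes A B :: "int^'n^'n"
  assumes "A ** B = mat 1"
  shows "B ** A = mat 1"
proof -
  have "rat_matrix A ** rat_matrix B = mat 1"
    using assms by (simp flip: rat_matrix_mult add: rat_matrix_mat)
  then have "rat_matrix B ** rat_matrix A = mat 1" by (rule matrix_left_right_inverse1)
  then have "rat_matrix (B ** A) = rat_matrix (mat 1)" by (simp add: rat_matrix_mult rat_matrix_mat)
  then show ?thesis by (simp only: rat_matrix_eq_iff)
qed

text \<open>Cramer's rule for the rational solution \<open>v / c\<close>, with denominators
  cleared.\<close>

lemma int_cramer:
  fixes A :: "int^'n^'n"
  assumes "A *v v = c *s u" "c \<noteq> 0"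
  shows "c * det (\<chi> i j. if j = k then u $ i else A $ i $ j) = v $ k * det A"
proof -
  define x :: "rat^'n" where "x = (\<chi> i. of_int (v $ i) / of_int c)"
  have ux: "(rat_matrix A *v x) $ i = of_int (u $ i)" for i
  proof -
    have "(rat_matrix A *v x) $ i = of_int ((A *v v) $ i) / of_int c"
      by (simp add: matrix_vector_mult_def x_def sum_divide_distrib)
    then show ?thesis using assms by simp
  qed
  have "of_int (det (\<chi> i j. if j = k then u $ i else A $ i $ j))
      = det (\<chi> i j. if j = k then (rat_matrix A *v x) $ i else rat_matrix A $ i $ j)"
    unfolding of_int_det ux by (rule arg_cong[where f = det]) (simp add: vec_eq_iff)
  also have "\<dots> = of_int (v $ k) / of_int c * of_int (det A)"
    unfolding cramer_lemma of_int_det by (simp add: x_def)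
  finally have "of_int c * of_int (det (\<chi> i j. if j = k then u $ i else A $ i $ j)) = (of_int (v $ k * det A) :: rat)"
    using assms(2) by simp
  then show ?thesis by (simp only: of_int_eq_iff flip: of_int_mult)
qed

text \<open>\<open>B\<close> is the adjugate: \<open>c\<close> times the inverse, and integral
  because Cramer's rule gives its entries as determinants.\<close>

lemma exists_adjugate:
  fixes Q :: "int^'n^'n"
  assumes det: "det Q = c" "c \<noteq> 0"
  obtains B where "Q ** B = mat c" "B ** Q = mat c" "\<And>i j. matrix_inv (rat_matrix Q) $ i $ j = of_int (B $ i $ j) / of_int c"
proof -
  let ?R = "rat_matrix Q"
  have dR: "det ?R = of_int c" using det by (simp flip: of_int_det)
  then have "invertible ?R" using det by (simp add: invertible_det_nz)
  then have inv: "?R ** matrix_inv ?R = mat 1 \<and> matrix_inv ?R ** ?R = mat 1"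
    unfolding invertible_def matrix_inv_def by (rule someI_ex)
  define B :: "int^'n^'n" where "B = (\<chi> k l. det (\<chi> i j. if j = k then axis l 1 $ i else Q $ i $ j))"
  have B: "of_int (B $ k $ l) = of_int c * matrix_inv ?R $ k $ l" for k l
  proof -
    have "(?R *v (matrix_inv ?R *v axis l 1)) = axis l 1"
      by (simp add: matrix_vector_mul_assoc inv)
    then have "det (\<chi> i j. if j = k then axis l 1 $ i else ?R $ i $ j) = (matrix_inv ?R *v axis l 1) $ k * of_int c"
      using cramer_lemma[of k ?R "matrix_inv ?R *v axis l 1"] dR by (simp only:)
    moreover have "of_int (B $ k $ l) = det (\<chi> i j. if j = k then axis l 1 $ i else ?R $ i $ j)"
      unfolding B_def by (simp add: of_int_det) (rule arg_cong[where f = det], simp add: vec_eq_iff axis_def)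
    ultimately show ?thesis by (simp add: mult_axis)
  qed
  have BR: "matrix_inv ?R $ i $ j = of_int (B $ i $ j) / of_int c" for i j
    using B det by simp
  have "rat_matrix (Q ** B) = rat_matrix (mat c)"
  proof -
    have "rat_matrix (Q ** B) $ i $ j = of_int c * (?R ** matrix_inv ?R) $ i $ j" for i j
      by (simp add: matrix_matrix_mult_def B sum_distrib_left mult_ac)
    then show ?thesis unfolding conjunct1[OF inv] by (simp add: vec_eq_iff mat_def)
  qed
  moreover have "rat_matrix (B ** Q) = rat_matrix (mat c)"
  proof -
    have "rat_matrix (B ** Q) $ i $ j = of_int c * (matrix_inv ?R ** ?R) $ i $ j" for i j
      by (simp add: matrix_matrix_mult_def B sum_distrib_left mult_ac)
    then show ?thesis unfolding conjunct2[OF inv] by (simp add: vec_eq_iff mat_def)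
  qed
  ultimately show ?thesis using that BR by (simp only: rat_matrix_eq_iff)
qed

text \<open>The kernel of \<open>Q\<close> modulo \<open>3\<close> is at most one-dimensional, as \<open>9\<close> does not divide \<open>det Q\<close>: replacing
  two columns of \<open>Q\<close> by the vectors \<open>u\<close> below divides the determinant by \<open>9\<close>, up to a minor of \<open>(v, v')\<close>.\<close>

lemma null_vectors_mod_3:
  fixes Q :: "int^'n^'n" and v v' u u' :: "int^'n"
  assumes det: "det Q = 3" and v: "Q *v v = 3 *s u" and v': "Q *v v' = 3 *s u'"
  shows "3 dvd v $ i * v' $ j - v' $ i * v $ j"
proof -
  have main: "3 dvd (v $ i * v' $ j - v' $ i * v $ j) * v $ i" if "i \<noteq> j" for i j
  proof -
    define A1 where "A1 = (\<chi> a b. if b = i then u $ a else Q $ a $ b)"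
    have d1: "det A1 = v $ i"
      using int_cramer[OF v, of i] det by (simp add: A1_def)
    \<comment> \<open>Its coordinate \<open>i\<close> vanishes, so \<open>A1\<close>, which differs
      from \<open>Q\<close> only in column \<open>i\<close>, acts on it as \<open>Q\<close> does.
      Cramer's rule for \<open>A1\<close> then supplies a second factor 3.\<close>
    define v2 where "v2 = v $ i *s v' - v' $ i *s v"
    define u2 where "u2 = v $ i *s u' - v' $ i *s u"
    have "Q *v v2 = v $ i *s (Q *v v') - v' $ i *s (Q *v v)"
      by (simp only: v2_def matrix_vector_mult_diff_distrib mult_smult)
    also have "\<dots> = 3 *s u2" unfolding v v' u2_def by (simp add: vec_eq_iff algebra_simps)
    finally have "Q *v v2 = 3 *s u2" .
    moreover have "A1 *v v2 = Q *v v2"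
    proof -
      have v2i: "v2 $ i = 0" by (simp add: v2_def mult.commute)
      have "(A1 *v v2) $ a = (Q *v v2) $ a" for a
        unfolding matrix_vector_mult_def vec_lambda_beta
        by (rule sum.cong) (use v2i in \<open>auto simp: A1_def\<close>)
      then show ?thesis by (simp only: vec_eq_iff simp_thms)
    qed
    ultimately have "A1 *v v2 = 3 *s u2" by (rule trans[rotated])
    from int_cramer[OF this, of j]
    have "v2 $ j * det A1 = 3 * det (\<chi> a b. if b = j then u2 $ a else A1 $ a $ b)" by simp
    then have "v2 $ j * v $ i = 3 * det (\<chi> a b. if b = j then u2 $ a else A1 $ a $ b)" unfolding d1 .
    then have "3 dvd v2 $ j * v $ i" by (rule dvdI)
    then show ?thesis by (simp only: v2_def vector_minus_component vector_smult_component)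
  qed
  show ?thesis
  proof (cases "i = j")
    case False
    have p: "prime (3 :: int)" by simp
    have "v $ j * v' $ i - v' $ j * v $ i = - (v $ i * v' $ j - v' $ i * v $ j)" by (simp add: algebra_simps)
    \<comment> \<open>If 3 does not divide the minor, it divides both \<open>v $ i\<close> and
      \<open>v $ j\<close>, and hence the minor after all.\<close>
    then have "3 dvd (v $ i * v' $ j - v' $ i * v $ j) \<or> 3 dvd v $ i \<and> 3 dvd v $ j"
      using main[OF False] main[of j i] False prime_dvd_mult_iff[OF p]
      by (metis dvd_minus_iff)
    then show ?thesis by (auto intro: dvd_diff dvd_mult dvd_mult2)
  qed simp
qed

text \<open>\<open>B\<close> is three times the inverse of \<open>Q\<close>. A covector
  \<open>y\<close> is the rational vector \<open>B y / 3\<close>, which allows dual norms to be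
  computed in integers as \<open>Q(B y, B y) / 9\<close>.\<close>

locale det3_form =
  fixes Q B :: "int^'n^'n"
  assumes sym: "symmetric_form Q" and pd: "positive_definite Q" and det: "det Q = 3"
    and QB: "Q ** B = mat 3" and BQ: "B ** Q = mat 3"
    and inv: "matrix_inv (rat_matrix Q) $ i $ j = of_int (B $ i $ j) / 3"
begin

lemma QBv: "Q *v (B *v x) = 3 *s x" and BQv: "B *v (Q *v x) = 3 *s x"
  by (simp_all add: matrix_vector_mul_assoc QB BQ mat_mult_vec)

lemma B_sym: "B $ i $ j = B $ j $ i"
proof -
  have "transpose B ** Q = mat 3"
    using arg_cong[OF QB, of transpose] sym by (simp add: matrix_transpose_mul symmetric_form_def)
  then have "transpose B ** (Q ** B) = mat 3 ** B" by (simp add: matrix_mul_assoc)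
  then have "(transpose B ** mat 3) $ j $ i = (mat 3 ** B) $ j $ i" by (simp add: QB)
  then show ?thesis
    by (simp add: matrix_matrix_mult_def mat_def transpose_def if_distrib[of "\<lambda>a. a * _"] if_distrib[of "\<lambda>a. _ * a"] cong: if_cong)
qed

lemma form_cancel: "scalar_product x (Q *v y) = scalar_product (Q *v x) y"
  using form_commute[OF sym, of x y] by (simp add: form_def scalar_product_commute)

lemma dual_form_eq:
  assumes "z = B *v y"
  shows "dual_form Q y y = of_int (form Q z z) / 9"
proof -
  have "dual_form Q y y = (\<Sum>i\<in>UNIV. \<Sum>j\<in>UNIV. of_int (y $ i * B $ i $ j * y $ j) / 3)"
    by (simp add: dual_form_def form_eq_sum inv)
  also have "\<dots> = of_int (scalar_product y z) / 3"
    unfolding assms by (simp add: scalar_product_def matrix_vector_mult_def sum_distrib_left sum_divide_distrib mult_ac)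
  also have "scalar_product (3 *s y) z = form Q z z"
    unfolding form_def form_cancel[of z z] unfolding assms QBv by (simp add: scalar_product_commute)
  then have "3 * scalar_product y z = form Q z z" by (simp add: scalar_product_simps)
  then have "of_int (form Q z z) = (of_int (3 * scalar_product y z) :: rat)" by (simp only:)
  then have "of_int (scalar_product y z) / 3 = (of_int (form Q z z) / 9 :: rat)" by simp
  finally show ?thesis .
qed

text \<open>Modulo 3 the matrix \<open>B\<close> is not zero, since otherwise \<open>B / 3\<close>
  would be an integral inverse of \<open>Q\<close>, and all its minors of size 2 vanish. By symmetry
  the square of an entry at \<open>i\<close>, \<open>j\<close> is then the product of the diagonal
  entries at \<open>i\<close> and \<open>j\<close>, so a nonzero entry yields a nonzero diagonal
  entry.\<close>

lemma exists_diagonal_unit_mod_3: obtains i where "\<not> 3 dvd B $ i $ i"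
proof -
  have "\<exists>i j. \<not> 3 dvd B $ i $ j"
  proof (rule ccontr)
    assume "\<nexists>i j. \<not> 3 dvd B $ i $ j"
    then have dv: "B $ i $ j = 3 * (B $ i $ j div 3)" for i j by simp
    define C where "C = (\<chi> i j. B $ i $ j div 3)"
    have "3 * (Q ** C) $ i $ j = (Q ** B) $ i $ j" for i j
    proof -
      have "(Q ** B) $ i $ j = (\<Sum>k\<in>UNIV. Q $ i $ k * (3 * C $ k $ j))"
        unfolding matrix_matrix_mult_def by (simp add: C_def dv[symmetric])
      then show ?thesis by (simp add: matrix_matrix_mult_def sum_distrib_left mult.left_commute)
    qed
    then have "Q ** C = mat 1" unfolding QB by (simp add: vec_eq_iff mat_def) (metis mult_cancel_left1 mult_eq_0_iff zero_neq_numeral)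
    then have "det Q * det C = 1" using det_mul[of Q C] by simp
    then show False unfolding det by presburger
  qed
  then obtain i j where ij: "\<not> 3 dvd B $ i $ j" by blast
  have "3 dvd (B *v axis j 1) $ i * (B *v axis i 1) $ j - (B *v axis i 1) $ i * (B *v axis j 1) $ j"
    by (rule null_vectors_mod_3[OF det QBv QBv])
  then have d: "3 dvd B $ i $ j * B $ i $ j - B $ i $ i * B $ j $ j" using B_sym[of j i] by (simp add: mult_axis)
  have "\<not> 3 dvd B $ i $ i"
  proof
    assume "3 dvd B $ i $ i"
    then have "3 dvd B $ i $ i * B $ j $ j" by (rule dvd_mult2)
    with d have "3 dvd B $ i $ j * B $ i $ j" by (metis dvd_add diff_add_cancel)
    then show False using ij prime_dvd_mult_iff[of "3::int"] by simp
  qed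
  then show ?thesis using that by blast
qed

text \<open>The covector \<open>axis i 1\<close> has the dual norm \<open>B $ i $ i / 3\<close>,
  which is not an integer, so it is nonzero in the discriminant group of order 3 and generates
  it.\<close>

lemma discriminant_generated:
  assumes i: "\<not> 3 dvd B $ i $ i"
  obtains k x where "\<eta> = Q *v x + k *s axis i 1"
proof -
  define \<beta> where "\<beta> = B $ i $ i"
  have \<beta>2: "3 dvd \<beta> * \<beta> - 1"
  proof -
    define q where "q = \<beta> div 3"
    have "\<beta> = 3 * q + 1 \<or> \<beta> = 3 * q + 2" using i unfolding \<beta>_def q_def by presburger
    then have "\<beta> * \<beta> - 1 = 3 * (3 * q * q + 2 * q) \<or> \<beta> * \<beta> - 1 = 3 * (3 * q * q + 4 * q + 1)"
      by (auto simp: algebra_simps)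
    then show ?thesis by (metis dvd_triv_left)
  qed
  define v where "v = B *v axis i 1"
  define v' where "v' = B *v \<eta>"
  \<comment> \<open>Since \<open>\<beta> * \<beta>\<close> is 1 modulo 3, this choice makes
    \<open>z $ i\<close> divisible by 3; the vanishing minors extend this to every coordinate of
    \<open>z\<close>.\<close>
  define k where "k = v' $ i * \<beta>"
  define z where "z = v' - k *s v"
  have vi: "v $ i = \<beta>" by (simp add: v_def mult_axis \<beta>_def)
  have zi: "3 dvd z $ i"
  proof -
    have "z $ i = - (v' $ i * (\<beta> * \<beta> - 1))" by (simp add: z_def k_def vi algebra_simps)
    then show ?thesis using \<beta>2 by (simp add: dvd_mult)
  qed
  have zj: "3 dvd z $ j" for j
  proof -
    have n: "3 dvd v $ i * v' $ j - v' $ i * v $ j"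
      by (rule null_vectors_mod_3[OF det]) (auto simp: v_def v'_def QBv)
    have "z $ j * \<beta> = (v $ i * v' $ j - v' $ i * v $ j) + v $ j * z $ i"
      by (simp add: z_def vi algebra_simps)
    also have "3 dvd \<dots>" using n zi by (intro dvd_add dvd_mult)
    finally have "3 dvd z $ j * \<beta>" .
    then show ?thesis using i prime_dvd_mult_iff[of "3::int"] unfolding \<beta>_def by simp
  qed
  define x where "x = (\<chi> j. z $ j div 3)"
  have "z = 3 *s x" using zj by (simp add: vec_eq_iff x_def)
  then have "3 *s (Q *v x) = Q *v z" by (simp add: mult_smult)
  also have "\<dots> = 3 *s (\<eta> - k *s axis i 1)"
    by (simp add: z_def v_def v'_def matrix_vector_mult_diff_distrib mult_smult QBv vector_ssub_ldistrib vector_smult_assoc mult_ac)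
  finally have e: "3 *s (Q *v x) = 3 *s (\<eta> - k *s axis i 1)" .
  have "(Q *v x) $ j = (\<eta> - k *s axis i 1) $ j" for j
  proof -
    have "3 * (Q *v x) $ j = 3 * (\<eta> - k *s axis i 1) $ j"
      using arg_cong[OF e, of "\<lambda>u. u $ j"] by (simp only: vector_smult_component)
    then show ?thesis by linarith
  qed
  then have "Q *v x = \<eta> - k *s axis i 1" by (simp only: vec_eq_iff simp_thms)
  then show ?thesis using that[of x k] by simp
qed

end

section \<open>Bordered Gram matrices and orthonormal bases\<close>

definition ocons :: "'a \<Rightarrow> 'a^'n \<Rightarrow> 'a^('n option)" where
  "ocons k x = (\<chi> i. case i of None \<Rightarrow> k | Some j \<Rightarrow> x $ j)"

text \<open>The Gram matrix with blocks \<open>m\<close>, \<open>y\<close>, \<open>y\<^sup>T\<close> and \<open>Q\<close>.\<close>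

definition extend :: "'a \<Rightarrow> 'a^'n \<Rightarrow> 'a^'n^'n \<Rightarrow> 'a^('n option)^('n option)" where
  "extend m y Q = ocons (ocons m y) (\<chi> i. ocons (y $ i) (Q $ i))"

lemma ocons_nth [simp]: "ocons k x $ None = k" "ocons k x $ Some j = x $ j"
  by (simp_all add: ocons_def)

lemma ocons_cases: obtains k x where "z = ocons k x"
proof
  show "z = ocons (z $ None) (\<chi> j. z $ Some j)"
    by (simp add: vec_eq_iff split_option_all)
qed

lemma ocons_zero: "ocons 0 0 = 0"
  by (simp add: vec_eq_iff split_option_all)

lemma sum_option: "(\<Sum>i\<in>UNIV. f i) = f None + (\<Sum>j\<in>UNIV. f (Some j))" for f :: "'n::finite option \<Rightarrow> 'a::comm_monoid_add"
  by (simp add: UNIV_option_conv sum.reindex)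

lemma scalar_product_ocons: "scalar_product (ocons k x) (ocons l y) = k * l + scalar_product x y"
  by (simp add: scalar_product_def sum_option)

lemma extend_mult: "extend m y Q *v ocons k x = ocons (scalar_product y x + m * k) (Q *v x + k *s y)"
  for Q :: "'a::comm_ring_1^'n^'n"
  by (simp add: vec_eq_iff split_option_all matrix_vector_mult_def sum_option extend_def scalar_product_def mult.commute add.commute)

lemma form_extend: "form (extend m y Q) (ocons k x) (ocons l z)
    = form Q x z + k * scalar_product y z + l * scalar_product y x + m * k * l" for Q :: "'a::comm_ring_1^'n^'n"
  by (simp add: form_def extend_mult scalar_product_ocons scalar_product_simps scalar_product_commute[of x y] algebra_simps)

lemma symmetric_form_extend: "symmetric_form Q \<Longrightarrow> symmetric_form (extend m y Q)"
  by (simp add: symmetric_form_def vec_eq_iff split_option_all transpose_def extend_def)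

text \<open>With \<open>P\<close> the matrix of the family, \<open>transpose P ** Q\<close> is a
  left inverse of \<open>P\<close>, hence a two-sided one over the integers. So the family is a
  basis of the lattice itself, not only of the rational space.\<close>

lemma orthonormal_parseval:
  fixes Q :: "int^'m^'m" and f :: "'m \<Rightarrow> int^'m"
  assumes sym: "symmetric_form Q" and f: "\<And>i j. form Q (f i) (f j) = (if i = j then 1 else 0)"
  shows "form Q u v = (\<Sum>i\<in>UNIV. form Q (f i) u * form Q (f i) v)"
proof -
  define P where "P = (\<chi> i j. f j $ i)"
  have Pv: "P *v c = (\<Sum>j\<in>UNIV. c $ j *s f j)" for c
    by (simp add: vec_eq_iff matrix_vector_mult_def P_def mult.commute)
  have R: "((transpose P ** Q) *v w) $ i = form Q (f i) w" for w i
  proof -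
    have "((transpose P ** Q) *v w) $ i = (transpose P *v (Q *v w)) $ i"
      by (simp only: matrix_vector_mul_assoc)
    also have "\<dots> = (\<Sum>a\<in>UNIV. P $ a $ i * (Q *v w) $ a)"
      by (rule transpose_mult_nth)
    also have "\<dots> = form Q (f i) w" by (simp add: P_def form_def scalar_product_def)
    finally show ?thesis .
  qed
  have "(transpose P ** Q) ** P = mat 1"
  proof -
    have Pj: "P *v axis j 1 = f j" for j
      by (simp add: vec_eq_iff mult_axis P_def)
    have "((transpose P ** Q) ** P) $ i $ j = ((transpose P ** Q) *v (P *v axis j 1)) $ i" for i j
      by (simp only: matrix_vector_mul_assoc mult_axis)
    then show ?thesis by (simp add: vec_eq_iff Pj R f mat_def)
  qed
  from int_matrix_left_right_inverse[OF this] have "v = P *v ((transpose P ** Q) *v v)"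
    by (simp add: matrix_vector_mul_assoc)
  also have "\<dots> = (\<Sum>j\<in>UNIV. form Q (f j) v *s f j)" by (simp add: Pv R)
  finally have "form Q u v = form Q u (\<Sum>j\<in>UNIV. form Q (f j) v *s f j)" by simp
  then show ?thesis
    by (simp add: form_sum_right form_simps form_commute[OF sym, of u] mult.commute)
qed

lemma abs_less_if_square_less:
  fixes x c :: int
  assumes "0 \<le> c" "x * x < c * c"
  shows "\<bar>x\<bar> < c"
proof (rule ccontr)
  assume "\<not> \<bar>x\<bar> < c"
  then have "c * c \<le> \<bar>x\<bar> * \<bar>x\<bar>" using assms(1) by (intro mult_mono) auto
  then show False using assms(2) by simp
qed

section \<open>Gluing along the discriminant group\<close>

context det3_form
begin

context
  fixes i :: 'n and m :: int
  assumes i: "\<not> 3 dvd B $ i $ i"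
begin

text \<open>The added basis vector is the glue. Its projection to the rational span of
  \<open>Q\<close> is \<open>b / 3\<close>, the dual vector of the coordinate \<open>i\<close>, and
  its orthogonal part has the norm \<open>(3 * m - B $ i $ i) / 3\<close>, to be made
  \<open>1/3\<close> or \<open>2/3\<close> by the choice of \<open>m\<close>.\<close>

definition "glue1 = extend m (axis i 1) Q"

definition "b = B *v axis i 1"

lemma b: "Q *v b = 3 *s axis i 1" "b $ i = B $ i $ i"
  by (simp_all add: b_def QBv mult_axis)

lemma form_b: "form Q x b = 3 * x $ i"
proof -
  have "form Q x b = 3 * scalar_product (axis i 1) x"
    by (simp add: form_def b scalar_product_simps scalar_product_commute)
  then show ?thesis by (simp add: scalar_product_axis)
qed

lemma form_b_left: "form Q b x = 3 * x $ i"
  using form_b form_commute[OF sym] by simp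

lemma form_glue1: "form glue1 (ocons k x) (ocons l z) = form Q x z + k * z $ i + l * x $ i + m * k * l"
  by (simp add: glue1_def form_extend scalar_product_axis)

text \<open>The orthogonal decomposition of \<open>ocons k x\<close>, multiplied by 9 to stay within
  the integers.\<close>

lemma nine_form_glue1: "9 * form glue1 (ocons k x) (ocons k x)
    = form Q (3 *s x + k *s b) (3 *s x + k *s b) + 3 * (3 * m - B $ i $ i) * k^2"
  by (simp add: form_glue1 form_simps form_b form_b_left b(2) power2_eq_square algebra_simps)

lemma symmetric_glue1: "symmetric_form glue1"
  unfolding glue1_def by (rule symmetric_form_extend[OF sym])

text \<open>The projection of \<open>ocons k x\<close> to the rational span of \<open>Q\<close>,
  written as a covector.\<close>

definition "covec k x = Q *v x + k *s axis i 1"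

lemma scalar_product_covec: "scalar_product (covec k x) \<xi> = form glue1 (ocons k x) (ocons 0 \<xi>)"
proof -
  have "scalar_product (covec k x) \<xi> = scalar_product (Q *v x) \<xi> + k * \<xi> $ i"
    by (simp add: covec_def scalar_product_simps scalar_product_axis)
  moreover have "form Q x \<xi> = scalar_product (Q *v x) \<xi>" by (simp add: form_def form_cancel)
  ultimately show ?thesis by (simp add: form_glue1)
qed

lemma dual_form_covec: "dual_form Q (covec k x) (covec k x)
    = of_int (form glue1 (ocons k x) (ocons k x)) - of_int ((3 * m - B $ i $ i) * k^2) / 3"
proof -
  have "B *v covec k x = 3 *s x + k *s b"
    by (simp add: covec_def matrix_vector_right_distrib mult_smult BQv b_def)
  then have "dual_form Q (covec k x) (covec k x) = of_int (form Q (3 *s x + k *s b) (3 *s x + k *s b)) / 9"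
    by (intro dual_form_eq) simp
  also have "form Q (3 *s x + k *s b) (3 *s x + k *s b)
      = 9 * form glue1 (ocons k x) (ocons k x) - 3 * (3 * m - B $ i $ i) * k^2"
    using nine_form_glue1[of k x] by simp
  finally show ?thesis by (simp add: diff_divide_distrib)
qed

text \<open>The vector \<open>ocons 3 (- b)\<close> is orthogonal to \<open>Q\<close>, so adding
  multiples of it does not change the projection.\<close>

lemma covec_shift: "covec (k + 3 * s) (x - s *s b) = covec k x"
  by (simp add: covec_def matrix_vector_mult_diff_distrib mult_smult b vec_eq_iff algebra_simps)

lemma glue1_mult: "glue1 *v ocons k x = ocons (x $ i + m * k) (covec k x)"
  by (simp add: glue1_def extend_mult scalar_product_axis covec_def)

end

text \<open>Gluing with the lattice generated by one vector of norm \<open>3\<close>.\<close>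

lemma case_two_mod_3:
  assumes i: "B $ i $ i mod 3 = 2"
  shows "\<exists>y. characteristic_covector Q y \<and> dual_form Q y y < of_nat CARD('n) - 2 / 3"
proof -
  have i': "\<not> 3 dvd B $ i $ i" using i by presburger
  \<comment> \<open>The orthogonal part of the glue receives the norm \<open>1/3\<close>, so that
    three times it is a vector of norm 3.\<close>
  define m where "m = (B $ i $ i + 1) div 3"
  have m: "3 * m - B $ i $ i = 1" using i unfolding m_def by presburger
  define L where "L = glue1 i m"
  note form_L = form_glue1[OF i', of m, folded L_def]
  have symL: "symmetric_form L" unfolding L_def by (rule symmetric_glue1[OF i'])
  have nine: "9 * form L (ocons k x) (ocons k x)
    = form Q (3 *s x + k *s b i) (3 *s x + k *s b i) + 3 * k^2" for k x
    using nine_form_glue1[OF i', of m k x] by (simp add: L_def m)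
  have pdL: "positive_definite L"
    unfolding positive_definite_def
  proof (intro allI impI)
    fix z :: "int^'n option" assume z: "z \<noteq> 0"
    obtain k x where kx: "z = ocons k x" by (rule ocons_cases)
    have "form Q (3 *s x + k *s b i) (3 *s x + k *s b i) + 3 * k^2 > 0"
    proof (cases "k = 0")
      case True
      then have "x \<noteq> 0" using z kx by (auto simp: ocons_zero)
      then show ?thesis using True pd by (simp add: positive_definite_def)
    next
      case False
      then show ?thesis using positive_definite_nonneg[OF pd, of "3 *s x + k *s b i"] by (simp add: add_nonneg_pos)
    qed
    then show "form L z z > 0" using nine[of k x] unfolding kx by simp
  qed
  have surjL: "surj ((*v) L)"
    unfolding surj_def
  proof
    fix z :: "int^'n option"
    obtain h \<eta> where z: "z = ocons h \<eta>" by (rule ocons_cases)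
    obtain k x where \<eta>: "\<eta> = Q *v x + k *s axis i 1" by (rule discriminant_generated[OF i'])
    \<comment> \<open>Each multiple of \<open>ocons 3 (- b i)\<close> leaves the covector alone and
      raises the first coordinate by \<open>3 * m - B $ i $ i = 1\<close>.\<close>
    define s where "s = h - x $ i - m * k"
    have "L *v ocons (k + 3 * s) (x - s *s b i) = ocons ((x - s *s b i) $ i + m * (k + 3 * s)) (covec i k x)"
      unfolding L_def glue1_mult[OF i'] covec_shift[OF i'] ..
    also have "(x - s *s b i) $ i + m * (k + 3 * s) = x $ i + m * k + s * (3 * m - B $ i $ i)"
      by (simp add: b[OF i'] algebra_simps)
    also have "\<dots> = h" unfolding m by (simp add: s_def)
    also have "covec i k x = \<eta>" by (simp add: covec_def[OF i'] \<eta>)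
    finally show "\<exists>x. z = L *v x" unfolding z by metis
  qed
  have char: "characteristic_covector Q (covec i k x)" if "characteristic_vector L (ocons k x)" for k x
    unfolding characteristic_covector_def
  proof
    fix \<xi>
    have "[form L (ocons k x) (ocons 0 \<xi>) = form L (ocons 0 \<xi>) (ocons 0 \<xi>)] (mod 2)"
      using that by (simp add: characteristic_vector_def)
    then show "[scalar_product (covec i k x) \<xi> = form Q \<xi> \<xi>] (mod 2)"
      unfolding scalar_product_covec[OF i', where m = m] L_def by (simp add: form_glue1[OF i'])
  qed
  have dual: "dual_form Q (covec i k x) (covec i k x) = of_int (form L (ocons k x) (ocons k x)) - of_int (k^2) / 3" for k x
    using dual_form_covec[OF i', where m = m and k = k and x = x] by (simp add: L_def m)
  from elkies[OF symL pdL surjL] show ?thesis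
  proof (elim disjE exE conjE)
    fix w assume w: "characteristic_vector L w" "form L w w + 8 \<le> int CARD('n option)"
    obtain k x where kx: "w = ocons k x" by (rule ocons_cases)
    have "form L w w + 8 \<le> int CARD('n) + 1" using w(2) by (simp add: card_option)
    then have "of_int (form L w w + 8) \<le> (of_int (int CARD('n) + 1) :: rat)" by (simp only: of_int_le_iff)
    then have "of_int (form L w w) + 8 \<le> (of_nat CARD('n) + 1 :: rat)" by simp
    moreover have "of_int (k^2) / 3 \<ge> (0::rat)" by simp
    ultimately have "dual_form Q (covec i k x) (covec i k x) < of_nat CARD('n) - 2 / 3"
      unfolding dual kx by linarith
    then show ?thesis using char w(1) kx by blast
  next
    fix f :: "'n option \<Rightarrow> int^'n option"
    assume "\<forall>i j. form L (f i) (f j) = (if i = j then 1 else 0)"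
    then have f: "form L (f i) (f j) = (if i = j then 1 else 0)" for i j by blast
    note parseval = orthonormal_parseval[OF symL f]
    \<comment> \<open>The vector of norm 3 orthogonal to \<open>Q\<close>; pairing with it reads off
      the component \<open>k\<close>.\<close>
    define e where "e = ocons 3 (- b i)"
    have e: "form L e (ocons k x) = k" for k x
    proof -
      have "form L e (ocons k x) = k * (3 * m - B $ i $ i)"
        unfolding e_def form_L by (simp add: form_simps form_b_left[OF i'] b[OF i'] algebra_simps)
      then show ?thesis by (simp add: m)
    qed
    define a where "a = (\<lambda>j. form L (f j) e)"
    have a2: "(\<Sum>j\<in>UNIV. a j * a j) = 3"
      using parseval[of e e] e[of 3 "- b i"] by (simp add: a_def flip: e_def)
    have a1: "\<bar>a j\<bar> = a j * a j" for j
    proof -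
      have "a j * a j \<le> (\<Sum>j\<in>UNIV. a j * a j)" by (rule member_le_sum) auto
      then have "a j * a j < 2 * 2" unfolding a2 by simp
      then have "\<bar>a j\<bar> < 2" by (rule abs_less_if_square_less[rotated]) simp
      then have "a j = -1 \<or> a j = 0 \<or> a j = 1" by linarith
      then show ?thesis by auto
    qed
    \<comment> \<open>In the orthonormal basis, \<open>e\<close> has three coordinates
      \<open>\<plusminus>1\<close>. Signs that agree with them give \<open>k = 3\<close> and the
      dual norm \<open>n + 1 - 9/3\<close>; other signs may give \<open>k = 1\<close>, and
      \<open>n + 1 - 1/3\<close> is too large.\<close>
    define \<epsilon> where "\<epsilon> = (\<lambda>j. if a j < 0 then - 1 else 1 :: int)"
    define w where "w = (\<Sum>j\<in>UNIV. \<epsilon> j *s f j)"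
    have fw: "form L w z = (\<Sum>j\<in>UNIV. \<epsilon> j * form L (f j) z)" for z
      by (simp add: w_def form_sum_left form_simps)
    have fjw: "form L (f j) w = \<epsilon> j" for j
      by (simp add: w_def form_sum_right form_simps f if_distrib cong: if_cong)
    have ww: "form L w w = int CARD('n) + 1"
    proof -
      have "form L w w = (\<Sum>j\<in>(UNIV :: 'n option set). 1 :: int)"
        unfolding fw fjw by (rule sum.cong) (auto simp: \<epsilon>_def)
      then show ?thesis by (simp add: card_option)
    qed
    have "form L w e = (\<Sum>j\<in>UNIV. \<bar>a j\<bar>)"
      unfolding fw by (rule sum.cong) (auto simp: \<epsilon>_def a_def)
    then have we: "form L w e = 3" unfolding a1 a2 .
    have charw: "characteristic_vector L w"
      unfolding characteristic_vector_def
    proof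
      fix \<xi>
      have "form L w \<xi> - form L \<xi> \<xi> = (\<Sum>j\<in>UNIV. \<epsilon> j * form L (f j) \<xi> - form L (f j) \<xi> * form L (f j) \<xi>)"
        unfolding fw parseval[of \<xi> \<xi>] by (simp add: sum_subtractf)
      also have "even \<dots>" by (rule dvd_sum) (auto simp: \<epsilon>_def)
      finally show "[form L w \<xi> = form L \<xi> \<xi>] (mod 2)" by (simp add: cong_iff_dvd_diff)
    qed
    obtain k x where kx: "w = ocons k x" by (rule ocons_cases)
    have k: "k = 3" using we e[of k x] form_commute[OF symL, of w e] kx by simp
    have "dual_form Q (covec i k x) (covec i k x) < of_nat CARD('n) - 2 / 3"
      unfolding dual using ww kx k by simp
    then show ?thesis using char charw kx by blast
  qed
qed

end

section \<open>Copies of the root lattice \<open>A2\<close> in a standard lattice\<close>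

lemma sum_squares_eq_2:
  fixes a :: "'a::finite \<Rightarrow> int"
  assumes "(\<Sum>i\<in>UNIV. a i * a i) = 2"
  obtains p q where "p \<noteq> q" "\<bar>a p\<bar> = 1" "\<bar>a q\<bar> = 1" "\<And>i. i \<noteq> p \<Longrightarrow> i \<noteq> q \<Longrightarrow> a i = 0"
proof -
  have abs1: "\<bar>x\<bar> = 1" if "x * x \<le> 2" "x \<noteq> 0" for x :: int
  proof -
    have "\<bar>x\<bar> < 2" by (rule abs_less_if_square_less) (use that in auto)
    then show ?thesis using that by linarith
  qed
  have sq1: "x * x = 1" if "\<bar>x\<bar> = 1" for x :: int using that by (auto simp: abs_if split: if_splits)
  have "\<exists>p. a p \<noteq> 0" by (rule ccontr) (use assms in simp)
  then obtain p where p: "a p \<noteq> 0" by blast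
  have split: "(\<Sum>i\<in>UNIV. a i * a i) = a p * a p + (\<Sum>i\<in>UNIV - {p}. a i * a i)"
    by (rule sum.remove) auto
  have nn: "(\<Sum>i\<in>A. a i * a i) \<ge> 0" for A by (rule sum_nonneg) auto
  have "a p * a p \<le> 2" using split nn[of "UNIV - {p}"] assms by linarith
  then have p1: "\<bar>a p\<bar> = 1" using p by (rule abs1)
  have rest: "(\<Sum>i\<in>UNIV - {p}. a i * a i) = 1" using split sq1[OF p1] assms by linarith
  have "\<exists>q\<in>UNIV - {p}. a q \<noteq> 0" by (rule ccontr) (use rest in simp)
  then obtain q where q: "q \<in> UNIV - {p}" "a q \<noteq> 0" by blast
  have split2: "(\<Sum>i\<in>UNIV - {p}. a i * a i) = a q * a q + (\<Sum>i\<in>UNIV - {p} - {q}. a i * a i)"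
    by (rule sum.remove) (use q in auto)
  have "a q * a q \<le> 2" using split2 nn[of "UNIV - {p} - {q}"] rest by linarith
  then have q1: "\<bar>a q\<bar> = 1" using q(2) by (rule abs1)
  have "(\<Sum>i\<in>UNIV - {p} - {q}. a i * a i) = 0" using split2 sq1[OF q1] rest by linarith
  then have "\<forall>i\<in>UNIV - {p} - {q}. a i * a i = 0" by (subst (asm) sum_nonneg_eq_0_iff) auto
  then have "a i = 0" if "i \<noteq> p" "i \<noteq> q" for i using that by auto
  then show ?thesis using that[of p q] q p1 q1 by blast
qed

text \<open>Each vector has exactly two nonzero entries, all of them odd. As the inner product is
  odd, the two supports meet in exactly one position, named \<open>q\<close>.\<close>

lemma two_roots_of_A2:
  fixes a b :: "'a::finite \<Rightarrow> int"
  assumes a: "(\<Sum>i\<in>UNIV. a i * a i) = 2" and b: "(\<Sum>i\<in>UNIV. b i * b i) = 2" and ab: "(\<Sum>i\<in>UNIV. a i * b i) = - 1"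
  obtains p q r where "p \<noteq> q" "q \<noteq> r" "p \<noteq> r" "\<bar>a p\<bar> = 1" "\<bar>a q\<bar> = 1" "\<bar>b q\<bar> = 1" "\<bar>b r\<bar> = 1"
    "\<And>i. i \<noteq> p \<Longrightarrow> i \<noteq> q \<Longrightarrow> a i = 0" "\<And>i. i \<noteq> q \<Longrightarrow> i \<noteq> r \<Longrightarrow> b i = 0"
proof -
  obtain p q where pq: "p \<noteq> q" "\<bar>a p\<bar> = 1" "\<bar>a q\<bar> = 1" "\<And>i. i \<noteq> p \<Longrightarrow> i \<noteq> q \<Longrightarrow> a i = 0"
    by (rule sum_squares_eq_2[OF a]) blast
  obtain s r where sr: "s \<noteq> r" "\<bar>b s\<bar> = 1" "\<bar>b r\<bar> = 1" "\<And>i. i \<noteq> s \<Longrightarrow> i \<noteq> r \<Longrightarrow> b i = 0"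
    by (rule sum_squares_eq_2[OF b]) blast
  have "(\<Sum>i\<in>UNIV. a i * b i) = (\<Sum>i\<in>{p, q}. a i * b i)"
    by (rule sum.mono_neutral_right) (use pq(4) in auto)
  then have e: "a p * b p + a q * b q = - 1" using ab pq(1) by simp
  have b_cases: "b i = 0 \<or> \<bar>b i\<bar> = 1" for i using sr by metis
  have odd_a: "odd (a p)" "odd (a q)" using pq(2,3) by presburger+
  have "odd (a p * b p + a q * b q)" unfolding e by simp
  then have "odd (b p + b q)" using odd_a by auto
  moreover have odd_b: "odd (b i)" if "b i \<noteq> 0" for i using b_cases[of i] that by presburger
  ultimately have "b p = 0 \<and> b q \<noteq> 0 \<or> b q = 0 \<and> b p \<noteq> 0"
    by (metis add.right_neutral add.left_neutral even_add even_zero)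
  then consider "b p = 0" "b q \<noteq> 0" | "b q = 0" "b p \<noteq> 0" by blast
  then show ?thesis
  proof cases
    case 1
    then consider "q = s" | "q = r" using sr(4) by blast
    then show ?thesis
    proof cases
      case 1
      note sr' = sr[folded 1]
      have ne: "p \<noteq> r" using \<open>b p = 0\<close> sr(3) by auto
      show ?thesis by (rule that[of p q r]) (rule pq sr' ne; assumption)+
    next
      case 2
      note sr' = sr[folded 2]
      have ne: "p \<noteq> s" "q \<noteq> s" using \<open>b p = 0\<close> sr(2) sr'(1) by auto
      have sw: "b i = 0" if "i \<noteq> q" "i \<noteq> s" for i using sr'(4)[OF that(2,1)] .
      show ?thesis by (rule that[of p q s]) (rule pq sr' ne sw; assumption)+
    qed
  next
    case 2
    have ne': "q \<noteq> p" using pq(1) by simp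
    have pq': "a i = 0" if "i \<noteq> q" "i \<noteq> p" for i using pq(4)[OF that(2,1)] .
    consider "p = s" | "p = r" using sr(4)[of p] 2 by blast
    then show ?thesis
    proof cases
      case 1
      note sr' = sr[folded 1]
      have ne: "q \<noteq> r" using \<open>b q = 0\<close> sr(3) by auto
      show ?thesis by (rule that[of q p r]) (rule pq pq' ne' sr' ne; assumption)+
    next
      case 2
      note sr' = sr[folded 2]
      have ne: "q \<noteq> s" "p \<noteq> s" using \<open>b q = 0\<close> sr(2) sr'(1) by auto
      have sw: "b i = 0" if "i \<noteq> p" "i \<noteq> s" for i using sr'(4)[OF that(2,1)] .
      show ?thesis by (rule that[of q p s]) (rule pq pq' ne' sr' ne sw; assumption)+
    qed
  qed
qed

context det3_form
begin

text \<open>Gluing with the root lattice \<open>A\<^sub>2\<close>; if the result is \<open>\<int>\<^sup>n\<^sup>+\<^sup>2\<close>, then the roots of \<open>A\<^sub>2\<close> are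
  \<open>\<plusminus> f\<^sub>p \<plusminus> f\<^sub>q\<close> and \<open>\<plusminus> f\<^sub>q \<plusminus> f\<^sub>r\<close>, and their orthogonal complement is diagonal.\<close>

lemma case_one_mod_3:
  assumes i: "B $ i $ i mod 3 = 1"
  shows "(\<exists>y. characteristic_covector Q y \<and> dual_form Q y y < of_nat CARD('n) - 2 / 3)
    \<or> ((\<exists>x. characteristic_vector Q x \<and> form Q x x \<le> int CARD('n) + 2)
        \<or> (\<exists>y. characteristic_covector Q y \<and> dual_form Q y y \<le> of_nat CARD('n) - 2 / 3)) \<and> diagonal_form Q"
proof -
  have i': "\<not> 3 dvd B $ i $ i" using i by presburger
  \<comment> \<open>Now the orthogonal part of the glue receives the norm \<open>2/3\<close>, the
    least nonzero norm in the dual of \<open>A2\<close>.\<close>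
  define m where "m = (B $ i $ i + 2) div 3"
  have m: "3 * m - B $ i $ i = 2" using i unfolding m_def by presburger
  define L1 where "L1 = glue1 i m"
  \<comment> \<open>\<open>L1\<close> alone has determinant \<open>3 * m - B $ i $ i = 2\<close>.
    The second new vector has norm 2, is orthogonal to \<open>Q\<close> and pairs to 1 with the
    glue: it is a root of \<open>A2\<close>.\<close>
  define L where "L = extend 2 (ocons 1 0) L1"
  define vec where "vec = (\<lambda>l k x. ocons l (ocons k x) :: int^'n option option)"
  have vec_cases: "\<exists>l k x. z = vec l k x" for z unfolding vec_def by (metis ocons_cases)
  have form_L: "form L (vec l k x) (vec l' k' x')
      = form Q x x' + k * x' $ i + k' * x $ i + m * k * k' + l * k' + l' * k + 2 * l * l'" for l k x l' k' x'
    by (simp add: L_def vec_def form_extend scalar_product_ocons L1_def form_glue1[OF i'])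
  \<comment> \<open>The component of \<open>vec l k x\<close> orthogonal to \<open>Q\<close> has the
    norm \<open>2/3 * nq k l\<close>, which is what the projection loses.\<close>
  define nq where "nq = (\<lambda>k l :: int. k * k + 3 * k * l + 3 * l * l)"
  have symL: "symmetric_form L"
    unfolding L_def L1_def by (intro symmetric_form_extend symmetric_glue1[OF i'])
  have nine: "9 * form L (vec l k x) (vec l k x)
    = form Q (3 *s x + k *s b i) (3 *s x + k *s b i) + 6 * nq k l" for l k x
  proof -
    have "form L (vec l k x) (vec l k x) = form L1 (ocons k x) (ocons k x) + 2 * l * k + 2 * l * l"
      by (simp add: form_L L1_def form_glue1[OF i'])
    then show ?thesis using nine_form_glue1[OF i', of m k x] by (simp add: L1_def m nq_def power2_eq_square)
  qed
  have four: "4 * nq k l = (2 * k + 3 * l) * (2 * k + 3 * l) + 3 * (l * l)" for k l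
    by (simp add: nq_def algebra_simps)
  have q_nonneg: "nq k l \<ge> 0" for k l
  proof -
    have "0 \<le> 4 * nq k l" unfolding four by (intro add_nonneg_nonneg) auto
    then show ?thesis by simp
  qed
  have q_pos: "nq k l > 0" if "k \<noteq> 0 \<or> l \<noteq> 0" for k l
  proof -
    have "nq k l \<noteq> 0"
    proof
      assume "nq k l = 0"
      then have "(2 * k + 3 * l) * (2 * k + 3 * l) + 3 * (l * l) = 0" using four[of k l] by simp
      then have "(2 * k + 3 * l) * (2 * k + 3 * l) = 0 \<and> 3 * (l * l) = 0"
        by (subst (asm) add_nonneg_eq_0_iff) auto
      then show False using that by auto
    qed
    then show ?thesis using q_nonneg[of k l] by linarith
  qed
  have vec0: "vec 0 0 0 = 0" by (simp add: vec_def ocons_zero)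
  have pdL: "positive_definite L"
    unfolding positive_definite_def
  proof (intro allI impI)
    fix z :: "int^'n option option" assume z: "z \<noteq> 0"
    obtain l k x where kx: "z = vec l k x" using vec_cases by blast
    have "form Q (3 *s x + k *s b i) (3 *s x + k *s b i) + 6 * nq k l > 0"
    proof (cases "k = 0 \<and> l = 0")
      case True
      then have "x \<noteq> 0" using z kx by (auto simp: vec0)
      then show ?thesis using True pd by (simp add: positive_definite_def nq_def)
    next
      case False
      then have "nq k l > 0" by (intro q_pos) blast
      then show ?thesis using positive_definite_nonneg[OF pd, of "3 *s x + k *s b i"] by linarith
    qed
    then show "form L z z > 0" using nine[of l k x] unfolding kx by linarith
  qed
  have surjL: "surj ((*v) L)"
    unfolding surj_def
  proof
    fix z :: "int^'n option option"
    obtain p h \<eta> where z: "z = vec p h \<eta>" using vec_cases by blast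
    obtain k x where \<eta>: "\<eta> = Q *v x + k *s axis i 1" by (rule discriminant_generated[OF i'])
    define c where "c = x $ i + m * k"
    \<comment> \<open>Together with \<open>l\<close> this solves \<open>c + 2 * s + l = h\<close>
      and \<open>k + 3 * s + 2 * l = p\<close>, a system of determinant 1.\<close>
    define s where "s = k + 2 * h - 2 * c - p"
    define l where "l = h - c - 2 * s"
    have "L *v vec l (k + 3 * s) (x - s *s b i)
        = vec ((k + 3 * s) + 2 * l) ((x - s *s b i) $ i + m * (k + 3 * s) + l) (covec i k x)"
      unfolding L_def vec_def extend_mult L1_def glue1_mult[OF i'] covec_shift[OF i'] scalar_product_ocons
      by (simp add: vec_eq_iff split_option_all)
    also have "(x - s *s b i) $ i + m * (k + 3 * s) + l = c + s * (3 * m - B $ i $ i) + l"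
      by (simp add: b[OF i'] c_def algebra_simps)
    also have "\<dots> = h" unfolding m by (simp add: l_def)
    also have "(k + 3 * s) + 2 * l = p" by (simp add: l_def s_def)
    also have "covec i k x = \<eta>" by (simp add: covec_def[OF i'] \<eta>)
    finally have "z = L *v vec l (k + 3 * s) (x - s *s b i)" unfolding z by simp
    then show "\<exists>x. z = L *v x" by blast
  qed
  have embed: "form L (vec 0 0 x) (vec 0 0 x') = form Q x x'" for x x'
    by (simp add: form_L)
  have char: "characteristic_covector Q (covec i k x)" if "characteristic_vector L (vec l k x)" for l k x
    unfolding characteristic_covector_def
  proof
    fix \<xi>
    have "[form L (vec l k x) (vec 0 0 \<xi>) = form L (vec 0 0 \<xi>) (vec 0 0 \<xi>)] (mod 2)"
      using that by (simp add: characteristic_vector_def)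
    moreover have "form L (vec l k x) (vec 0 0 \<xi>) = scalar_product (covec i k x) \<xi>"
      unfolding scalar_product_covec[OF i', where m = m] by (simp add: form_L form_glue1[OF i'])
    ultimately show "[scalar_product (covec i k x) \<xi> = form Q \<xi> \<xi>] (mod 2)"
      unfolding embed by simp
  qed
  have dual: "3 * dual_form Q (covec i k x) (covec i k x)
      = of_int (3 * form L (vec l k x) (vec l k x) - 2 * nq k l)" for l k x
  proof -
    have "3 * form L (vec l k x) (vec l k x) - 2 * nq k l
        = 3 * form L1 (ocons k x) (ocons k x) - (3 * m - B $ i $ i) * k^2"
      unfolding m by (simp add: form_L L1_def form_glue1[OF i'] nq_def power2_eq_square algebra_simps)
    moreover have "3 * (of_int F - of_int K / 3) = (of_int (3 * F - K) :: rat)" for F K :: int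
      by (simp add: algebra_simps)
    ultimately show ?thesis
      by (simp only: dual_form_covec[OF i', where m = m and k = k and x = x] L1_def)
  qed
  from elkies[OF symL pdL surjL] show ?thesis
  proof (elim disjE exE conjE)
    fix w assume w: "characteristic_vector L w" "form L w w + 8 \<le> int CARD('n option option)"
    obtain l k x where kx: "w = vec l k x" using vec_cases by blast
    have "3 * form L w w - 2 * nq k l \<le> 3 * int CARD('n) - 18"
      using w(2) q_nonneg[of k l] by (simp add: card_option)
    then have "of_int (3 * form L w w - 2 * nq k l) \<le> (of_int (3 * int CARD('n) - 18) :: rat)"
      by (simp only: of_int_le_iff)
    then have "3 * dual_form Q (covec i k x) (covec i k x) \<le> 3 * of_nat CARD('n) - 18"
      unfolding dual[of k x l] kx by simp
    then have "dual_form Q (covec i k x) (covec i k x) < of_nat CARD('n) - 2 / 3" by linarith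
    then show ?thesis using char[of l k x] w(1) kx by blast
  next
    fix f :: "'n option option \<Rightarrow> int^'n option option"
    assume "\<forall>i j. form L (f i) (f j) = (if i = j then 1 else 0)"
    then have f: "form L (f i) (f j) = (if i = j then 1 else 0)" for i j by blast
    note parseval = orthonormal_parseval[OF symL f]
    define \<alpha> where "\<alpha> = vec 1 0 0"
    \<comment> \<open>A base of the \<open>A2\<close> orthogonal to \<open>Q\<close>: the analogue
      of the vector \<open>e\<close> above, minus \<open>2 *s \<alpha>\<close>. The pairings with
      \<open>\<alpha>\<close> and \<open>\<beta>\<close> determine \<open>k\<close> and
      \<open>l\<close>.\<close>
    define \<beta> where "\<beta> = vec (- 2) 3 (- b i)"
    have \<alpha>: "form L \<alpha> (vec l k x) = k + 2 * l" for l k x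
      by (simp add: \<alpha>_def form_L)
    have \<beta>: "form L \<beta> (vec l k x) = - l" for l k x
    proof -
      have "form L \<beta> (vec l k x) = (3 * m - B $ i $ i) * k - 2 * k - l"
        unfolding \<beta>_def form_L by (simp add: form_simps form_b_left[OF i'] b[OF i'] algebra_simps)
      then show ?thesis by (simp add: m)
    qed
    have norms: "form L \<alpha> \<alpha> = 2" "form L \<beta> \<beta> = 2" "form L \<alpha> \<beta> = - 1"
      using \<alpha>[of 1 0 0] \<beta>[of "- 2" 3 "- b i"] \<alpha>[of "- 2" 3 "- b i"] by (simp_all flip: \<alpha>_def \<beta>_def)
    define w where "w = (\<Sum>j\<in>UNIV. f j)"
    have fw: "form L w z = (\<Sum>j\<in>UNIV. form L (f j) z)" for z
      by (simp add: w_def form_sum_left)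
    have fjw: "form L (f j) w = 1" for j
      by (simp add: w_def form_sum_right f)
    have ww: "form L w w = int CARD('n) + 2"
      unfolding fw fjw by (simp add: card_option)
    have charw: "characteristic_vector L w"
      unfolding characteristic_vector_def
    proof
      fix \<xi>
      have "form L w \<xi> - form L \<xi> \<xi> = (\<Sum>j\<in>UNIV. form L (f j) \<xi> - form L (f j) \<xi> * form L (f j) \<xi>)"
        unfolding fw parseval[of \<xi> \<xi>] by (simp add: sum_subtractf)
      also have "even \<dots>" by (rule dvd_sum) auto
      finally show "[form L w \<xi> = form L \<xi> \<xi>] (mod 2)" by (simp add: cong_iff_dvd_diff)
    qed
    obtain l k x where kx: "w = vec l k x" using vec_cases by blast
    \<comment> \<open>Roots have even norm, so the characteristic vector \<open>w\<close> pairs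
      evenly with them.\<close>
    have "even (form L \<beta> w)" "even (form L \<alpha> w)"
      using characteristic_vectorD[OF charw, of \<alpha>] characteristic_vectorD[OF charw, of \<beta>] norms
      by (simp_all add: form_commute[OF symL, of _ w])
    then have "even l" "even k" unfolding kx \<alpha> \<beta> by auto
    then obtain l1 k1 where lk: "l = 2 * l1" "k = 2 * k1" by (auto elim!: evenE)
    have short: "(\<exists>x. characteristic_vector Q x \<and> form Q x x \<le> int CARD('n) + 2)
        \<or> (\<exists>y. characteristic_covector Q y \<and> dual_form Q y y \<le> of_nat CARD('n) - 2 / 3)"
    proof (cases "k = 0")
      case True
      have "characteristic_vector Q x"
        unfolding characteristic_vector_def
      proof
        fix \<xi>
        have "[form L w (vec 0 0 \<xi>) = form L (vec 0 0 \<xi>) (vec 0 0 \<xi>)] (mod 2)"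
          using charw by (simp add: characteristic_vector_def)
        then show "[form Q x \<xi> = form Q \<xi> \<xi>] (mod 2)" unfolding kx True by (simp add: form_L)
      qed
      moreover have "form Q x x + 2 * (l * l) = int CARD('n) + 2"
        using ww unfolding kx True by (simp add: form_L)
      then have "form Q x x \<le> int CARD('n) + 2" using zero_le_square[of l] by linarith
      ultimately show ?thesis by blast
    next
      case False
      \<comment> \<open>Evenness of \<open>k\<close> and \<open>l\<close> makes
        \<open>nq k l\<close> a positive multiple of 4; the loss is at least \<open>8/3\<close>, and
        \<open>n + 2 - 8/3 = n - 2/3\<close>.\<close>
      have "nq k l = 4 * nq k1 l1"
        by (simp add: lk nq_def algebra_simps)
      moreover have "nq k1 l1 > 0" using False lk by (intro q_pos) auto
      ultimately have "nq k l \<ge> 4" by linarith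
      then have "3 * form L w w - 2 * nq k l \<le> 3 * int CARD('n) - 2"
        unfolding ww by (simp add: ring_distribs)
      then have "of_int (3 * form L w w - 2 * nq k l) \<le> (of_int (3 * int CARD('n) - 2) :: rat)"
        by (simp only: of_int_le_iff)
      then have "3 * dual_form Q (covec i k x) (covec i k x) \<le> 3 * of_nat CARD('n) - 2"
        unfolding dual[of k x l] kx by simp
      then have "dual_form Q (covec i k x) (covec i k x) \<le> of_nat CARD('n) - 2 / 3" by linarith
      then show ?thesis using char[of l k x] charw kx by blast
    qed
    define a where "a = (\<lambda>j. form L (f j) \<alpha>)"
    define c where "c = (\<lambda>j. form L (f j) \<beta>)"
    have sums: "(\<Sum>j\<in>UNIV. a j * a j) = 2" "(\<Sum>j\<in>UNIV. c j * c j) = 2" "(\<Sum>j\<in>UNIV. a j * c j) = - 1"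
      using parseval[of \<alpha> \<alpha>] parseval[of \<beta> \<beta>] parseval[of \<alpha> \<beta>] norms by (simp_all add: a_def c_def)
    obtain p q r where pqr: "p \<noteq> q" "q \<noteq> r" "p \<noteq> r" "\<bar>a p\<bar> = 1" "\<bar>a q\<bar> = 1" "\<bar>c q\<bar> = 1" "\<bar>c r\<bar> = 1"
      "\<And>i. i \<noteq> p \<Longrightarrow> i \<noteq> q \<Longrightarrow> a i = 0" "\<And>i. i \<noteq> q \<Longrightarrow> i \<noteq> r \<Longrightarrow> c i = 0"
      by (rule two_roots_of_A2[OF sums]) blast
    have sq: "a p * a p = 1" "c r * c r = 1" using pqr(4,7) by (metis abs_mult_self_eq mult_1)+
    \<comment> \<open>The combination of \<open>f p\<close>, \<open>f q\<close> and
      \<open>f r\<close> that is orthogonal to both roots, normalised to the coefficient 1 at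
      \<open>q\<close>.\<close>
    define v where "v = (- a p * a q) *s f p + f q + (- c q * c r) *s f r"
    have fv: "form L (f j) v = (if j = p then - a p * a q else if j = q then 1 else if j = r then - c q * c r else 0)" for j
      using pqr(1-3) by (simp add: v_def form_simps f)
    have "form L v \<alpha> = - (a p * a p) * a q + a q"
      using pqr(8)[of r] pqr(1-3) by (simp add: v_def form_simps flip: a_def) (simp add: a_def)
    then have v\<alpha>: "form L v \<alpha> = 0" using sq by simp
    have "form L v \<beta> = c q - c q * (c r * c r)"
      using pqr(9)[of p] pqr(1-3) by (simp add: v_def form_simps flip: c_def) (simp add: c_def)
    then have v\<beta>: "form L v \<beta> = 0" using sq by simp
    have in_Q: "\<exists>x. z = vec 0 0 x" if "form L z \<alpha> = 0" "form L z \<beta> = 0" for z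
    proof -
      obtain l k x where z: "z = vec l k x" using vec_cases by blast
      have "form L \<alpha> z = 0" "form L \<beta> z = 0" using that by (simp_all add: form_commute[OF symL, of _ z])
      then have "l = 0" "k = 0" unfolding z \<alpha> \<beta> by auto
      then show ?thesis using z by blast
    qed
    have "card (UNIV - {p, r} :: 'n option option set) = CARD('n)"
      using pqr(3) by (simp add: card_Diff_subset card_option)
    then obtain \<sigma> where \<sigma>: "bij_betw \<sigma> (UNIV :: 'n set) (UNIV - {p, r})"
      using finite_same_card_bij[of "UNIV :: 'n set" "UNIV - {p, r}"] by auto
    have \<sigma>_ne: "\<sigma> j \<noteq> p" "\<sigma> j \<noteq> r" for j using bij_betwE[OF \<sigma>] by auto
    have \<sigma>_inj: "\<sigma> j = \<sigma> j' \<longleftrightarrow> j = j'" for j j' using \<sigma> by (auto simp: bij_betw_def inj_on_def)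
    \<comment> \<open>The orthogonal complement of the roots: the \<open>f j\<close> with
      \<open>j\<close> outside \<open>{p, q, r}\<close>, together with \<open>v\<close>, which takes
      the index \<open>q\<close>.\<close>
    define g where "g = (\<lambda>j. if \<sigma> j = q then v else f (\<sigma> j))"
    have "\<exists>x. g j = vec 0 0 x" for j
    proof (rule in_Q)
      show "form L (g j) \<alpha> = 0"
        using v\<alpha> pqr(8)[OF \<sigma>_ne(1)] by (simp add: g_def a_def)
      show "form L (g j) \<beta> = 0"
        using v\<beta> pqr(9)[OF _ \<sigma>_ne(2)] by (simp add: g_def c_def)
    qed
    then obtain P where P: "\<And>j. g j = vec 0 0 (P j)" by metis
    have fg: "form L (f (\<sigma> j)) (g j') = (if j = j' then 1 else 0)" for j j'
      using \<sigma>_ne[of j] \<sigma>_inj[of j j'] by (auto simp: g_def fv f)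
    have gg: "form L (g j) (g j') = 0" if "j \<noteq> j'" for j j'
    proof (cases "\<sigma> j = q")
      case True
      then have "\<sigma> j' \<noteq> q" using \<sigma>_inj[of j j'] that by simp
      then have "form L (g j') (g j) = 0" using fg[of j' j] that by (simp add: g_def)
      then show ?thesis using form_commute[OF symL] by simp
    next
      case False
      then show ?thesis using fg[of j j'] that by (simp add: g_def)
    qed
    \<comment> \<open>The coordinates \<open>form L (f (\<sigma> j))\<close>, restricted to
      \<open>Q\<close>, are dual to \<open>g\<close>, because \<open>v\<close> has coefficient 1 at
      \<open>q\<close>. Hence \<open>M\<close> inverts \<open>PM\<close>, and \<open>g\<close> is an
      integral basis of \<open>Q\<close>, not merely an independent family.\<close>
    define M :: "int^'n^'n" where "M = (\<chi> j i. form L (f (\<sigma> j)) (vec 0 0 (axis i 1)))"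
    define PM :: "int^'n^'n" where "PM = (\<chi> i j. P j $ i)"
    have Mv: "(M *v x) $ j = form L (f (\<sigma> j)) (vec 0 0 x)" for x j
    proof -
      have "vec 0 0 x = (\<Sum>i\<in>UNIV. x $ i *s vec 0 0 (axis i 1))"
        by (simp add: vec_eq_iff split_option_all vec_def axis_def if_distrib cong: if_cong)
      then have "form L (f (\<sigma> j)) (vec 0 0 x) = (\<Sum>i\<in>UNIV. x $ i * form L (f (\<sigma> j)) (vec 0 0 (axis i 1)))"
        by (simp add: form_sum_right form_simps)
      then show ?thesis by (simp add: matrix_vector_mult_def M_def mult.commute)
    qed
    have PMj: "PM *v axis j 1 = P j" for j by (simp add: vec_eq_iff mult_axis PM_def)
    have "(M ** PM) $ j $ j' = (M *v (PM *v axis j' 1)) $ j" for j j'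
      by (simp only: matrix_vector_mul_assoc mult_axis)
    then have MP: "M ** PM = mat 1"
      by (simp add: vec_eq_iff PMj Mv flip: P) (simp add: fg mat_def)
    have "invertible PM"
      unfolding invertible_def using MP int_matrix_left_right_inverse[OF MP] by blast
    moreover have "diagonal_matrix (transpose PM ** Q ** PM)"
      unfolding diagonal_matrix_def
    proof (intro allI impI)
      fix j j' :: 'n assume "j \<noteq> j'"
      have "(transpose PM ** Q ** PM) $ j $ j' = (transpose PM *v (Q *v (PM *v axis j' 1))) $ j"
        by (simp only: matrix_vector_mul_assoc matrix_mul_assoc mult_axis)
      also have "\<dots> = form Q (P j) (P j')"
        unfolding PMj transpose_mult_nth by (simp add: form_def scalar_product_def PM_def)
      also have "\<dots> = form L (g j) (g j')" by (simp add: P embed)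
      finally show "(transpose PM ** Q ** PM) $ j $ j' = 0" using gg[OF \<open>j \<noteq> j'\<close>] by simp
    qed
    ultimately have "diagonal_form Q" unfolding diagonal_form_def same_form_def by blast
    with short show ?thesis by blast
  qed
qed

end

theorem theorem3p1:
  fixes Q :: "int^'n^'n"
  assumes "symmetric_form Q"
    and "positive_definite Q"
    and "det Q = 3"
  shows "((\<exists>x. characteristic_vector Q x \<and> form Q x x \<le> int CARD('n) + 2) \<or>
          (\<exists>y. characteristic_covector Q y \<and> dual_form Q y y \<le> of_nat CARD('n) - 2 / 3)) \<and>
         (\<not> diagonal_form Q \<longrightarrow>
          (\<exists>x. characteristic_vector Q x \<and> form Q x x < int CARD('n) + 2) \<or>
          (\<exists>y. characteristic_covector Q y \<and> dual_form Q y y < of_nat CARD('n) - 2 / 3))"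
proof -
  obtain B where B: "Q ** B = mat 3" "B ** Q = mat 3"
    "\<And>i j. matrix_inv (rat_matrix Q) $ i $ j = of_int (B $ i $ j) / of_int 3"
    using exists_adjugate[OF assms(3)] by (metis zero_neq_numeral)
  interpret det3_form Q B
    by unfold_locales (use assms B in simp_all)
  obtain i where "\<not> 3 dvd B $ i $ i" by (rule exists_diagonal_unit_mod_3)
  \<comment> \<open>Residue 2 always gives the strict bound for a covector; diagonality is an issue
    for residue 1 only.\<close>
  then have "B $ i $ i mod 3 = 1 \<or> B $ i $ i mod 3 = 2" by presburger
  then consider "B $ i $ i mod 3 = 1" | "B $ i $ i mod 3 = 2" by blast
  then show ?thesis
  proof cases
    case 1
    from case_one_mod_3[OF this] show ?thesis using less_imp_le by blast
  next
    case 2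
    from case_two_mod_3[OF this] show ?thesis using less_imp_le by blast
  qed
qed

end
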